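(* Let $R$ be a commutative ring which either is $\mathrm J$-regular or verifies the primitive condition. Then the Picard group of $R$ is $0$. Moreover, over such a ring $R$, every finitely generated projective module of finite constant (local) rank is free.
   Context: All rings are commutative, unital and nonzero. A ring $R$ is $\mathrm J$-regular if $R/\mathrm J(R)$ is von Neumann regular (for each $x$ there is $y$ with $x^2y=x$), where $\mathrm J(R)$ is the Jacobson radical of $R$. A ring $R$ verifies the primitive condition if for each polynomial $p(X)\in R[X]$ whose content (the ideal generated by its coefficients) is $R$, there is some $x\in R$ such that $p(x)$ is a unit of $R$. *)

theory Defs
  imports
    "HOL-Algebra.Polynomials"
    "HOL-Algebra.Elementary_Groups"
    "Jordan_Normal_Form.Missing_VectorSpace"
begin

section \<open>The two ring conditions\<close>

text \<open>For a nonzero commutative ring this is the intersection of all maximal ideals; spelling out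
  membership in the carrier only matters for the zero ring.\<close>

definition jacobson_radical :: "('a, 'r) ring_scheme \<Rightarrow> 'a set" where
  "jacobson_radical R = {x \<in> carrier R. \<forall>I. maximalideal I R \<longrightarrow> x \<in> I}"

definition von_neumann_regular :: "('a, 'r) ring_scheme \<Rightarrow> bool" where
  "von_neumann_regular R \<longleftrightarrow>
     (\<forall>x \<in> carrier R. \<exists>y \<in> carrier R. (x \<otimes>\<^bsub>R\<^esub> x) \<otimes>\<^bsub>R\<^esub> y = x)"

definition J_regular :: "('a, 'r) ring_scheme \<Rightarrow> bool" where
  "J_regular R \<longleftrightarrow> von_neumann_regular (R Quot (jacobson_radical R))"

text \<open>Polynomials are coefficient lists here, so that the set of entries of the list generates
  the content ideal.\<close>

definition primitive_condition :: "('a, 'r) ring_scheme \<Rightarrow> bool" where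
  "primitive_condition R \<longleftrightarrow>
     (\<forall>p \<in> carrier (univ_poly R (carrier R)).
        genideal R (set p) = carrier R \<longrightarrow> (\<exists>x \<in> carrier R. ring.eval R p x \<in> Units R))"


section \<open>Modules\<close>

text \<open>The fields \<open>mult\<close> and \<open>one\<close> of a module record carry no information; in the modules
  constructed below that are not rings they are given dummy values.\<close>

definition regular_module :: "('a, 'r) ring_scheme \<Rightarrow> ('a, 'a) module" where
  "regular_module R =
     \<lparr>carrier = carrier R, mult = mult R, one = one R, zero = zero R, add = add R,
      smult = mult R\<rparr>"

definition module_isomorphic ::
  "('a, 'r) ring_scheme \<Rightarrow> ('a, 'b, 'm) module_scheme \<Rightarrow> ('a, 'c, 'n) module_scheme \<Rightarrow> bool" where
  "module_isomorphic R M N \<longleftrightarrow>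
     (\<exists>f \<in> module_hom R M N. bij_betw f (carrier M) (carrier N))"

definition finitely_generated ::
  "('a, 'r) ring_scheme \<Rightarrow> ('a, 'b, 'm) module_scheme \<Rightarrow> bool" where
  "finitely_generated R M \<longleftrightarrow>
     (\<exists>A. finite A \<and> A \<subseteq> carrier M \<and> module.span R M A = carrier M)"

definition is_basis ::
  "('a, 'r) ring_scheme \<Rightarrow> ('a, 'b, 'm) module_scheme \<Rightarrow> 'b set \<Rightarrow> bool" where
  "is_basis R M B \<longleftrightarrow>
     B \<subseteq> carrier M \<and> \<not> module.lin_dep R M B \<and> module.span R M B = carrier M"

definition is_free :: "('a, 'r) ring_scheme \<Rightarrow> ('a, 'b, 'm) module_scheme \<Rightarrow> bool" where
  "is_free R M \<longleftrightarrow> module R M \<and> (\<exists>B. is_basis R M B)"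

definition is_free_of_rank ::
  "('a, 'r) ring_scheme \<Rightarrow> ('a, 'b, 'm) module_scheme \<Rightarrow> nat \<Rightarrow> bool" where
  "is_free_of_rank R M n \<longleftrightarrow>
     module R M \<and> (\<exists>B. is_basis R M B \<and> finite B \<and> card B = n)"

text \<open>The free module \<open>R\<^sup>(\<^sup>I\<^sup>)\<close> of finitely supported functions from \<open>I\<close> to \<open>R\<close>.\<close>

definition free_module :: "('a, 'r) ring_scheme \<Rightarrow> 'i set \<Rightarrow> ('a, 'i \<Rightarrow> 'a) module" where
  "free_module R I =
     (ring.func_space R I)
       \<lparr>carrier := {f \<in> I \<rightarrow>\<^sub>E carrier R. finite {i \<in> I. f i \<noteq> \<zero>\<^bsub>R\<^esub>}}\<rparr>"

text \<open>A module is projective if it is a direct summand of a free module. The types of the index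
  set and of the complement are no restriction: a projective module \<open>M\<close> is a direct summand of
  \<open>R\<^sup>(\<^sup>M\<^sup>)\<close>, with the kernel of \<open>R\<^sup>(\<^sup>M\<^sup>) \<rightarrow> M\<close> as a complement.\<close>

definition projective :: "('a, 'r) ring_scheme \<Rightarrow> ('a, 'b, 'm) module_scheme \<Rightarrow> bool" where
  "projective R M \<longleftrightarrow>
     module R M \<and>
     (\<exists>(I :: 'b set) (N :: ('a, 'b \<Rightarrow> 'a) module).
        module R N \<and> module_isomorphic R (direct_sum M N) (free_module R I))"


section \<open>Localization and local rank\<close>

text \<open>The fraction \<open>m/s\<close> in \<open>S\<^sup>-\<^sup>1M\<close>, as an equivalence class of pairs.\<close>

definition fraction ::
  "'a set \<Rightarrow> ('a, 'b, 'm) module_scheme \<Rightarrow> 'b \<Rightarrow> 'a \<Rightarrow> ('b \<times> 'a) set" where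
  "fraction S M m s =
     {(n, t). n \<in> carrier M \<and> t \<in> S \<and>
        (\<exists>u \<in> S. u \<odot>\<^bsub>M\<^esub> (t \<odot>\<^bsub>M\<^esub> m) = u \<odot>\<^bsub>M\<^esub> (s \<odot>\<^bsub>M\<^esub> n))}"

text \<open>As in \<open>R Quot I\<close>, operations on classes are unions over all representatives; each such
  union consists of equal classes.\<close>

definition localized_ring :: "('a, 'r) ring_scheme \<Rightarrow> 'a set \<Rightarrow> ('a \<times> 'a) set ring" where
  "localized_ring R S =
     (let frac = fraction S (regular_module R) in
     \<lparr>carrier = {frac a s | a s. a \<in> carrier R \<and> s \<in> S},
      mult = (\<lambda>A B. \<Union>{frac (a \<otimes>\<^bsub>R\<^esub> b) (s \<otimes>\<^bsub>R\<^esub> t) | a s b t. (a, s) \<in> A \<and> (b, t) \<in> B}),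
      one = frac \<one>\<^bsub>R\<^esub> \<one>\<^bsub>R\<^esub>,
      zero = frac \<zero>\<^bsub>R\<^esub> \<one>\<^bsub>R\<^esub>,
      add = (\<lambda>A B. \<Union>{frac ((t \<otimes>\<^bsub>R\<^esub> a) \<oplus>\<^bsub>R\<^esub> (s \<otimes>\<^bsub>R\<^esub> b)) (s \<otimes>\<^bsub>R\<^esub> t) | a s b t.
                       (a, s) \<in> A \<and> (b, t) \<in> B})\<rparr>)"

definition localized_module ::
  "('a, 'r) ring_scheme \<Rightarrow> 'a set \<Rightarrow> ('a, 'b, 'm) module_scheme
     \<Rightarrow> (('a \<times> 'a) set, ('b \<times> 'a) set) module" where
  "localized_module R S M =
     (let frac = fraction S M in
     \<lparr>carrier = {frac m s | m s. m \<in> carrier M \<and> s \<in> S},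
      mult = (\<lambda>A B. frac \<zero>\<^bsub>M\<^esub> \<one>\<^bsub>R\<^esub>),
      one = frac \<zero>\<^bsub>M\<^esub> \<one>\<^bsub>R\<^esub>,
      zero = frac \<zero>\<^bsub>M\<^esub> \<one>\<^bsub>R\<^esub>,
      add = (\<lambda>A B. \<Union>{frac ((t \<odot>\<^bsub>M\<^esub> m) \<oplus>\<^bsub>M\<^esub> (s \<odot>\<^bsub>M\<^esub> n)) (s \<otimes>\<^bsub>R\<^esub> t) | m s n t.
                       (m, s) \<in> A \<and> (n, t) \<in> B}),
      smult = (\<lambda>A B. \<Union>{frac (a \<odot>\<^bsub>M\<^esub> m) (s \<otimes>\<^bsub>R\<^esub> t) | a s m t. (a, s) \<in> A \<and> (m, t) \<in> B})\<rparr>)"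

text \<open>The local rank of \<open>M\<close> at every prime \<open>P\<close>, that is the rank of the free
  \<open>R\<^sub>P\<close>-module \<open>M\<^sub>P\<close>, is \<open>n\<close>.\<close>

definition has_constant_rank ::
  "('a, 'r) ring_scheme \<Rightarrow> ('a, 'b, 'm) module_scheme \<Rightarrow> nat \<Rightarrow> bool" where
  "has_constant_rank R M n \<longleftrightarrow>
     (\<forall>P. primeideal P R \<longrightarrow>
        is_free_of_rank (localized_ring R (carrier R - P)) (localized_module R (carrier R - P) M) n)"


section \<open>Tensor products and the Picard group\<close>

definition quotient_module ::
  "('a, 'r) ring_scheme \<Rightarrow> ('a, 'b, 'm) module_scheme \<Rightarrow> 'b set \<Rightarrow> ('a, 'b set) module" where
  "quotient_module R M K =
     \<lparr>carrier = a_rcosets\<^bsub>M\<^esub> K, mult = (\<lambda>A B. K), one = K, zero = K, add = set_add M,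
      smult = (\<lambda>r A. \<Union>x \<in> A. K +>\<^bsub>M\<^esub> (r \<odot>\<^bsub>M\<^esub> x))\<rparr>"

definition unit_vector :: "('a, 'r) ring_scheme \<Rightarrow> 'i set \<Rightarrow> 'i \<Rightarrow> 'i \<Rightarrow> 'a" where
  "unit_vector R I i = (\<lambda>j \<in> I. if j = i then \<one>\<^bsub>R\<^esub> else \<zero>\<^bsub>R\<^esub>)"

definition tensor_relations ::
  "('a, 'r) ring_scheme \<Rightarrow> ('a, 'b, 'm) module_scheme \<Rightarrow> ('a, 'c, 'n) module_scheme
     \<Rightarrow> ('b \<times> 'c \<Rightarrow> 'a) set" where
  "tensor_relations R M N =
     (let I = carrier M \<times> carrier N; F = free_module R I; d = (\<lambda>m n. unit_vector R I (m, n)) in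
        {d (m \<oplus>\<^bsub>M\<^esub> m') n \<ominus>\<^bsub>F\<^esub> (d m n \<oplus>\<^bsub>F\<^esub> d m' n) | m m' n.
           m \<in> carrier M \<and> m' \<in> carrier M \<and> n \<in> carrier N} \<union>
        {d m (n \<oplus>\<^bsub>N\<^esub> n') \<ominus>\<^bsub>F\<^esub> (d m n \<oplus>\<^bsub>F\<^esub> d m n') | m n n'.
           m \<in> carrier M \<and> n \<in> carrier N \<and> n' \<in> carrier N} \<union>
        {d (r \<odot>\<^bsub>M\<^esub> m) n \<ominus>\<^bsub>F\<^esub> (r \<odot>\<^bsub>F\<^esub> d m n) | r m n.
           r \<in> carrier R \<and> m \<in> carrier M \<and> n \<in> carrier N} \<union>
        {d m (r \<odot>\<^bsub>N\<^esub> n) \<ominus>\<^bsub>F\<^esub> (r \<odot>\<^bsub>F\<^esub> d m n) | r m n.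
           r \<in> carrier R \<and> m \<in> carrier M \<and> n \<in> carrier N})"

definition tensor_product ::
  "('a, 'r) ring_scheme \<Rightarrow> ('a, 'b, 'm) module_scheme \<Rightarrow> ('a, 'c, 'n) module_scheme
     \<Rightarrow> ('a, ('b \<times> 'c \<Rightarrow> 'a) set) module" where
  "tensor_product R M N =
     (let F = free_module R (carrier M \<times> carrier N) in
        quotient_module R F (module.span R F (tensor_relations R M N)))"

text \<open>Isomorphism classes are taken among the modules carried by subsets of \<open>nat \<Rightarrow> 'a\<close>. Every
  finitely generated module, hence every invertible one, has an isomorphic copy there, since it
  is a quotient of some \<open>R\<^sup>n\<close> and so is in bijection with a subset of \<open>R\<^sup>n\<close>.\<close>

definition module_class ::
  "('a, 'r) ring_scheme \<Rightarrow> ('a, 'b, 'm) module_scheme \<Rightarrow> ('a, nat \<Rightarrow> 'a) module set" where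
  "module_class R M = {L. module R L \<and> module_isomorphic R L M}"

definition module_class_monoid ::
  "('a, 'r) ring_scheme \<Rightarrow> ('a, nat \<Rightarrow> 'a) module set monoid" where
  "module_class_monoid R =
     \<lparr>carrier = {module_class R M | M :: ('a, nat \<Rightarrow> 'a) module. module R M},
      mult = (\<lambda>A B. \<Union>M \<in> A. \<Union>N \<in> B. module_class R (tensor_product R M N)),
      one = module_class R (regular_module R)\<rparr>"

text \<open>The group of isomorphism classes of invertible modules, i.e. of the modules \<open>M\<close> with
  \<open>M \<otimes> N \<cong> R\<close> for some module \<open>N\<close>.\<close>

definition picard_group ::
  "('a, 'r) ring_scheme \<Rightarrow> ('a, nat \<Rightarrow> 'a) module set monoid" where
  "picard_group R = units_of (module_class_monoid R)"

end

theory Submission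
  imports Defs
begin

text \<open>Both hypotheses on \<open>R\<close> imply that a square matrix whose entries generate the unit ideal, viewed
  as a bilinear form, represents a unit. For the primitive condition one evaluates the form at
  \<open>(x\<^sup>i\<^sup>n)\<^sub>i\<close>, \<open>(x\<^sup>j)\<^sub>j\<close>, which gives a polynomial in \<open>x\<close> whose coefficients are the entries; in the
  \<open>J\<close>-regular case one glues vectors along idempotents modulo the Jacobson radical.

  If \<open>M\<close> is finitely generated projective of constant rank \<open>r > 0\<close>, the values of linear forms on \<open>M\<close>
  generate the unit ideal, so some form takes the value 1 at some element. This element splits off a
  free summand, whose complement has constant rank \<open>r - 1\<close>.

  An isomorphism \<open>M \<otimes> N \<cong> R\<close> is a bilinear form \<open>\<beta>\<close> on \<open>M \<times> N\<close> whose values generate \<open>R\<close>. Hence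
  \<open>\<beta>(x, y) = 1\<close> for some \<open>x\<close>, \<open>y\<close>, and \<open>x \<otimes> y\<close> generates \<open>M \<otimes> N\<close>. The linear map \<open>M \<otimes> N \<rightarrow> M\<close>
  with \<open>m \<otimes> n \<mapsto> \<beta>(x, n) (m - \<beta>(m, y) x)\<close> vanishes at \<open>x \<otimes> y\<close>, so it is zero, and evaluating
  it at \<open>m \<otimes> y\<close> shows \<open>m = \<beta>(m, y) x\<close>.\<close>

section \<open>Rings over which unimodular bilinear forms represent units\<close>

text \<open>The obstacle is the passage from a sum to a single value. Positive local rank makes 1 a
  linear combination of the entries \<open>\<psi> i (g j)\<close>, and this holds over every
  commutative ring; but a projective module without free summands admits no form with value 1
  anywhere. \<open>represents_units\<close> closes exactly this gap, since the value of the matrix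
  at two coefficient vectors is the value of one combined form at one combined element.

  For the rank argument, localizations are translated once into statements about families in M with
  denominators cleared (\<open>local_basis\<close>). The induction on the rank then stays inside
  submodules of M, where splitting off an element amounts to an exchange argument that keeps track
  of denominators.

  Invertible modules are treated through the map from the free module on M x N to R: the pairing
  itself provides the unimodular matrix, and the conclusion is an explicit isomorphism with
  R.\<close>

context cring
begin

section \<open>Maximal ideals and units modulo the Jacobson radical\<close>

lemma exists_maximalideal:
  assumes "ideal I R" and "I \<noteq> carrier R"
  obtains m where "maximalideal m R" and "I \<subseteq> m"
proof -
  \<comment> \<open>Properness is expressed as \<open>\<one> \<notin> J\<close>, a condition that
    passes to unions of chains, so that Zorn's lemma applies.\<close>
  let ?A = "{J. ideal J R \<and> I \<subseteq> J \<and> \<one> \<notin> J}"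
  have I: "I \<in> ?A"
    using assms ideal.one_imp_carrier by blast
  have "\<Union>C \<in> ?A" if C: "C \<noteq> {}" "subset.chain ?A C" for C
  proof -
    have id: "\<And>J. J \<in> C \<Longrightarrow> ideal J R" "\<And>J. J \<in> C \<Longrightarrow> I \<subseteq> J" "\<And>J. J \<in> C \<Longrightarrow> \<one> \<notin> J"
      and ch: "\<And>J K. J \<in> C \<Longrightarrow> K \<in> C \<Longrightarrow> J \<subseteq> K \<or> K \<subseteq> J"
      using C(2) unfolding subset_chain_def by blast+
    have "ideal (\<Union>C) R"
    proof (rule idealI[OF ring_axioms])
      show "subgroup (\<Union>C) (add_monoid R)"
      proof (rule add.subgroupI)
        show "\<Union>C \<subseteq> carrier R" using id(1) ideal.Icarr by fast
        show "\<Union>C \<noteq> {}" using C(1) id(1) additive_subgroup.zero_closed ideal.axioms(1) by fastforce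
        show "\<ominus> a \<in> \<Union>C" if "a \<in> \<Union>C" for a
          using that id(1) additive_subgroup.a_inv_closed ideal.axioms(1) by fast
        show "a \<oplus> b \<in> \<Union>C" if ab: "a \<in> \<Union>C" "b \<in> \<Union>C" for a b
        proof -
          obtain J where "J \<in> C" "a \<in> J" "b \<in> J" using ab ch by blast
          then show ?thesis using id(1) additive_subgroup.a_closed ideal.axioms(1) by fast
        qed
      qed
    qed (use id(1) ideal.I_l_closed ideal.I_r_closed in fast)+
    then show ?thesis using id C(1) by blast
  qed
  then obtain m where m: "m \<in> ?A" "\<forall>Y\<in>?A. m \<subseteq> Y \<longrightarrow> Y = m"
    using subset_Zorn_nonempty[of ?A] I by blast
  have "maximalideal m R"
  proof (rule maximalidealI)
    show "carrier R \<noteq> m" using m(1) one_closed by blast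
    show "J = m \<or> J = carrier R" if J: "ideal J R" "m \<subseteq> J" "J \<subseteq> carrier R" for J
    proof (cases "\<one> \<in> J")
      case False
      then have "J \<in> ?A" using J(1,2) m(1) by blast
      then show ?thesis using m(2) J(2) by simp
    qed (simp add: ideal.one_imp_carrier[OF J(1)])
  qed (use m in blast)
  then show thesis using that m(1) by blast
qed

lemma ideal_eq_carrierI:
  assumes "ideal I R" and "\<And>m. maximalideal m R \<Longrightarrow> \<not> I \<subseteq> m"
  shows "I = carrier R"
  using assms exists_maximalideal by metis

lemma unit_if_not_in_maximalideal:
  assumes a: "a \<in> carrier R" and "\<And>m. maximalideal m R \<Longrightarrow> a \<notin> m"
  shows "a \<in> Units R"
proof -
  have "PIdl a = carrier R"
    using assms cgenideal_self by (intro ideal_eq_carrierI cgenideal_ideal) blast+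
  then obtain b where "b \<in> carrier R" "\<one> = b \<otimes> a"
    using one_closed unfolding cgenideal_def by blast
  then show ?thesis using a m_comm by (auto simp: Units_def)
qed

text \<open>A nonzero ring has a maximal ideal, so the radical is a nonempty intersection of proper
  ideals.\<close>

lemma jacobson_radical_ideal:
  assumes "\<one> \<noteq> \<zero>"
  shows "ideal (jacobson_radical R) R" and "\<one> \<notin> jacobson_radical R"
proof -
  have "{\<zero>} \<noteq> carrier R" using assms one_closed by blast
  then obtain m where m: "maximalideal m R"
    using exists_maximalideal[OF zeroideal] by blast
  have "jacobson_radical R = \<Inter>{m. maximalideal m R}"
    using m maximalideal.axioms(1) ideal.Icarr unfolding jacobson_radical_def by fast
  moreover have "ideal (\<Inter>{m. maximalideal m R}) R"
    by (rule i_Intersect) (use m maximalideal.axioms(1) in auto)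
  ultimately show "ideal (jacobson_radical R) R" by simp
  show "\<one> \<notin> jacobson_radical R"
    using m maximalideal.I_notcarr maximalideal.axioms(1) ideal.one_imp_carrier
    unfolding jacobson_radical_def by fast
qed

text \<open>A maximal ideal containing \<open>a\<close> would contain both
  \<open>a \<otimes> b\<close> and \<open>a \<otimes> b \<ominus> \<one>\<close>, hence 1. This is
  how a unit of the quotient by the radical lifts to a unit of the ring.\<close>

lemma unit_mod_jacobson_radical:
  assumes a: "a \<in> carrier R" and b: "b \<in> carrier R" and ab: "a \<otimes> b \<ominus> \<one> \<in> jacobson_radical R"
  shows "a \<in> Units R"
proof (rule unit_if_not_in_maximalideal[OF a], rule notI)
  fix m assume m: "maximalideal m R" and am: "a \<in> m"
  interpret m: maximalideal m R by (rule m)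
  have "a \<otimes> b \<in> m" using am b by (rule m.I_r_closed)
  moreover have "a \<otimes> b \<ominus> \<one> \<in> m" using ab m unfolding jacobson_radical_def by blast
  ultimately have "\<ominus> (a \<otimes> b \<ominus> \<one>) \<oplus> a \<otimes> b \<in> m" by simp
  moreover have "\<ominus> (a \<otimes> b \<ominus> \<one>) \<oplus> a \<otimes> b = \<one>"
    using a b by algebra
  ultimately show False using m.one_imp_carrier m.I_notcarr by simp
qed

end

section \<open>Bilinear forms given by square matrices\<close>

definition bilinear_form ::
  "('a, 'r) ring_scheme \<Rightarrow> nat \<Rightarrow> (nat \<Rightarrow> nat \<Rightarrow> 'a) \<Rightarrow> (nat \<Rightarrow> 'a) \<Rightarrow> (nat \<Rightarrow> 'a) \<Rightarrow> 'a" where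
  "bilinear_form R n a u v =
     (\<Oplus>\<^bsub>R\<^esub>i\<in>{..<n}. \<Oplus>\<^bsub>R\<^esub>j\<in>{..<n}. u i \<otimes>\<^bsub>R\<^esub> (a i j \<otimes>\<^bsub>R\<^esub> v j))"

text \<open>This is the common consequence of the two ring conditions, and all the module theory
  below rests on it. Matrices and vectors are total functions of which only the indices below
  \<open>n\<close> enter, so that membership in the carrier can be stated without index
  bounds.\<close>

definition represents_units :: "('a, 'r) ring_scheme \<Rightarrow> bool" where
  "represents_units R \<longleftrightarrow>
     (\<forall>n a. (\<forall>i j. a i j \<in> carrier R) \<longrightarrow> genideal R {a i j | i j. i < n \<and> j < n} = carrier R \<longrightarrow>
       (\<exists>u v. (\<forall>i. u i \<in> carrier R) \<and> (\<forall>i. v i \<in> carrier R) \<and> bilinear_form R n a u v \<in> Units R))"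

lemma represents_unitsE:
  assumes "represents_units R" and "\<And>i j. a i j \<in> carrier R"
    and "genideal R {a i j | i j. i < n \<and> j < n} = carrier R"
  obtains u v where "\<And>i. u i \<in> carrier R" and "\<And>i. v i \<in> carrier R"
    and "bilinear_form R n a u v \<in> Units R"
  using assms(1)[unfolded represents_units_def, rule_format, OF assms(2,3)] that by blast

context cring
begin

lemma bilinear_form_closed [simp]:
  assumes "\<And>i j. a i j \<in> carrier R" "\<And>i. u i \<in> carrier R" "\<And>i. v i \<in> carrier R"
  shows "bilinear_form R n a u v \<in> carrier R"
  unfolding bilinear_form_def using assms by (auto intro!: finsum_closed)

lemma bilinear_form_lincomb_left:
  assumes "\<And>i j. a i j \<in> carrier R" "\<And>i. u i \<in> carrier R" "\<And>i. u' i \<in> carrier R"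
    "\<And>i. v i \<in> carrier R" "e \<in> carrier R" "f \<in> carrier R"
  shows "bilinear_form R n a (\<lambda>i. e \<otimes> u i \<oplus> f \<otimes> u' i) v =
    e \<otimes> bilinear_form R n a u v \<oplus> f \<otimes> bilinear_form R n a u' v"
  unfolding bilinear_form_def using assms
  by (simp add: finsum_rdistr[symmetric] finsum_addf l_distr m_assoc Pi_def)

lemma bilinear_form_lincomb_right:
  assumes "\<And>i j. a i j \<in> carrier R" "\<And>i. v i \<in> carrier R" "\<And>i. v' i \<in> carrier R"
    "\<And>i. u i \<in> carrier R" "e \<in> carrier R" "f \<in> carrier R"
  shows "bilinear_form R n a u (\<lambda>i. e \<otimes> v i \<oplus> f \<otimes> v' i) =
    e \<otimes> bilinear_form R n a u v \<oplus> f \<otimes> bilinear_form R n a u v'"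
  unfolding bilinear_form_def using assms
  by (simp add: finsum_rdistr[symmetric] finsum_addf r_distr m_lcomm Pi_def)

lemma bilinear_form_unit_vectors:
  assumes "\<And>i j. a i j \<in> carrier R" "k < n" "l < n"
  shows "bilinear_form R n a (\<lambda>i. if i = k then \<one> else \<zero>) (\<lambda>j. if j = l then \<one> else \<zero>) = a k l"
proof -
  have "(\<Oplus>j\<in>{..<n}. (if i = k then \<one> else \<zero>) \<otimes> (a i j \<otimes> (if j = l then \<one> else \<zero>)))
     = (\<Oplus>j\<in>{..<n}. if l = j then (if i = k then a i j else \<zero>) else \<zero>)" for i
    using assms by (intro finsum_cong') auto
  also have "\<dots> i = (if k = i then a i l else \<zero>)" for i
    using assms finsum_singleton[of l "{..<n}" "\<lambda>j. if i = k then a i j else \<zero>"] by auto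
  finally show ?thesis
    unfolding bilinear_form_def using assms finsum_singleton[of k "{..<n}" "\<lambda>i. a i l"] by auto
qed

text \<open>If \<open>e\<close> is the idempotent generating the ideal of the value at \<open>(u, v)\<close>, then the value at
  \<open>(e u + (1 - e) u', e v + (1 - e) v')\<close> divides the values at both \<open>(u, v)\<close> and \<open>(u', v')\<close>.\<close>
lemma von_neumann_regular_represents_units:
  assumes vn: "von_neumann_regular R"
  shows "represents_units R"
  unfolding represents_units_def
proof (intro allI impI)
  fix n :: nat and a :: "nat \<Rightarrow> nat \<Rightarrow> 'a"
  assume "\<forall>i j. a i j \<in> carrier R" and gen: "Idl {a i j | i j. i < n \<and> j < n} = carrier R"
  then have a [simp]: "\<And>i j. a i j \<in> carrier R" by blast
  let ?B = "bilinear_form R n a"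
  \<comment> \<open>Entries are absorbed one at a time: for a finite set \<open>K\<close> of
    positions there is a single value of the form dividing every entry at a position in
    \<open>K\<close>.\<close>
  have "\<exists>u v. (\<forall>i. u i \<in> carrier R) \<and> (\<forall>i. v i \<in> carrier R) \<and>
      (\<forall>(i, j)\<in>K. \<exists>r\<in>carrier R. a i j = r \<otimes> ?B u v)"
    if "finite K" "K \<subseteq> {..<n} \<times> {..<n}" for K
    using that
  proof (induction K rule: finite_induct)
    case empty
    have "\<forall>i::nat. \<zero> \<in> carrier R" by simp
    then show ?case by (intro exI[of _ "\<lambda>_. \<zero>"]) auto
  next
    case (insert p K)
    then obtain k l where p: "p = (k, l)" and kl: "k < n" "l < n" by auto
    from insert obtain u v where [simp]: "\<And>i. u i \<in> carrier R" "\<And>i. v i \<in> carrier R"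
      and K: "\<forall>(i, j)\<in>K. \<exists>r\<in>carrier R. a i j = r \<otimes> ?B u v" by auto
    define d where "d = ?B u v"
    have d [simp]: "d \<in> carrier R" by (simp add: d_def)
    obtain y where y [simp]: "y \<in> carrier R" and dy: "d \<otimes> d \<otimes> y = d"
      using vn d unfolding von_neumann_regular_def by metis
    \<comment> \<open>From \<open>d \<otimes> d \<otimes> y = d\<close> it follows that
      \<open>e\<close> is idempotent with \<open>e \<otimes> d = d\<close>, so \<open>e\<close> and
      \<open>d\<close> generate the same ideal; \<open>f\<close> is the complementary
      idempotent.\<close>
    define e where "e = d \<otimes> y"
    have e [simp]: "e \<in> carrier R" by (simp add: e_def)
    have ed: "e \<otimes> d = d" using dy by (simp add: e_def m_ac)
    have ee: "e \<otimes> e = e" using ed by (simp add: e_def m_assoc[symmetric])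
    define f where "f = \<one> \<ominus> e"
    have f [simp]: "f \<in> carrier R" by (simp add: f_def)
    have ff: "f \<otimes> f = f" and ef: "e \<otimes> f = \<zero>" and esf: "e \<oplus> f = \<one>"
    proof -
      have "f \<otimes> f = \<one> \<ominus> e \<ominus> e \<oplus> e \<otimes> e" unfolding f_def using e by algebra
      also have "\<dots> = f" unfolding ee f_def using e by algebra
      finally show "f \<otimes> f = f" .
      have "e \<otimes> f = e \<ominus> e \<otimes> e" unfolding f_def using e by algebra
      then show "e \<otimes> f = \<zero>" using e by (simp add: ee)
      show "e \<oplus> f = \<one>" unfolding f_def using e by algebra
    qed
    \<comment> \<open>Unit vectors at which the form takes the new entry \<open>a k l\<close> as its
      value.\<close>
    define u0 v0 :: "nat \<Rightarrow> 'a"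
      where "u0 = (\<lambda>i. if i = k then \<one> else \<zero>)" and "v0 = (\<lambda>j. if j = l then \<one> else \<zero>)"
    have [simp]: "\<And>i. u0 i \<in> carrier R" "\<And>i. v0 i \<in> carrier R" by (auto simp: u0_def v0_def)
    have B0: "?B u0 v0 = a k l" unfolding u0_def v0_def using kl by (simp add: bilinear_form_unit_vectors)
    define w where "w = ?B (\<lambda>i. e \<otimes> u i \<oplus> f \<otimes> u0 i) (\<lambda>i. e \<otimes> v i \<oplus> f \<otimes> v0 i)"
    have [simp]: "w \<in> carrier R" by (simp add: w_def)
    have B: "?B u v0 \<in> carrier R" "?B u0 v \<in> carrier R" by simp_all
    \<comment> \<open>Both vectors are glued along the same idempotent, so the two mixed values
      carry the factor \<open>e \<otimes> f = \<zero>\<close> and disappear.\<close>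
    have "w = e \<otimes> (e \<otimes> d \<oplus> f \<otimes> ?B u v0) \<oplus> f \<otimes> (e \<otimes> ?B u0 v \<oplus> f \<otimes> a k l)"
      by (simp add: w_def bilinear_form_lincomb_left bilinear_form_lincomb_right d_def B0)
    also have "\<dots> = (e \<otimes> e) \<otimes> d \<oplus> (e \<otimes> f) \<otimes> (?B u v0 \<oplus> ?B u0 v) \<oplus> (f \<otimes> f) \<otimes> a k l"
      using B d e f a[of k l] by algebra
    also have "\<dots> = d \<oplus> f \<otimes> a k l" by (simp add: ee ef ff ed)
    finally have w: "w = d \<oplus> f \<otimes> a k l" .
    have fd: "f \<otimes> d = \<zero>"
    proof -
      have "f \<otimes> d = f \<otimes> (e \<otimes> d)" by (simp add: ed)
      also have "\<dots> = (e \<otimes> f) \<otimes> d" by (simp add: m_ac)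
      finally show ?thesis by (simp add: ef)
    qed
    have ew: "e \<otimes> w = d"
    proof -
      have "e \<otimes> w = e \<otimes> d \<oplus> (e \<otimes> f) \<otimes> a k l" by (simp add: w r_distr m_assoc)
      then show ?thesis by (simp add: ed ef)
    qed
    have fw: "f \<otimes> w = f \<otimes> a k l"
    proof -
      have "f \<otimes> w = f \<otimes> d \<oplus> (f \<otimes> f) \<otimes> a k l" by (simp add: w r_distr m_assoc)
      then show ?thesis by (simp add: ff fd)
    qed
    \<comment> \<open>Both parts of the new entry are multiples of \<open>w\<close>: the
      \<open>e\<close>-part is a multiple of \<open>d = e \<otimes> w\<close>, and the
      \<open>f\<close>-part equals \<open>f \<otimes> w\<close>.\<close>
    have "a k l = (e \<oplus> f) \<otimes> a k l" by (simp add: esf)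
    also have "\<dots> = e \<otimes> a k l \<oplus> f \<otimes> a k l" by (simp add: l_distr)
    also have "e \<otimes> a k l = a k l \<otimes> y \<otimes> (e \<otimes> w)" unfolding ew unfolding e_def using m_comm m_assoc d y a by (metis m_closed)
    also have "f \<otimes> a k l = f \<otimes> w" by (simp add: fw)
    also have "a k l \<otimes> y \<otimes> (e \<otimes> w) \<oplus> f \<otimes> w = (a k l \<otimes> y \<otimes> e \<oplus> f) \<otimes> w"
      by (simp add: l_distr m_assoc del: ew fw)
    finally have "\<exists>r\<in>carrier R. a k l = r \<otimes> w" by (intro bexI[of _ "a k l \<otimes> y \<otimes> e \<oplus> f"]) simp_all
    \<comment> \<open>The old entries are multiples of \<open>d\<close>, and
      \<open>d = e \<otimes> w\<close> is itself a multiple of \<open>w\<close>.\<close>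
    moreover have "\<exists>r\<in>carrier R. a i j = r \<otimes> w" if ij: "(i, j) \<in> K" for i j
    proof -
      obtain r where r: "r \<in> carrier R" "a i j = r \<otimes> d" using K ij unfolding d_def by blast
      have "(r \<otimes> e) \<otimes> w = r \<otimes> (e \<otimes> w)" by (rule m_assoc) (simp_all add: r(1))
      also have "\<dots> = a i j" unfolding ew r(2) ..
      finally show ?thesis using r(1) e by (metis m_closed)
    qed
    ultimately show ?case
      unfolding w_def p by (intro exI[of _ "\<lambda>i. e \<otimes> u i \<oplus> f \<otimes> u0 i"] exI[of _ "\<lambda>i. e \<otimes> v i \<oplus> f \<otimes> v0 i"]) auto
  qed
  from this[of "{..<n} \<times> {..<n}"]
  obtain u v where uv: "\<forall>i. u i \<in> carrier R" "\<forall>i. v i \<in> carrier R"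
    and div: "\<And>i j. i < n \<Longrightarrow> j < n \<Longrightarrow> \<exists>r\<in>carrier R. a i j = r \<otimes> ?B u v" by auto
  \<comment> \<open>A value dividing all entries generates an ideal that contains theirs, which is
    the unit ideal.\<close>
  have "a i j \<in> PIdl (?B u v)" if "i < n" "j < n" for i j
    using div[OF that] unfolding cgenideal_def by blast
  then have "Idl {a i j | i j. i < n \<and> j < n} \<subseteq> PIdl (?B u v)"
    using uv by (intro genideal_minimal cgenideal_ideal) auto
  then have "\<one> \<in> PIdl (?B u v)" using gen by auto
  then obtain r where r: "r \<in> carrier R" "\<one> = r \<otimes> ?B u v"
    unfolding cgenideal_def by blast
  moreover have "?B u v \<in> carrier R" using uv by simp
  ultimately have "?B u v \<in> Units R" using m_comm by (auto simp: Units_def)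
  with uv show "\<exists>u v. (\<forall>i. u i \<in> carrier R) \<and> (\<forall>i. v i \<in> carrier R) \<and> ?B u v \<in> Units R" by blast
qed

end

section \<open>Lifting from the quotient by the Jacobson radical\<close>

lemma (in ring_hom_cring) hom_bilinear_form:
  assumes "\<And>i j. a i j \<in> carrier R" "\<And>i. u i \<in> carrier R" "\<And>i. v i \<in> carrier R"
  shows "h (bilinear_form R n a u v) =
    bilinear_form S n (\<lambda>i j. h (a i j)) (\<lambda>i. h (u i)) (\<lambda>i. h (v i))"
  unfolding bilinear_form_def using assms by (simp add: Pi_def o_def)

context cring
begin

text \<open>The idempotents exist only in the quotient, so the vectors are found there and lifted
  coordinatewise. An arbitrary lift suffices: the value of the form at the lifts is a unit modulo
  the radical, hence a unit.\<close>

lemma J_regular_represents_units: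
  assumes "\<one> \<noteq> \<zero>" and J: "J_regular R"
  shows "represents_units R"
  unfolding represents_units_def
proof (intro allI impI)
  fix n :: nat and a :: "nat \<Rightarrow> nat \<Rightarrow> 'a"
  assume "\<forall>i j. a i j \<in> carrier R" and gen: "Idl {a i j | i j. i < n \<and> j < n} = carrier R"
  then have a [simp]: "\<And>i j. a i j \<in> carrier R" by blast
  let ?J = "jacobson_radical R"
  let ?Q = "R Quot ?J"
  let ?h = "(+>) ?J"
  interpret J: ideal ?J R using assms jacobson_radical_ideal by blast
  interpret h: ring_hom_cring R ?Q ?h
    by (rule J.rcos_ring_hom_cring[OF cring_axioms])
  let ?T = "{?h (a i j) | i j. i < n \<and> j < n}"
  have "ideal (genideal ?Q ?T) ?Q"
    by (rule h.S.genideal_ideal) auto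
  \<comment> \<open>To see that the images of the entries generate the unit ideal of the quotient,
    pull back the ideal they generate: the preimage contains all the entries, hence 1.\<close>
  have id: "ideal {r \<in> carrier R. ?h r \<in> genideal ?Q ?T} R"
    using ring_hom_ring.ideal_vimage[OF J.rcos_ring_hom_ring \<open>ideal (genideal ?Q ?T) ?Q\<close>] by simp
  have T: "?T \<subseteq> genideal ?Q ?T"
    by (rule h.S.genideal_self) auto
  have "{a i j | i j. i < n \<and> j < n} \<subseteq> {r \<in> carrier R. ?h r \<in> genideal ?Q ?T}"
  proof (clarify, intro conjI a)
    fix i j assume "i < n" "j < n"
    then have "?h (a i j) \<in> ?T" by blast
    then show "?h (a i j) \<in> genideal ?Q ?T" using T by (rule rev_subsetD)
  qed
  from genideal_minimal[OF id this]
  have "carrier R \<subseteq> {r \<in> carrier R. ?h r \<in> genideal ?Q ?T}" unfolding gen .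
  then have "?h \<one> \<in> genideal ?Q ?T" using one_closed by blast
  then have gen': "genideal ?Q ?T = carrier ?Q"
    using ideal.one_imp_carrier[OF \<open>ideal (genideal ?Q ?T) ?Q\<close>] by simp
  have "represents_units ?Q"
    using J h.S.von_neumann_regular_represents_units unfolding J_regular_def by blast
  then obtain u' v' where uv': "\<And>i. u' i \<in> carrier ?Q" "\<And>i. v' i \<in> carrier ?Q"
    and unit: "bilinear_form ?Q n (\<lambda>i j. ?h (a i j)) u' v' \<in> Units ?Q"
    using represents_unitsE[OF _ h.hom_closed[OF a] gen'] by blast
  have surj: "\<exists>r\<in>carrier R. ?h r = q" if "q \<in> carrier ?Q" for q
    using that unfolding FactRing_def A_RCOSETS_def' by auto
  have "\<forall>i. \<exists>r. r \<in> carrier R \<and> ?h r = u' i" and "\<forall>i. \<exists>r. r \<in> carrier R \<and> ?h r = v' i"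
    using surj[OF uv'(1)] surj[OF uv'(2)] by blast+
  from this[THEN choice] obtain u v where u: "\<And>i. u i \<in> carrier R" "\<And>i. ?h (u i) = u' i"
    and v: "\<And>i. v i \<in> carrier R" "\<And>i. ?h (v i) = v' i"
    by blast
  let ?b = "bilinear_form R n a u v"
  have b: "?b \<in> carrier R" using u v by simp
  have "?h ?b \<in> Units ?Q" using unit u v by (simp add: h.hom_bilinear_form)
  then obtain q where q: "q \<in> carrier ?Q" "?h ?b \<otimes>\<^bsub>?Q\<^esub> q = \<one>\<^bsub>?Q\<^esub>"
    unfolding Units_def by auto
  obtain r where r: "r \<in> carrier R" "?h r = q" using surj q(1) by blast
  have "?h (?b \<otimes> r) = ?h \<one>" using b r q(2) by simp
  then have "?b \<otimes> r \<ominus> \<one> \<in> ?J"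
    using quotient_eq_iff_same_a_r_cos[OF J.is_ideal, of "?b \<otimes> r" \<one>] b r by simp
  then have "?b \<in> Units R" using unit_mod_jacobson_radical b r by blast
  with u v show "\<exists>u v. (\<forall>i. u i \<in> carrier R) \<and> (\<forall>i. v i \<in> carrier R) \<and> bilinear_form R n a u v \<in> Units R"
    by blast
qed

section \<open>The primitive condition and matrices read as polynomials\<close>

lemma eval_map_rev_upt:
  fixes f :: "nat \<Rightarrow> 'a"
  assumes "\<And>k. f k \<in> carrier R" and "x \<in> carrier R"
  shows "eval (map f (rev [0..<N])) x = (\<Oplus>k\<in>{..<N}. f k \<otimes> x [^] k)"
proof (induction N)
  case (Suc N)
  then show ?case using assms by (simp add: lessThan_Suc Pi_def)
qed simp

text \<open>The indices of the \<open>j\<close>-th block are \<open>j * n + i\<close> with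
  \<open>i < n\<close>. This rearranges a polynomial with \<open>n * n\<close> coefficients into the
  double sum of a bilinear form.\<close>

lemma finsum_div_mod:
  fixes f :: "nat \<Rightarrow> 'a"
  assumes "\<And>k. f k \<in> carrier R"
  shows "(\<Oplus>k\<in>{..<m * n}. f k) = (\<Oplus>j\<in>{..<m}. \<Oplus>i\<in>{..<n}. f (j * n + i))"
proof (induction m)
  case (Suc m)
  have "(\<lambda>i. m * n + i) ` {..<n} = {m * n..<m * n + n}"
    using image_add_atLeastLessThan[of "m * n" 0 n] by (simp add: lessThan_atLeast0 add.commute)
  then have "{..<Suc m * n} = {..<m * n} \<union> (\<lambda>i. m * n + i) ` {..<n}"
    by auto
  moreover have "(\<Oplus>k\<in>(\<lambda>i. m * n + i) ` {..<n}. f k) = (\<Oplus>i\<in>{..<n}. f (m * n + i))"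
    using assms by (intro finsum_reindex) auto
  moreover have "{..<m * n} \<inter> (\<lambda>i. m * n + i) ` {..<n} = {}" by auto
  ultimately have "(\<Oplus>k\<in>{..<Suc m * n}. f k) =
      (\<Oplus>k\<in>{..<m * n}. f k) \<oplus> (\<Oplus>i\<in>{..<n}. f (m * n + i))"
    using assms finsum_Un_disjoint[of "{..<m * n}" "(\<lambda>i. m * n + i) ` {..<n}" f] by (simp add: Pi_def)
  then show ?case using assms by (simp add: Suc lessThan_Suc Pi_def a_comm)
qed simp

text \<open>Polynomials must have no leading zeros, whereas the corner entries of a matrix may
  vanish. Normalizing loses at most the coefficient 0, so it does not change the content.\<close>

lemma set_normalize: "set (normalize p) \<subseteq> set p" "set p \<subseteq> insert \<zero> (set (normalize p))"
  by (induction p) auto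

text \<open>This is a Kronecker substitution: for \<open>j < n\<close> the exponent
  \<open>i * n + j\<close> determines \<open>i\<close> and \<open>j\<close>, so different entries
  never merge into one coefficient and the content of the polynomial is the ideal of the
  entries.\<close>

lemma primitive_condition_represents_units:
  assumes "primitive_condition R"
  shows "represents_units R"
  unfolding represents_units_def
proof (intro allI impI)
  fix n :: nat and a :: "nat \<Rightarrow> nat \<Rightarrow> 'a"
  assume "\<forall>i j. a i j \<in> carrier R" and gen: "Idl {a i j | i j. i < n \<and> j < n} = carrier R"
  then have a [simp]: "\<And>i j. a i j \<in> carrier R" by blast
  let ?p = "map (\<lambda>k. a (k div n) (k mod n)) (rev [0..<n * n])"
  have p0: "set ?p \<subseteq> carrier R" by auto
  then have p: "set (normalize ?p) \<subseteq> carrier R" using set_normalize(1)[of ?p] by blast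
  have "{a i j | i j. i < n \<and> j < n} \<subseteq> set ?p"
  proof safe
    fix i j assume ij: "i < n" "j < n"
    then have "i * n + j < n * n"
      by (metis add.commute mult_Suc nat_add_left_cancel_less less_le_trans Suc_leI mult_le_mono1)
    moreover have "(i * n + j) div n = i" "(i * n + j) mod n = j" using ij by auto
    ultimately show "a i j \<in> set ?p" by force
  qed
  also have "set ?p \<subseteq> insert \<zero> (set (normalize ?p))" by (rule set_normalize)
  also have "insert \<zero> (set (normalize ?p)) \<subseteq> Idl (set (normalize ?p))"
    using genideal_self[OF p] genideal_ideal[OF p]
    by (simp add: additive_subgroup.zero_closed ideal.axioms(1))
  finally have "Idl {a i j | i j. i < n \<and> j < n} \<subseteq> Idl (set (normalize ?p))"
    by (rule genideal_minimal[OF genideal_ideal[OF p]])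
  then have "Idl (set (normalize ?p)) = carrier R"
    unfolding gen using ideal.Icarr[OF genideal_ideal[OF p]] by (intro equalityI subsetI) auto
  moreover have "normalize ?p \<in> carrier (univ_poly R (carrier R))"
    unfolding univ_poly_def using normalize_gives_polynomial[OF p0] by simp
  ultimately obtain x where x: "x \<in> carrier R" and ev: "eval (normalize ?p) x \<in> Units R"
    using assms unfolding primitive_condition_def by blast
  have xp [simp]: "x [^] (k::nat) \<in> carrier R" for k using x by simp
  have "eval (normalize ?p) x = (\<Oplus>k\<in>{..<n * n}. a (k div n) (k mod n) \<otimes> x [^] k)"
    using x eval_map_rev_upt[of "\<lambda>k. a (k div n) (k mod n)" x "n * n"]
    by (subst eval_normalize[OF p0 x]) simp
  also have "\<dots> = (\<Oplus>i\<in>{..<n}. \<Oplus>j\<in>{..<n}. a ((i * n + j) div n) ((i * n + j) mod n) \<otimes> x [^] (i * n + j))"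
    using x by (subst finsum_div_mod) auto
  \<comment> \<open>The power of \<open>x\<close> with exponent \<open>i * n + j\<close> factors
    into a row part and a column part, which become the two vectors.\<close>
  also have "\<dots> = (\<Oplus>i\<in>{..<n}. \<Oplus>j\<in>{..<n}. x [^] (i * n) \<otimes> (a i j \<otimes> x [^] j))"
    using x by (intro finsum_cong') (auto intro!: finsum_cong' simp: nat_pow_mult[symmetric] m_lcomm)
  also have "\<dots> = bilinear_form R n a (\<lambda>i. x [^] (i * n)) (\<lambda>j. x [^] j)"
    by (simp add: bilinear_form_def)
  finally show "\<exists>u v. (\<forall>i. u i \<in> carrier R) \<and> (\<forall>i. v i \<in> carrier R) \<and> bilinear_form R n a u v \<in> Units R"
    using ev by (intro exI[of _ "\<lambda>i. x [^] (i * n)"] exI[of _ "\<lambda>j. x [^] j"]) simp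
qed

end

section \<open>Linear combinations of indexed families\<close>

lemma carrier_regular_module [simp]: "carrier (regular_module R) = carrier R"
  and add_regular_module [simp]: "add (regular_module R) = add R"
  and zero_regular_module [simp]: "zero (regular_module R) = zero R"
  and smult_regular_module [simp]: "smult (regular_module R) = mult R"
  by (simp_all add: regular_module_def)

lemma finsum_regular_module [simp]: "finsum (regular_module R) f A = finsum R f A"
  by (simp add: finsum_def finprod_def)

lemma a_inv_regular_module [simp]: "a_inv (regular_module R) = a_inv R"
  by (simp add: fun_eq_iff a_inv_def m_inv_def)

lemma a_minus_regular_module [simp]: "a_minus (regular_module R) = a_minus R"
  by (simp add: fun_eq_iff a_minus_def)

lemma module_homI:
  assumes "\<And>y. y \<in> carrier M \<Longrightarrow> f y \<in> carrier N"
    and "\<And>y z. y \<in> carrier M \<Longrightarrow> z \<in> carrier M \<Longrightarrow> f (y \<oplus>\<^bsub>M\<^esub> z) = f y \<oplus>\<^bsub>N\<^esub> f z"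
    and "\<And>r y. r \<in> carrier R \<Longrightarrow> y \<in> carrier M \<Longrightarrow> f (r \<odot>\<^bsub>M\<^esub> y) = r \<odot>\<^bsub>N\<^esub> f y"
  shows "f \<in> module_hom R M N"
  using assms unfolding module_hom_def by auto

lemma (in cring) regular_module_is_module: "module R (regular_module R)"
proof (rule moduleI)
  show "abelian_group (regular_module R)"
    by (rule abelian_groupI) (auto simp: a_ac intro: l_neg exI[of _ "\<ominus> _"] bexI[of _ "\<ominus> _"])
qed (simp_all add: cring_axioms l_distr r_distr m_assoc)

text \<open>Unlike \<open>lincomb\<close>, which runs over a set of vectors, this sum runs over an
  indexed family. The family may repeat vectors, as happens after applying a projection or another
  linear map.\<close>

definition lsum ::
  "('a, 'b, 'm) module_scheme \<Rightarrow> 'i set \<Rightarrow> ('i \<Rightarrow> 'b) \<Rightarrow> ('i \<Rightarrow> 'a) \<Rightarrow> 'b" where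
  "lsum M I b c = (\<Oplus>\<^bsub>M\<^esub>i\<in>I. c i \<odot>\<^bsub>M\<^esub> b i)"

context module
begin

lemma lsum_closed [simp]:
  assumes "\<And>i. i \<in> I \<Longrightarrow> b i \<in> carrier M" "\<And>i. i \<in> I \<Longrightarrow> c i \<in> carrier R"
  shows "lsum M I b c \<in> carrier M"
  unfolding lsum_def using assms by (auto intro: M.finsum_closed)

lemma lsum_empty [simp]: "lsum M {} b c = \<zero>\<^bsub>M\<^esub>"
  by (simp add: lsum_def)

lemma lsum_insert:
  assumes "finite I" "k \<notin> I" "b k \<in> carrier M" "c k \<in> carrier R"
    "\<And>i. i \<in> I \<Longrightarrow> b i \<in> carrier M" "\<And>i. i \<in> I \<Longrightarrow> c i \<in> carrier R"
  shows "lsum M (insert k I) b c = c k \<odot>\<^bsub>M\<^esub> b k \<oplus>\<^bsub>M\<^esub> lsum M I b c"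
  unfolding lsum_def using assms by (intro M.finsum_insert) auto

lemma lsum_remove:
  assumes "finite I" "k \<in> I"
    "\<And>i. i \<in> I \<Longrightarrow> b i \<in> carrier M" "\<And>i. i \<in> I \<Longrightarrow> c i \<in> carrier R"
  shows "lsum M I b c = c k \<odot>\<^bsub>M\<^esub> b k \<oplus>\<^bsub>M\<^esub> lsum M (I - {k}) b c"
  using lsum_insert[of "I - {k}" k b c] assms by (simp add: insert_absorb)

lemma lsum_cong:
  assumes "\<And>i. i \<in> I \<Longrightarrow> b i = b' i" "\<And>i. i \<in> I \<Longrightarrow> c i = c' i"
    "\<And>i. i \<in> I \<Longrightarrow> b' i \<in> carrier M" "\<And>i. i \<in> I \<Longrightarrow> c' i \<in> carrier R"
  shows "lsum M I b c = lsum M I b' c'"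
  unfolding lsum_def using assms by (intro M.finsum_cong') auto

lemma lsum_add:
  assumes "\<And>i. i \<in> I \<Longrightarrow> b i \<in> carrier M" "\<And>i. i \<in> I \<Longrightarrow> c i \<in> carrier R"
    "\<And>i. i \<in> I \<Longrightarrow> d i \<in> carrier R"
  shows "lsum M I b (\<lambda>i. c i \<oplus> d i) = lsum M I b c \<oplus>\<^bsub>M\<^esub> lsum M I b d"
proof -
  have "lsum M I b (\<lambda>i. c i \<oplus> d i) = (\<Oplus>\<^bsub>M\<^esub>i\<in>I. c i \<odot>\<^bsub>M\<^esub> b i \<oplus>\<^bsub>M\<^esub> d i \<odot>\<^bsub>M\<^esub> b i)"
    unfolding lsum_def using assms by (intro M.finsum_cong') (auto simp: smult_l_distr)
  also have "\<dots> = lsum M I b c \<oplus>\<^bsub>M\<^esub> lsum M I b d"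
    unfolding lsum_def using assms by (intro M.finsum_addf) auto
  finally show ?thesis .
qed

lemma lsum_smult:
  assumes "finite I" "\<And>i. i \<in> I \<Longrightarrow> b i \<in> carrier M" "\<And>i. i \<in> I \<Longrightarrow> c i \<in> carrier R"
    "a \<in> carrier R"
  shows "lsum M I b (\<lambda>i. a \<otimes> c i) = a \<odot>\<^bsub>M\<^esub> lsum M I b c"
proof -
  have "lsum M I b (\<lambda>i. a \<otimes> c i) = (\<Oplus>\<^bsub>M\<^esub>i\<in>I. a \<odot>\<^bsub>M\<^esub> (c i \<odot>\<^bsub>M\<^esub> b i))"
    unfolding lsum_def using assms by (intro M.finsum_cong') (auto simp: smult_assoc1)
  also have "\<dots> = a \<odot>\<^bsub>M\<^esub> lsum M I b c"
    unfolding lsum_def using assms by (intro finsum_smult_ldistr[symmetric]) auto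
  finally show ?thesis .
qed

lemma lsum_minus:
  assumes "finite I" "\<And>i. i \<in> I \<Longrightarrow> b i \<in> carrier M" "\<And>i. i \<in> I \<Longrightarrow> c i \<in> carrier R"
    "\<And>i. i \<in> I \<Longrightarrow> d i \<in> carrier R"
  shows "lsum M I b (\<lambda>i. c i \<ominus> d i) = lsum M I b c \<ominus>\<^bsub>M\<^esub> lsum M I b d"
proof -
  have "lsum M I b (\<lambda>i. c i \<ominus> d i) = lsum M I b (\<lambda>i. c i \<oplus> (\<ominus> \<one>) \<otimes> d i)"
    using assms by (intro lsum_cong) (auto simp: a_minus_def l_minus)
  also have "\<dots> = lsum M I b c \<oplus>\<^bsub>M\<^esub> (\<ominus> \<one>) \<odot>\<^bsub>M\<^esub> lsum M I b d"
    using assms by (subst lsum_add) (auto simp: lsum_smult)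
  also have "\<dots> = lsum M I b c \<ominus>\<^bsub>M\<^esub> lsum M I b d"
    using assms by (simp add: smult_minus_1 M.minus_eq)
  finally show ?thesis .
qed

lemma lsum_single:
  assumes "finite I" "k \<in> I" "\<And>i. i \<in> I \<Longrightarrow> b i \<in> carrier M" "a \<in> carrier R"
  shows "lsum M I b (\<lambda>i. if i = k then a else \<zero>) = a \<odot>\<^bsub>M\<^esub> b k"
proof -
  have "lsum M (I - {k}) b (\<lambda>i. if i = k then a else \<zero>) = (\<Oplus>\<^bsub>M\<^esub>i\<in>I - {k}. \<zero>\<^bsub>M\<^esub>)"
    unfolding lsum_def using assms by (intro M.finsum_cong') auto
  then show ?thesis using assms by (subst lsum_remove[of I k]) auto
qed

lemma lsum_mem_submodule:
  assumes "submodule R K M" "\<And>i. i \<in> I \<Longrightarrow> b i \<in> K" "\<And>i. i \<in> I \<Longrightarrow> c i \<in> carrier R"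
  shows "lsum M I b c \<in> K"
  using assms(2,3)
proof (induction I rule: infinite_finite_induct)
  case (infinite A)
  then show ?case using submodule.zero_closed[OF assms(1)] by (simp add: lsum_def)
next
  case empty
  then show ?case using submodule.zero_closed[OF assms(1)] by simp
next
  case (insert k I)
  have K: "K \<subseteq> carrier M" by (rule submodule.subset[OF assms(1)])
  then have "lsum M (insert k I) b c = c k \<odot>\<^bsub>M\<^esub> b k \<oplus>\<^bsub>M\<^esub> lsum M I b c"
    using insert.hyps insert.prems by (intro lsum_insert) auto
  then show ?case using insert submodule.m_closed[OF assms(1)] submodule.smult_closed[OF assms(1)] by auto
qed

lemma lsum_submodule:
  assumes "submodule R K M" "finite I" "\<And>i. i \<in> I \<Longrightarrow> b i \<in> K" "\<And>i. i \<in> I \<Longrightarrow> c i \<in> carrier R"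
  shows "lsum (M\<lparr>carrier := K\<rparr>) I b c = lsum M I b c"
  using assms(2-4)
proof (induction I rule: finite_induct)
  case empty
  then show ?case using module.lsum_empty[OF submodule_is_module[OF assms(1)]] by simp
next
  case (insert k I)
  interpret K: module R "M\<lparr>carrier := K\<rparr>" by (rule submodule_is_module[OF assms(1)])
  have K: "K \<subseteq> carrier M" by (rule submodule.subset[OF assms(1)])
  have "lsum (M\<lparr>carrier := K\<rparr>) (insert k I) b c = c k \<odot>\<^bsub>M\<^esub> b k \<oplus>\<^bsub>M\<^esub> lsum (M\<lparr>carrier := K\<rparr>) I b c"
    using insert.hyps insert.prems K.lsum_insert[of I k b c] by simp
  moreover have "lsum M (insert k I) b c = c k \<odot>\<^bsub>M\<^esub> b k \<oplus>\<^bsub>M\<^esub> lsum M I b c"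
    using insert.hyps insert.prems K by (intro lsum_insert) auto
  ultimately show ?case using insert by simp
qed

end

lemma (in mod_hom) hom_lsum:
  assumes "finite I" "\<And>i. i \<in> I \<Longrightarrow> b i \<in> carrier M" "\<And>i. i \<in> I \<Longrightarrow> c i \<in> carrier R"
  shows "f (lsum M I b c) = lsum N I (\<lambda>i. f (b i)) c"
  using assms
proof (induction I rule: finite_induct)
  case (insert k I)
  then show ?case by (simp add: M.lsum_insert N.lsum_insert)
qed simp

text \<open>The disjunction allows a term to lie in the ideal either through its value or through
  its coefficient; both cases occur below.\<close>

lemma (in ideal) lsum_mem_ideal:
  assumes "cring R" "\<And>i. i \<in> A \<Longrightarrow> f i \<in> carrier R" "\<And>i. i \<in> A \<Longrightarrow> c i \<in> carrier R"
    "\<And>i. i \<in> A \<Longrightarrow> f i \<in> I \<or> c i \<in> I"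
  shows "lsum (regular_module R) A f c \<in> I"
  using assms(2-4)
proof (induction A rule: infinite_finite_induct)
  case (insert k A)
  interpret N: module R "regular_module R" by (rule cring.regular_module_is_module[OF assms(1)])
  have "c k \<otimes> f k \<in> I" using insert.prems[of k] I_l_closed I_r_closed by auto
  then show ?case using insert N.lsum_insert[of A k f c] by simp
qed (simp_all add: lsum_def)

lemma mod_homI:
  "module R M \<Longrightarrow> module R N \<Longrightarrow> f \<in> module_hom R M N \<Longrightarrow> mod_hom R M N f"
  by (simp add: mod_hom_def mod_hom_axioms_def)

section \<open>Splitting off free summands\<close>

text \<open>These are coordinates for a finitely generated projective module: the identity is a
  finite sum of maps \<open>y \<mapsto> \<psi> i y \<odot> g i\<close>. In this form the property
  passes to a direct summand by projecting the \<open>g i\<close>.\<close>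

definition dual_basis ::
  "('a, 'r) ring_scheme \<Rightarrow> ('a, 'b, 'm) module_scheme \<Rightarrow> nat \<Rightarrow> (nat \<Rightarrow> 'b) \<Rightarrow> (nat \<Rightarrow> 'b \<Rightarrow> 'a) \<Rightarrow> bool"
  where
  "dual_basis R M n g \<psi> \<longleftrightarrow>
     (\<forall>i. g i \<in> carrier M) \<and> (\<forall>i. \<psi> i \<in> module_hom R M (regular_module R)) \<and>
     (\<forall>y\<in>carrier M. lsum M {..<n} g (\<lambda>i. \<psi> i y) = y)"

text \<open>The images of the family \<open>b\<close> in the localization at the prime ideal \<open>P\<close> form a basis.\<close>
definition local_basis ::
  "('a, 'r) ring_scheme \<Rightarrow> ('a, 'b, 'm) module_scheme \<Rightarrow> 'a set \<Rightarrow> 'i set \<Rightarrow> ('i \<Rightarrow> 'b) \<Rightarrow> bool"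
  where
  "local_basis R M P I b \<longleftrightarrow>
     finite I \<and> (\<forall>i. b i \<in> carrier M) \<and>
     (\<forall>y\<in>carrier M. \<exists>s\<in>carrier R - P. \<exists>c. (\<forall>i. c i \<in> carrier R) \<and> s \<odot>\<^bsub>M\<^esub> y = lsum M I b c) \<and>
     (\<forall>c. (\<forall>i. c i \<in> carrier R) \<longrightarrow> lsum M I b c = \<zero>\<^bsub>M\<^esub> \<longrightarrow>
       (\<exists>s\<in>carrier R - P. \<forall>i\<in>I. s \<otimes>\<^bsub>R\<^esub> c i = \<zero>\<^bsub>R\<^esub>))"

context module
begin

lemma linear_form_hom: "\<phi> \<in> module_hom R M (regular_module R) \<Longrightarrow> mod_hom R M (regular_module R) \<phi>"
  by (intro mod_homI module_axioms regular_module_is_module)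

lemma linear_form_closed [simp]:
  "\<phi> \<in> module_hom R M (regular_module R) \<Longrightarrow> y \<in> carrier M \<Longrightarrow> \<phi> y \<in> carrier R"
  using module_hom_closed by fastforce

text \<open>Combining the generators with coefficients \<open>v\<close> and the forms with
  coefficients \<open>u\<close> gives an element and a form whose pairing is the value of the matrix
  at \<open>u\<close> and \<open>v\<close>. Since this value is a unit, rescaling the element makes
  it 1.\<close>

lemma unimodular_element_exists:
  assumes R: "represents_units R" and db: "dual_basis R M n g \<psi>"
    and gen: "Idl {\<psi> i (g j) | i j. i < n \<and> j < n} = carrier R"
  obtains x \<phi> where "x \<in> carrier M" and "\<phi> \<in> module_hom R M (regular_module R)" and "\<phi> x = \<one>"
proof -
  interpret N: module R "regular_module R" by (rule regular_module_is_module)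
  have g [simp]: "\<And>i. g i \<in> carrier M" and \<psi>: "\<And>i. \<psi> i \<in> module_hom R M (regular_module R)"
    using db unfolding dual_basis_def by auto
  have \<psi>c [simp]: "\<And>i y. y \<in> carrier M \<Longrightarrow> \<psi> i y \<in> carrier R" using \<psi> by simp
  obtain u v where u [simp]: "\<And>i. u i \<in> carrier R" and v [simp]: "\<And>i. v i \<in> carrier R"
    and unit: "bilinear_form R n (\<lambda>i j. \<psi> i (g j)) u v \<in> Units R"
    using represents_unitsE[OF R \<psi>c[OF g] gen] by blast
  define x where "x = lsum M {..<n} g v"
  have x: "x \<in> carrier M" by (simp add: x_def)
  have \<psi>x: "\<psi> i x = (\<Oplus>j\<in>{..<n}. \<psi> i (g j) \<otimes> v j)" for i
  proof -
    interpret mod_hom R M "regular_module R" "\<psi> i" by (rule linear_form_hom[OF \<psi>])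
    show ?thesis unfolding x_def
      by (subst hom_lsum) (auto simp: lsum_def m_comm intro!: R.finsum_cong')
  qed
  define \<phi> where "\<phi> y = (\<Oplus>i\<in>{..<n}. u i \<otimes> \<psi> i y)" for y
  have \<phi>: "\<phi> \<in> module_hom R M (regular_module R)"
  proof (rule module_homI)
    show "\<phi> y \<in> carrier (regular_module R)" if "y \<in> carrier M" for y
      unfolding \<phi>_def using that by auto
    show "\<phi> (y \<oplus>\<^bsub>M\<^esub> z) = \<phi> y \<oplus>\<^bsub>regular_module R\<^esub> \<phi> z"
      if "y \<in> carrier M" "z \<in> carrier M" for y z
    proof -
      have "\<phi> (y \<oplus>\<^bsub>M\<^esub> z) = (\<Oplus>i\<in>{..<n}. u i \<otimes> \<psi> i y \<oplus> u i \<otimes> \<psi> i z)"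
        unfolding \<phi>_def using that
        by (intro R.finsum_cong') (auto simp: module_hom_add[OF \<psi>] r_distr)
      also have "\<dots> = \<phi> y \<oplus> \<phi> z" unfolding \<phi>_def using that by (intro R.finsum_addf) auto
      finally show ?thesis by simp
    qed
    show "\<phi> (r \<odot>\<^bsub>M\<^esub> y) = r \<odot>\<^bsub>regular_module R\<^esub> \<phi> y"
      if "r \<in> carrier R" "y \<in> carrier M" for r y
    proof -
      have "\<phi> (r \<odot>\<^bsub>M\<^esub> y) = (\<Oplus>i\<in>{..<n}. r \<otimes> (u i \<otimes> \<psi> i y))"
        unfolding \<phi>_def using that
        by (intro R.finsum_cong') (auto simp: module_hom_smult[OF \<psi>] m_lcomm)
      also have "\<dots> = r \<otimes> \<phi> y" unfolding \<phi>_def using that by (intro R.finsum_rdistr[symmetric]) auto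
      finally show ?thesis by simp
    qed
  qed
  have "\<phi> x = bilinear_form R n (\<lambda>i j. \<psi> i (g j)) u v"
    unfolding \<phi>_def \<psi>x bilinear_form_def
    by (intro R.finsum_cong') (auto intro!: R.finsum_rdistr)
  then have unit: "\<phi> x \<in> Units R" using unit by simp
  show thesis
  proof (rule that[OF _ \<phi>])
    show "inv (\<phi> x) \<odot>\<^bsub>M\<^esub> x \<in> carrier M" using unit x by simp
    show "\<phi> (inv (\<phi> x) \<odot>\<^bsub>M\<^esub> x) = \<one>" using unit x by (simp add: module_hom_smult[OF \<phi>])
  qed
qed

lemma prime_complement_mult:
  "primeideal P R \<Longrightarrow> s \<in> carrier R - P \<Longrightarrow> t \<in> carrier R - P \<Longrightarrow> s \<otimes> t \<in> carrier R - P"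
  using primeideal.I_prime by fastforce

lemma prime_complement_one:
  "primeideal P R \<Longrightarrow> \<one> \<in> carrier R - P"
  using primeideal.I_notcarr primeideal.axioms(1) ideal.one_imp_carrier one_closed by blast

text \<open>If all \<open>\<psi> i (g j)\<close> were in a maximal ideal \<open>m\<close>, a local
  basis vector \<open>b k\<close> would, after multiplication by a denominator, be a combination of
  the local basis with all coefficients in \<open>m\<close>. Comparing the coefficients at
  \<open>k\<close> contradicts independence.\<close>

lemma trace_ideal_eq_carrier:
  assumes db: "dual_basis R M n g \<psi>"
    and loc: "\<And>m. maximalideal m R \<Longrightarrow> \<exists>I (b :: nat \<Rightarrow> 'c). I \<noteq> {} \<and> local_basis R M m I b"
  shows "Idl {\<psi> i (g j) | i j. i < n \<and> j < n} = carrier R" (is "Idl ?T = _")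
proof (rule ideal_eq_carrierI)
  have g [simp]: "\<And>i. g i \<in> carrier M" and \<psi>: "\<And>i. \<psi> i \<in> module_hom R M (regular_module R)"
    and exp: "\<And>y. y \<in> carrier M \<Longrightarrow> lsum M {..<n} g (\<lambda>i. \<psi> i y) = y"
    using db unfolding dual_basis_def by auto
  have \<psi>c [simp]: "\<And>i y. y \<in> carrier M \<Longrightarrow> \<psi> i y \<in> carrier R" using \<psi> by simp
  have T: "?T \<subseteq> carrier R" by auto
  then show "ideal (Idl ?T) R" by (rule genideal_ideal)
  fix m assume m: "maximalideal m R"
  show "\<not> Idl ?T \<subseteq> m"
  proof
    assume Tm: "Idl ?T \<subseteq> m"
    interpret m: primeideal m R by (rule maximalideal_prime[OF m])
    note S = prime_complement_mult[OF m.primeideal] prime_complement_one[OF m.primeideal]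
    obtain I and b :: "nat \<Rightarrow> 'c" where I: "finite I" "I \<noteq> {}" and b [simp]: "\<And>i. b i \<in> carrier M"
      and gen: "\<And>y. y \<in> carrier M \<Longrightarrow> \<exists>s\<in>carrier R - m. \<exists>c. (\<forall>i. c i \<in> carrier R) \<and> s \<odot>\<^bsub>M\<^esub> y = lsum M I b c"
      and ind: "\<And>c. (\<And>i. c i \<in> carrier R) \<Longrightarrow> lsum M I b c = \<zero>\<^bsub>M\<^esub> \<Longrightarrow> \<exists>s\<in>carrier R - m. \<forall>i\<in>I. s \<otimes> c i = \<zero>"
      using loc[OF m] unfolding local_basis_def by blast
    obtain k where k: "k \<in> I" using I by blast
    \<comment> \<open>Apply \<open>\<psi> i\<close> to the expansion of \<open>b k\<close>: every
      term contains some \<open>\<psi> i (g j)\<close>, which lies in \<open>m\<close>.\<close>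
    have bm: "\<psi> i (b k) \<in> m" if "i < n" for i
    proof -
      interpret \<psi>: mod_hom R M "regular_module R" "\<psi> i" by (rule linear_form_hom[OF \<psi>])
      have "\<psi> i (b k) = lsum (regular_module R) {..<n} (\<lambda>j. \<psi> i (g j)) (\<lambda>j. \<psi> j (b k))"
        by (subst exp[symmetric], simp, subst \<psi>.hom_lsum) auto
      also have "\<dots> \<in> m"
      proof (rule m.lsum_mem_ideal)
        show "\<psi> i (g j) \<in> m \<or> \<psi> j (b k) \<in> m" if "j \<in> {..<n}" for j
          using genideal_self[OF T] Tm that \<open>i < n\<close> by blast
      qed (auto simp: R.cring_axioms)
      finally show ?thesis .
    qed
    \<comment> \<open>The dual basis expansion of \<open>b k\<close> is rewritten in the local basis
      term by term. Each \<open>g j\<close> brings its own denominator, and these are multiplied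
      together along the induction.\<close>
    have "\<exists>s\<in>carrier R - m. \<exists>d. (\<forall>i. d i \<in> m) \<and> s \<odot>\<^bsub>M\<^esub> lsum M {..<N} g (\<lambda>i. \<psi> i (b k)) = lsum M I b d"
      if "N \<le> n" for N
      using that
    proof (induction N)
      case 0
      have "lsum M I b (\<lambda>_. \<zero>) = \<zero>\<^bsub>M\<^esub>"
        using lsum_smult[OF I(1), of b "\<lambda>_. \<zero>" \<zero>] by simp
      then show ?case using S(2) by (intro bexI[of _ \<one>] exI[of _ "\<lambda>_. \<zero>"]) simp_all
    next
      case (Suc N)
      then obtain s d where s: "s \<in> carrier R - m" and d: "\<And>i. d i \<in> m"
        and sd: "s \<odot>\<^bsub>M\<^esub> lsum M {..<N} g (\<lambda>i. \<psi> i (b k)) = lsum M I b d" by auto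
      obtain t c where t: "t \<in> carrier R - m" and c: "\<And>i. c i \<in> carrier R"
        and tc: "t \<odot>\<^bsub>M\<^esub> g N = lsum M I b c" using gen[OF g] by metis
      have [simp]: "s \<in> carrier R" "t \<in> carrier R" "\<And>i. d i \<in> carrier R" "\<And>i. c i \<in> carrier R"
        using s t d c m.Icarr by auto
      let ?z = "lsum M {..<N} g (\<lambda>i. \<psi> i (b k))" and ?a = "\<psi> N (b k)"
      have z: "?z \<in> carrier M" by simp
      have "(s \<otimes> t) \<odot>\<^bsub>M\<^esub> lsum M {..<Suc N} g (\<lambda>i. \<psi> i (b k))
          = (s \<otimes> t) \<odot>\<^bsub>M\<^esub> (?a \<odot>\<^bsub>M\<^esub> g N \<oplus>\<^bsub>M\<^esub> ?z)"
        unfolding lessThan_Suc by (subst lsum_insert) auto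
      also have "\<dots> = ((s \<otimes> ?a) \<odot>\<^bsub>M\<^esub> (t \<odot>\<^bsub>M\<^esub> g N)) \<oplus>\<^bsub>M\<^esub> (t \<odot>\<^bsub>M\<^esub> (s \<odot>\<^bsub>M\<^esub> ?z))"
        using z by (simp add: smult_r_distr smult_assoc1[symmetric] m_ac)
      also have "\<dots> = lsum M I b (\<lambda>i. (s \<otimes> ?a) \<otimes> c i \<oplus> t \<otimes> d i)"
        unfolding sd tc using I by (simp add: lsum_add lsum_smult)
      finally have "(s \<otimes> t) \<odot>\<^bsub>M\<^esub> lsum M {..<Suc N} g (\<lambda>i. \<psi> i (b k))
          = lsum M I b (\<lambda>i. (s \<otimes> ?a) \<otimes> c i \<oplus> t \<otimes> d i)" .
      moreover have "(s \<otimes> ?a) \<otimes> c i \<oplus> t \<otimes> d i \<in> m" for i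
        using bm[of N] Suc.prems d m.I_l_closed m.I_r_closed by simp
      ultimately show ?case
        by (intro bexI[OF _ S(1)[OF s t]] exI[of _ "\<lambda>i. (s \<otimes> ?a) \<otimes> c i \<oplus> t \<otimes> d i"] conjI allI)
    qed
    from this[of n] obtain s d where s: "s \<in> carrier R - m" and d: "\<And>i. d i \<in> m"
      and sd: "s \<odot>\<^bsub>M\<^esub> b k = lsum M I b d" by (auto simp: exp)
    have [simp]: "s \<in> carrier R" "\<And>i. d i \<in> carrier R" using s d m.Icarr by auto
    \<comment> \<open>This is a relation with coefficient \<open>d k \<ominus> s\<close> at
      \<open>k\<close>. Some \<open>t\<close> outside the prime ideal \<open>m\<close> kills it, so
      \<open>d k \<ominus> s\<close> is in \<open>m\<close>; with \<open>d k\<close> also in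
      \<open>m\<close> this puts the denominator \<open>s\<close> into \<open>m\<close>.\<close>
    have "lsum M I b (\<lambda>i. d i \<ominus> (if i = k then s else \<zero>)) = \<zero>\<^bsub>M\<^esub>"
      using I(1) k by (simp add: lsum_minus lsum_single sd[symmetric])
    then obtain t where t: "t \<in> carrier R - m" "t \<otimes> (d k \<ominus> s) = \<zero>"
      using ind[of "\<lambda>i. d i \<ominus> (if i = k then s else \<zero>)"] k by auto
    then have "t \<otimes> (d k \<ominus> s) \<in> m" by simp
    then have "d k \<ominus> s \<in> m" using t(1) m.I_prime[of t "d k \<ominus> s"] by auto
    then have "d k \<ominus> (d k \<ominus> s) \<in> m" using d[of k] by (simp add: a_minus_def)
    moreover have "d k \<ominus> (d k \<ominus> s) = s" using \<open>s \<in> carrier R\<close> \<open>d k \<in> carrier R\<close> by algebra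
    ultimately show False using s by simp
  qed
qed

end

section \<open>Splitting a module at an element where a linear form takes the value 1\<close>

locale split_module = module R M for R and M (structure) +
  fixes x and \<phi>
  assumes x [simp]: "x \<in> carrier M" and \<phi>: "\<phi> \<in> module_hom R M (regular_module R)"
    and \<phi>x [simp]: "\<phi> x = \<one>\<^bsub>R\<^esub>"
begin

sublocale \<phi>: mod_hom R M "regular_module R" \<phi>
  by (rule linear_form_hom[OF \<phi>])

lemma \<phi>_closed [simp]: "y \<in> carrier M \<Longrightarrow> \<phi> y \<in> carrier R"
  using \<phi>.f_im by simp

definition complement where "complement = {y \<in> carrier M. \<phi> y = \<zero>\<^bsub>R\<^esub>}"

text \<open>This is the projection onto the kernel of \<open>\<phi>\<close> along \<open>x\<close>;
  it is idempotent because \<open>\<phi> x\<close> is 1.\<close>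

definition proj where "proj y = y \<ominus>\<^bsub>M\<^esub> \<phi> y \<odot>\<^bsub>M\<^esub> x"

lemma submodule_complement: "submodule R complement M"
  using \<phi>.ker_is_submodule unfolding \<phi>.ker_def complement_def by simp

lemma proj_closed [simp]: "y \<in> carrier M \<Longrightarrow> proj y \<in> carrier M"
  by (simp add: proj_def)

lemma proj_complement: "y \<in> carrier M \<Longrightarrow> proj y \<in> complement"
  using \<phi>.f_minus[of y "\<phi> y \<odot>\<^bsub>M\<^esub> x"]
  by (simp add: complement_def proj_def)

lemma proj_id: "y \<in> complement \<Longrightarrow> proj y = y"
  by (simp add: complement_def proj_def M.minus_eq)

lemma proj_x: "proj x = \<zero>\<^bsub>M\<^esub>"
  by (simp add: proj_def)

lemma decompose: "y \<in> carrier M \<Longrightarrow> y = \<phi> y \<odot>\<^bsub>M\<^esub> x \<oplus>\<^bsub>M\<^esub> proj y"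
  unfolding proj_def M.minus_eq by (simp add: M.a_lcomm M.r_neg)

lemma proj_hom: "proj \<in> module_hom R M M"
proof (rule module_homI)
  show "proj (y \<oplus>\<^bsub>M\<^esub> z) = proj y \<oplus>\<^bsub>M\<^esub> proj z" if "y \<in> carrier M" "z \<in> carrier M" for y z
    using that by (simp add: proj_def M.minus_eq smult_l_distr M.minus_add M.a_ac)
  show "proj (r \<odot>\<^bsub>M\<^esub> y) = r \<odot>\<^bsub>M\<^esub> proj y" if "r \<in> carrier R" "y \<in> carrier M" for r y
    using that by (simp add: proj_def M.minus_eq smult_r_distr smult_r_minus smult_assoc1)
qed simp

sublocale proj: mod_hom R M M proj
  by (intro mod_homI module_axioms proj_hom)

abbreviation "K \<equiv> M\<lparr>carrier := complement\<rparr>"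

text \<open>The generators are projected and the forms restricted. An element of the complement is
  fixed by \<open>proj\<close>, so applying \<open>proj\<close> to its expansion yields an expansion
  in the projected generators. The length \<open>n\<close> stays the same.\<close>

lemma dual_basis_complement:
  assumes "dual_basis R M n g \<psi>"
  shows "dual_basis R K n (\<lambda>i. proj (g i)) \<psi>"
proof -
  have g: "\<And>i. g i \<in> carrier M" and \<psi>: "\<And>i. \<psi> i \<in> module_hom R M (regular_module R)"
    and exp: "\<And>y. y \<in> carrier M \<Longrightarrow> lsum M {..<n} g (\<lambda>i. \<psi> i y) = y"
    using assms unfolding dual_basis_def by auto
  have sub: "complement \<subseteq> carrier M" by (auto simp: complement_def)
  have "lsum K {..<n} (\<lambda>i. proj (g i)) (\<lambda>i. \<psi> i y) = y" if y: "y \<in> complement" for y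
  proof -
    have [simp]: "y \<in> carrier M" using y sub by blast
    have "lsum K {..<n} (\<lambda>i. proj (g i)) (\<lambda>i. \<psi> i y) = lsum M {..<n} (\<lambda>i. proj (g i)) (\<lambda>i. \<psi> i y)"
      by (rule lsum_submodule[OF submodule_complement]) (simp_all add: proj_complement g \<psi>)
    also have "\<dots> = proj y"
      by (subst (3) exp[symmetric]) (simp_all add: proj.hom_lsum g \<psi>)
    finally show ?thesis using y by (simp add: proj_id)
  qed
  moreover have "\<psi> i \<in> module_hom R K (regular_module R)" for i
    using \<psi>[of i] sub unfolding module_hom_def by (auto simp: Pi_def subset_iff)
  ultimately show ?thesis
    using proj_complement[OF g] by (simp add: dual_basis_def)
qed

text \<open>An exchange step with denominators. In an expansion of a multiple of \<open>x\<close>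
  some coefficient \<open>d k\<close> lies outside \<open>P\<close>, so it is an admissible
  denominator and \<open>x\<close> can replace \<open>b k\<close>. Projecting away \<open>x\<close>
  leaves a local basis indexed by the other elements.\<close>

lemma local_basis_complement:
  assumes P: "primeideal P R" and loc: "local_basis R M P I b"
  obtains k where "k \<in> I" and "local_basis R K P (I - {k}) (\<lambda>i. proj (b i))"
proof -
  interpret P: primeideal P R by (rule P)
  note S = prime_complement_mult[OF P]
  have I: "finite I" and b [simp]: "\<And>i. b i \<in> carrier M"
    and gen: "\<And>y. y \<in> carrier M \<Longrightarrow> \<exists>s\<in>carrier R - P. \<exists>c. (\<forall>i. c i \<in> carrier R) \<and> s \<odot>\<^bsub>M\<^esub> y = lsum M I b c"
    and ind: "\<And>c. (\<And>i. c i \<in> carrier R) \<Longrightarrow> lsum M I b c = \<zero>\<^bsub>M\<^esub> \<Longrightarrow> \<exists>s\<in>carrier R - P. \<forall>i\<in>I. s \<otimes>\<^bsub>R\<^esub> c i = \<zero>\<^bsub>R\<^esub>"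
    using loc unfolding local_basis_def by blast+
  obtain s d where s: "s \<in> carrier R - P" and d [simp]: "\<And>i. d i \<in> carrier R"
    and sx: "s \<odot>\<^bsub>M\<^esub> x = lsum M I b d" using gen[OF x] by auto
  have [simp]: "s \<in> carrier R" using s by simp
  \<comment> \<open>Otherwise applying \<open>\<phi>\<close> to the expansion of
    \<open>s \<odot> x\<close> would put \<open>s = \<phi> (s \<odot> x)\<close> into
    \<open>P\<close>.\<close>
  have "\<exists>k\<in>I. d k \<notin> P"
  proof (rule ccontr)
    assume "\<not> ?thesis"
    then have "lsum (regular_module R) I (\<lambda>i. \<phi> (b i)) d \<in> P"
      by (intro P.lsum_mem_ideal) (auto simp: R.cring_axioms)
    also have "lsum (regular_module R) I (\<lambda>i. \<phi> (b i)) d = \<phi> (s \<odot>\<^bsub>M\<^esub> x)"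
      unfolding sx using I by (simp add: \<phi>.hom_lsum)
    also have "\<dots> = s" by simp
    finally show False using s by simp
  qed
  then obtain k where k: "k \<in> I" and dk: "d k \<in> carrier R - P" by auto
  let ?b = "\<lambda>i. proj (b i)" and ?I = "I - {k}"
  have fin: "finite ?I" using I by simp
  have kI: "lsum M I b' c = c k \<odot>\<^bsub>M\<^esub> b' k \<oplus>\<^bsub>M\<^esub> lsum M ?I b' c"
    if "\<And>i. b' i \<in> carrier M" "\<And>i. c i \<in> carrier R" for b' c
    using that k I by (intro lsum_remove) auto
  \<comment> \<open>Since \<open>proj\<close> kills \<open>x\<close>, the projected expansion is a
    relation. It expresses \<open>d k\<close> times the projection of \<open>b k\<close> through the
    remaining vectors.\<close>
  have "\<zero>\<^bsub>M\<^esub> = proj (s \<odot>\<^bsub>M\<^esub> x)" by (simp add: proj_x)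
  also have "\<dots> = lsum M I ?b d" unfolding sx using I by (simp add: proj.hom_lsum)
  also have "\<dots> = d k \<odot>\<^bsub>M\<^esub> ?b k \<oplus>\<^bsub>M\<^esub> lsum M ?I ?b d" by (rule kI) simp_all
  finally have dbk: "d k \<odot>\<^bsub>M\<^esub> ?b k = \<ominus>\<^bsub>M\<^esub> lsum M ?I ?b d"
    by (intro M.minus_equality[symmetric]) (simp_all)
  have sub: "lsum K ?I ?b c = lsum M ?I ?b c" if "\<And>i. c i \<in> carrier R" for c
    using that fin by (intro lsum_submodule[OF submodule_complement]) (simp_all add: proj_complement)
  have "\<exists>t\<in>carrier R - P. \<exists>c. (\<forall>i. c i \<in> carrier R) \<and> t \<odot>\<^bsub>M\<^esub> y = lsum K ?I ?b c" if y: "y \<in> complement" for y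
  proof -
    have [simp]: "y \<in> carrier M" using y by (simp add: complement_def)
    obtain t c where t: "t \<in> carrier R - P" and c [simp]: "\<And>i. c i \<in> carrier R"
      and ty: "t \<odot>\<^bsub>M\<^esub> y = lsum M I b c" using gen[of y] by auto
    have [simp]: "t \<in> carrier R" using t by simp
    have "t \<odot>\<^bsub>M\<^esub> y = proj (t \<odot>\<^bsub>M\<^esub> y)" using y by (simp add: proj_id)
    also have "\<dots> = lsum M I ?b c" unfolding ty using I by (simp add: proj.hom_lsum)
    also have "\<dots> = c k \<odot>\<^bsub>M\<^esub> ?b k \<oplus>\<^bsub>M\<^esub> lsum M ?I ?b c" by (rule kI) simp_all
    finally have ty': "t \<odot>\<^bsub>M\<^esub> y = c k \<odot>\<^bsub>M\<^esub> ?b k \<oplus>\<^bsub>M\<^esub> lsum M ?I ?b c" .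
    \<comment> \<open>The extra factor \<open>d k\<close> makes it possible to substitute for the
      projection of \<open>b k\<close>.\<close>
    have "(d k \<otimes>\<^bsub>R\<^esub> t) \<odot>\<^bsub>M\<^esub> y = d k \<odot>\<^bsub>M\<^esub> (c k \<odot>\<^bsub>M\<^esub> ?b k \<oplus>\<^bsub>M\<^esub> lsum M ?I ?b c)"
      by (simp add: smult_assoc1 ty')
    also have "\<dots> = c k \<odot>\<^bsub>M\<^esub> (d k \<odot>\<^bsub>M\<^esub> ?b k) \<oplus>\<^bsub>M\<^esub> d k \<odot>\<^bsub>M\<^esub> lsum M ?I ?b c"
      by (simp add: smult_r_distr smult_assoc1[symmetric] R.m_comm)
    also have "\<dots> = d k \<odot>\<^bsub>M\<^esub> lsum M ?I ?b c \<ominus>\<^bsub>M\<^esub> c k \<odot>\<^bsub>M\<^esub> lsum M ?I ?b d"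
      unfolding dbk by (simp add: smult_r_minus M.minus_eq M.a_comm)
    also have "\<dots> = lsum M ?I ?b (\<lambda>i. d k \<otimes>\<^bsub>R\<^esub> c i \<ominus>\<^bsub>R\<^esub> c k \<otimes>\<^bsub>R\<^esub> d i)"
      using fin by (simp add: lsum_minus lsum_smult)
    also have "\<dots> = lsum K ?I ?b (\<lambda>i. d k \<otimes>\<^bsub>R\<^esub> c i \<ominus>\<^bsub>R\<^esub> c k \<otimes>\<^bsub>R\<^esub> d i)"
      by (rule sub[symmetric]) simp
    finally show ?thesis
      by (intro bexI[OF _ S[OF dk t]] exI[of _ "\<lambda>i. d k \<otimes>\<^bsub>R\<^esub> c i \<ominus>\<^bsub>R\<^esub> c k \<otimes>\<^bsub>R\<^esub> d i"] conjI allI) simp_all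
  qed
  moreover have "\<exists>t\<in>carrier R - P. \<forall>i\<in>?I. t \<otimes>\<^bsub>R\<^esub> c i = \<zero>\<^bsub>R\<^esub>"
    if c [simp]: "\<And>i. c i \<in> carrier R" and "lsum K ?I ?b c = \<zero>\<^bsub>M\<^esub>" for c
  proof -
    \<comment> \<open>The relation among projected vectors is lifted to an element \<open>z\<close>
      of M with coefficient 0 at \<open>k\<close>. As \<open>z\<close> projects to zero it is a
      multiple of \<open>x\<close>, so expanding \<open>s \<odot> z\<close> in two ways gives a
      relation among the \<open>b i\<close>.\<close>
    define c' where "c' = (\<lambda>i. if i = k then \<zero>\<^bsub>R\<^esub> else c i)"
    have [simp]: "c' i \<in> carrier R" for i by (simp add: c'_def)
    define z where "z = lsum M I b c'"
    have [simp]: "z \<in> carrier M" by (simp add: z_def)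
    have "proj z = lsum M I ?b c'" unfolding z_def using I by (simp add: proj.hom_lsum)
    also have "\<dots> = c' k \<odot>\<^bsub>M\<^esub> ?b k \<oplus>\<^bsub>M\<^esub> lsum M ?I ?b c'" by (rule kI) simp_all
    also have "\<dots> = lsum M ?I ?b c" by (simp add: c'_def) (intro lsum_cong, auto)
    also have "\<dots> = \<zero>\<^bsub>M\<^esub>" using that sub by simp
    finally have "z = \<phi> z \<odot>\<^bsub>M\<^esub> x" using decompose[of z] by simp
    then have "s \<odot>\<^bsub>M\<^esub> z = s \<odot>\<^bsub>M\<^esub> (\<phi> z \<odot>\<^bsub>M\<^esub> x)" by simp
    also have "\<dots> = \<phi> z \<odot>\<^bsub>M\<^esub> lsum M I b d"
      unfolding sx[symmetric] by (simp add: smult_assoc1[symmetric] R.m_comm)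
    finally have 0: "lsum M I b (\<lambda>i. s \<otimes>\<^bsub>R\<^esub> c' i \<ominus>\<^bsub>R\<^esub> \<phi> z \<otimes>\<^bsub>R\<^esub> d i) = \<zero>\<^bsub>M\<^esub>"
      using I by (simp add: lsum_minus lsum_smult z_def[symmetric])
    have "\<exists>t\<in>carrier R - P. \<forall>i\<in>I. t \<otimes>\<^bsub>R\<^esub> (s \<otimes>\<^bsub>R\<^esub> c' i \<ominus>\<^bsub>R\<^esub> \<phi> z \<otimes>\<^bsub>R\<^esub> d i) = \<zero>\<^bsub>R\<^esub>"
      by (rule ind[OF _ 0]) simp
    then obtain t where t: "t \<in> carrier R - P"
      and tI: "\<forall>i\<in>I. t \<otimes>\<^bsub>R\<^esub> (s \<otimes>\<^bsub>R\<^esub> c' i \<ominus>\<^bsub>R\<^esub> \<phi> z \<otimes>\<^bsub>R\<^esub> d i) = \<zero>\<^bsub>R\<^esub>" ..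
    have [simp]: "t \<in> carrier R" using t by simp
    have eq: "t \<otimes>\<^bsub>R\<^esub> (s \<otimes>\<^bsub>R\<^esub> c' i) = t \<otimes>\<^bsub>R\<^esub> (\<phi> z \<otimes>\<^bsub>R\<^esub> d i)" if "i \<in> I" for i
    proof -
      define p q where "p = s \<otimes>\<^bsub>R\<^esub> c' i" and "q = \<phi> z \<otimes>\<^bsub>R\<^esub> d i"
      have pq: "p \<in> carrier R" "q \<in> carrier R" "t \<in> carrier R" by (simp_all add: p_def q_def)
      have "t \<otimes>\<^bsub>R\<^esub> p \<ominus>\<^bsub>R\<^esub> t \<otimes>\<^bsub>R\<^esub> q = t \<otimes>\<^bsub>R\<^esub> (p \<ominus>\<^bsub>R\<^esub> q)" using pq by algebra
      also have "\<dots> = \<zero>\<^bsub>R\<^esub>" unfolding p_def q_def using tI that by (rule bspec)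
      finally show ?thesis unfolding p_def[symmetric] q_def[symmetric] using pq by simp
    qed
    \<comment> \<open>At the index \<open>k\<close> the relation reads
      \<open>t \<otimes> (\<phi> z \<otimes> d k) = \<zero>\<close>, because \<open>c' k\<close> is
      0. Multiplying the relation at \<open>i\<close> by \<open>d k\<close> therefore kills its
      right hand side.\<close>
    have "(d k \<otimes>\<^bsub>R\<^esub> (t \<otimes>\<^bsub>R\<^esub> s)) \<otimes>\<^bsub>R\<^esub> c i = \<zero>\<^bsub>R\<^esub>" if i: "i \<in> ?I" for i
    proof -
      have "(d k \<otimes>\<^bsub>R\<^esub> (t \<otimes>\<^bsub>R\<^esub> s)) \<otimes>\<^bsub>R\<^esub> c i = d k \<otimes>\<^bsub>R\<^esub> (t \<otimes>\<^bsub>R\<^esub> (s \<otimes>\<^bsub>R\<^esub> c' i))"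
        using i by (simp add: R.m_assoc c'_def)
      also have "\<dots> = d k \<otimes>\<^bsub>R\<^esub> (t \<otimes>\<^bsub>R\<^esub> (\<phi> z \<otimes>\<^bsub>R\<^esub> d i))" using eq i by simp
      also have "\<dots> = d i \<otimes>\<^bsub>R\<^esub> (t \<otimes>\<^bsub>R\<^esub> (\<phi> z \<otimes>\<^bsub>R\<^esub> d k))" by (simp add: R.m_ac)
      also have "t \<otimes>\<^bsub>R\<^esub> (\<phi> z \<otimes>\<^bsub>R\<^esub> d k) = \<zero>\<^bsub>R\<^esub>" using eq[OF k] by (simp add: c'_def)
      finally show ?thesis by simp
    qed
    then show ?thesis using S[OF dk S[OF t s]] by blast
  qed
  ultimately have "local_basis R K P ?I ?b"
    unfolding local_basis_def using fin by (simp add: proj_complement)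
  with k show thesis by (rule that)
qed

text \<open>The form \<open>\<phi>\<close> vanishes on the span of \<open>B\<close> and is 1 at
  \<open>x\<close>, so it reads off the coefficient of \<open>x\<close> in a relation. That
  coefficient is thus 0, and the rest is a relation inside \<open>B\<close>.\<close>

lemma is_basis_insert:
  assumes "is_basis R K B"
  shows "is_basis R M (insert x B)"
proof -
  note sub = submodule_complement
  have cM: "complement \<subseteq> carrier M" by (auto simp: complement_def)
  have B: "B \<subseteq> complement" using assms by (simp add: is_basis_def)
  have li: "lin_indpt B" and sp: "span B = complement"
    using assms span_li_not_depend[OF B sub] by (simp_all add: is_basis_def)
  have BM: "insert x B \<subseteq> carrier M" using B cM by auto
  have "lin_indpt (insert x B)"
  proof
    assume "lin_dep (insert x B)"
    then obtain A a v where A: "finite A" "A \<subseteq> insert x B" "a \<in> A \<rightarrow> carrier R"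
      and lc: "lincomb a A = \<zero>\<^bsub>M\<^esub>" and v: "v \<in> A" "a v \<noteq> \<zero>\<^bsub>R\<^esub>"
      unfolding lin_dep_def by auto
    show False
    proof (cases "x \<in> A")
      case False
      then show ?thesis using li A lc v lin_dep_crit[of A B a v] by blast
    next
      case True
      let ?A = "A - {x}"
      have A': "?A \<subseteq> B" "?A \<subseteq> complement" "?A \<subseteq> carrier M" "a \<in> ?A \<rightarrow> carrier R"
        using A B cM by auto
      have ax [simp]: "a x \<in> carrier R" using A True by auto
      have "lincomb a ?A \<in> complement"
        using A A' unfolding sp[symmetric] span_def by blast
      then have 0: "\<phi> (lincomb a ?A) = \<zero>\<^bsub>R\<^esub>" "lincomb a ?A \<in> carrier M" by (simp_all add: complement_def)
      have dec: "a x \<odot>\<^bsub>M\<^esub> x \<oplus>\<^bsub>M\<^esub> lincomb a ?A = \<zero>\<^bsub>M\<^esub>"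
        using lincomb_del2[OF A(1) subset_trans[OF A(2) BM] A(3) True] lc by simp
      have "\<phi> (a x \<odot>\<^bsub>M\<^esub> x \<oplus>\<^bsub>M\<^esub> lincomb a ?A) = a x" using 0 by simp
      then have a0: "a x = \<zero>\<^bsub>R\<^esub>" unfolding dec using \<phi>.f0_is_0 by simp
      then have "lincomb a ?A = \<zero>\<^bsub>M\<^esub>" using dec 0 by simp
      moreover have "v \<in> ?A" using v a0 by auto
      ultimately show ?thesis using li A A' v lin_dep_crit[of ?A B a v] by blast
    qed
  qed
  moreover have "span (insert x B) = carrier M"
  proof
    show "span (insert x B) \<subseteq> carrier M" by (rule span_is_subset2[OF BM])
    show "carrier M \<subseteq> span (insert x B)"
    proof
      fix y assume y: "y \<in> carrier M"
      have s: "submodule R (span (insert x B)) M" by (rule span_is_submodule[OF BM])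
      have "x \<in> span (insert x B)" using in_own_span[OF BM] by simp
      moreover have "proj y \<in> span (insert x B)"
        using proj_complement[OF y] span_is_monotone[of B "insert x B"] sp by blast
      ultimately have "\<phi> y \<odot>\<^bsub>M\<^esub> x \<oplus>\<^bsub>M\<^esub> proj y \<in> span (insert x B)"
        using y by (intro submodule.m_closed[OF s] submodule.smult_closed[OF s]) simp_all
      then show "y \<in> span (insert x B)" using decompose[OF y] by simp
    qed
  qed
  ultimately show ?thesis using BM by (simp add: is_basis_def)
qed

end

section \<open>From local ranks to a global basis\<close>

lemma (in module) trivial_if_locally_trivial:
  assumes "\<And>m. maximalideal m R \<Longrightarrow> local_basis R M m {} (b m)"
  shows "carrier M = {\<zero>\<^bsub>M\<^esub>}"
proof -
  have "y = \<zero>\<^bsub>M\<^esub>" if y: "y \<in> carrier M" for y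
  proof -
    \<comment> \<open>The annihilator of \<open>y\<close> is contained in no maximal ideal, because
      an empty local basis at \<open>m\<close> yields an annihilating element outside
      \<open>m\<close>. Hence it contains 1.\<close>
    let ?A = "{a \<in> carrier R. a \<odot>\<^bsub>M\<^esub> y = \<zero>\<^bsub>M\<^esub>}"
    have "?A = carrier R"
    proof (rule ideal_eq_carrierI)
      show "ideal ?A R"
      proof (rule idealI[OF R.ring_axioms])
        show "subgroup ?A (add_monoid R)"
          by (rule R.add.subgroupI) (use y in \<open>auto simp: smult_l_distr smult_l_minus\<close>)
        show "a \<otimes> c \<in> ?A" if "c \<in> carrier R" "a \<in> ?A" for a c
          using that y smult_assoc1[of c a y] by (simp add: m_comm)
        show "c \<otimes> a \<in> ?A" if "c \<in> carrier R" "a \<in> ?A" for a c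
          using that y by (simp add: smult_assoc1)
      qed
      show "\<not> ?A \<subseteq> m" if m: "maximalideal m R" for m
        using assms[OF m] y unfolding local_basis_def by auto
    qed
    then have "\<one> \<in> ?A" by simp
    then show ?thesis using y by simp
  qed
  then show ?thesis by auto
qed

text \<open>The induction is on the local rank and not on the length \<open>n\<close> of the dual
  basis, which does not shrink. The complement keeps the type of \<open>M\<close>, so the induction
  hypothesis applies to it.\<close>

lemma is_basis_exists_if_constant_rank:
  assumes "represents_units R" "module R M" "dual_basis R M n g \<psi>"
    and "\<And>m. maximalideal m R \<Longrightarrow> \<exists>I (b :: nat \<Rightarrow> 'b). card I = r \<and> local_basis R M m I b"
  shows "\<exists>B. is_basis R (M :: ('a, 'b, 'm) module_scheme) B"
  using assms(2-)
proof (induction r arbitrary: M g)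
  case 0
  interpret module R M by (rule 0(1))
  have "\<exists>b :: nat \<Rightarrow> 'b. local_basis R M m {} b" if "maximalideal m R" for m
    using 0(3)[OF that] unfolding local_basis_def by auto
  then have "carrier M = {\<zero>\<^bsub>M\<^esub>}"
    using trivial_if_locally_trivial[of "\<lambda>m. SOME b. local_basis R M m {} b"] by (metis someI_ex)
  then have "is_basis R M {}"
    by (auto simp: is_basis_def lin_dep_def span_def lincomb_def)
  then show ?case by (rule exI)
next
  case (Suc r)
  interpret module R M by (rule Suc.prems(1))
  have "\<exists>I (b :: nat \<Rightarrow> 'b). I \<noteq> {} \<and> local_basis R M m I b" if m: "maximalideal m R" for m
  proof -
    obtain I and b :: "nat \<Rightarrow> 'b" where "card I = Suc r" "local_basis R M m I b"
      using Suc.prems(3)[OF m] by (elim exE conjE)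
    then show ?thesis by (intro exI[of _ I] exI[of _ b]) auto
  qed
  then obtain x \<phi> where "x \<in> carrier M" "\<phi> \<in> module_hom R M (regular_module R)" "\<phi> x = \<one>\<^bsub>R\<^esub>"
    using unimodular_element_exists[OF assms(1) Suc.prems(2) trace_ideal_eq_carrier[OF Suc.prems(2)]] by blast
  then interpret split_module R M x \<phi> by unfold_locales
  have "\<exists>B. is_basis R K B"
  proof (rule Suc.IH)
    show "module R K" by (rule submodule_is_module[OF submodule_complement])
    show "dual_basis R K n (\<lambda>i. proj (g i)) \<psi>" by (rule dual_basis_complement[OF Suc.prems(2)])
    show "\<exists>I (b :: nat \<Rightarrow> 'b). card I = r \<and> local_basis R K m I b" if m: "maximalideal m R" for m
    proof -
      obtain I and b :: "nat \<Rightarrow> 'b" where I: "card I = Suc r" and b: "local_basis R M m I b"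
        using Suc.prems(3)[OF m] by (elim exE conjE)
      obtain k where "k \<in> I" "local_basis R K m (I - {k}) (\<lambda>i. proj (b i))"
        using local_basis_complement[OF R.maximalideal_prime[OF m] b] by blast
      moreover from this have "card (I - {k}) = r" using I by simp
      ultimately show ?thesis by blast
    qed
  qed
  then obtain B where "is_basis R K B" ..
  then have "is_basis R M (insert x B)" by (rule is_basis_insert)
  then show ?case by (rule exI)
qed

section \<open>Localization\<close>

context module
begin

lemma lsum_reindex:
  assumes "bij_betw h A B" "\<And>i. i \<in> B \<Longrightarrow> b i \<in> carrier M" "\<And>i. i \<in> B \<Longrightarrow> c i \<in> carrier R"
  shows "lsum M B b c = lsum M A (\<lambda>i. b (h i)) (\<lambda>i. c (h i))"
proof -
  have B: "B = h ` A" and "inj_on h A" using assms(1) by (auto simp: bij_betw_def)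
  then show ?thesis unfolding lsum_def B using assms(2,3)
    by (intro M.finsum_reindex) (auto simp: B)
qed

text \<open>This multiplies an equation by \<open>r\<close> and leaves the new scalars to be matched
  separately, a pure calculation in the ring. Well-definedness of fractions reduces to such
  steps.\<close>

lemma smult_eq_smult_cancel:
  assumes "a \<odot>\<^bsub>M\<^esub> x = b \<odot>\<^bsub>M\<^esub> y" "a' = r \<otimes> a" "b' = r \<otimes> b"
    "r \<in> carrier R" "a \<in> carrier R" "b \<in> carrier R" "x \<in> carrier M" "y \<in> carrier M"
  shows "a' \<odot>\<^bsub>M\<^esub> x = b' \<odot>\<^bsub>M\<^esub> y"
  using assms by (simp add: smult_assoc1)

end

text \<open>Operations on fractions are unions over all representatives; once they are shown
  independent of the representatives, the union collapses to a single class.\<close>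

lemma Union_image_constant:
  assumes "\<And>a b c d. (a, b) \<in> A \<Longrightarrow> (c, d) \<in> B \<Longrightarrow> F a b c d = Y"
    and "(a0, b0) \<in> A" "(c0, d0) \<in> B"
  shows "\<Union>{F a b c d | a b c d. (a, b) \<in> A \<and> (c, d) \<in> B} = Y"
proof -
  have "{F a b c d | a b c d. (a, b) \<in> A \<and> (c, d) \<in> B} = {Y}"
  proof (intro equalityI subsetI)
    fix x assume "x \<in> {F a b c d | a b c d. (a, b) \<in> A \<and> (c, d) \<in> B}"
    then obtain a b c d where "x = F a b c d" "(a, b) \<in> A" "(c, d) \<in> B" by blast
    then show "x \<in> {Y}" using assms(1)[of a b c d] by simp
  next
    fix x assume "x \<in> {Y}"
    then have "x = F a0 b0 c0 d0" using assms(1)[OF assms(2,3)] by simp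
    then show "x \<in> {F a b c d | a b c d. (a, b) \<in> A \<and> (c, d) \<in> B}" using assms(2,3) by blast
  qed
  then show ?thesis by simp
qed

locale localization = module R M for R (structure) and M +
  fixes S
  assumes S_carrier: "S \<subseteq> carrier R" and one_S [simp]: "\<one> \<in> S"
    and mult_S [simp]: "s \<in> S \<Longrightarrow> t \<in> S \<Longrightarrow> s \<otimes> t \<in> S"
begin

lemma S_closed [simp]: "s \<in> S \<Longrightarrow> s \<in> carrier R"
  using S_carrier by blast

lemma mem_fraction:
  assumes "m \<in> carrier M" "s \<in> S"
  shows "(n, t) \<in> fraction S M m s \<longleftrightarrow>
    n \<in> carrier M \<and> t \<in> S \<and> (\<exists>u\<in>S. (u \<otimes> t) \<odot>\<^bsub>M\<^esub> m = (u \<otimes> s) \<odot>\<^bsub>M\<^esub> n)"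
  using assms by (auto simp: fraction_def smult_assoc1)

lemma fraction_self: "m \<in> carrier M \<Longrightarrow> s \<in> S \<Longrightarrow> (m, s) \<in> fraction S M m s"
  by (auto simp: mem_fraction intro: bexI[OF _ one_S])

lemma fraction_subset:
  assumes "m \<in> carrier M" "s \<in> S" "n \<in> carrier M" "t \<in> S" "u \<in> S"
    "(u \<otimes> t) \<odot>\<^bsub>M\<^esub> m = (u \<otimes> s) \<odot>\<^bsub>M\<^esub> n"
  shows "fraction S M m s \<subseteq> fraction S M n t"
proof (rule subrelI)
  fix k r assume "(k, r) \<in> fraction S M m s"
  then obtain v where k: "k \<in> carrier M" and r: "r \<in> S" and v: "v \<in> S"
    and eq: "(v \<otimes> r) \<odot>\<^bsub>M\<^esub> m = (v \<otimes> s) \<odot>\<^bsub>M\<^esub> k" using assms by (auto simp: mem_fraction)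
  note [simp] = k r v assms(1-5)
  \<comment> \<open>The witness for transitivity is the product of the two given witnesses and the
    denominator \<open>s\<close> of the middle fraction.\<close>
  let ?w = "u \<otimes> (v \<otimes> s)"
  have "(?w \<otimes> r) \<odot>\<^bsub>M\<^esub> n = ((v \<otimes> r) \<otimes> (u \<otimes> t)) \<odot>\<^bsub>M\<^esub> m"
    by (rule smult_eq_smult_cancel[OF assms(6)[symmetric], of _ "v \<otimes> r"]) (simp_all add: m_ac)
  also have "\<dots> = (?w \<otimes> t) \<odot>\<^bsub>M\<^esub> k"
    by (rule smult_eq_smult_cancel[OF eq, of _ "u \<otimes> t"]) (simp_all add: m_ac)
  finally show "(k, r) \<in> fraction S M n t"
    by (auto simp: mem_fraction intro!: bexI[of _ ?w])
qed

lemma fraction_eq_iff: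
  assumes "m \<in> carrier M" "s \<in> S" "n \<in> carrier M" "t \<in> S"
  shows "fraction S M m s = fraction S M n t \<longleftrightarrow> (\<exists>u\<in>S. (u \<otimes> t) \<odot>\<^bsub>M\<^esub> m = (u \<otimes> s) \<odot>\<^bsub>M\<^esub> n)"
proof
  assume "fraction S M m s = fraction S M n t"
  then have "(n, t) \<in> fraction S M m s" using assms fraction_self by simp
  then show "\<exists>u\<in>S. (u \<otimes> t) \<odot>\<^bsub>M\<^esub> m = (u \<otimes> s) \<odot>\<^bsub>M\<^esub> n" using assms by (simp add: mem_fraction)
next
  assume "\<exists>u\<in>S. (u \<otimes> t) \<odot>\<^bsub>M\<^esub> m = (u \<otimes> s) \<odot>\<^bsub>M\<^esub> n"
  then obtain u where "u \<in> S" "(u \<otimes> t) \<odot>\<^bsub>M\<^esub> m = (u \<otimes> s) \<odot>\<^bsub>M\<^esub> n" ..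
  then show "fraction S M m s = fraction S M n t"
    using assms fraction_subset[of m s n t u] fraction_subset[of n t m s u] by simp
qed

sublocale reg: localization R "regular_module R" S
  by (intro localization.intro regular_module_is_module localization_axioms.intro S_carrier) simp_all

abbreviation "L \<equiv> localized_ring R S"
abbreviation "LM \<equiv> localized_module R S M"
abbreviation "fr \<equiv> fraction S M"
abbreviation "fr_R \<equiv> fraction S (regular_module R)"

lemma carrier_LM: "carrier LM = {fr m s | m s. m \<in> carrier M \<and> s \<in> S}"
  and zero_LM: "\<zero>\<^bsub>LM\<^esub> = fr \<zero>\<^bsub>M\<^esub> \<one>"
  and carrier_L: "carrier L = {fr_R a s | a s. a \<in> carrier R \<and> s \<in> S}"
  and zero_L: "\<zero>\<^bsub>L\<^esub> = fr_R \<zero> \<one>"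
  by (simp_all add: localized_module_def localized_ring_def Let_def)

lemma fr_closed: "m \<in> carrier M \<Longrightarrow> s \<in> S \<Longrightarrow> fr m s \<in> carrier LM"
  and fr_R_closed: "a \<in> carrier R \<Longrightarrow> s \<in> S \<Longrightarrow> fr_R a s \<in> carrier L"
  unfolding carrier_LM carrier_L by blast+

lemma add_LM:
  assumes [simp]: "m \<in> carrier M" "s \<in> S" "n \<in> carrier M" "t \<in> S"
  shows "fr m s \<oplus>\<^bsub>LM\<^esub> fr n t = fr (t \<odot>\<^bsub>M\<^esub> m \<oplus>\<^bsub>M\<^esub> s \<odot>\<^bsub>M\<^esub> n) (s \<otimes> t)"
proof -
  let ?F = "\<lambda>m s n t. fr (t \<odot>\<^bsub>M\<^esub> m \<oplus>\<^bsub>M\<^esub> s \<odot>\<^bsub>M\<^esub> n) (s \<otimes> t)"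
  have "?F m' s' n' t' = ?F m s n t" if mem: "(m', s') \<in> fr m s" "(n', t') \<in> fr n t" for m' s' n' t'
  proof -
    obtain u v where [simp]: "m' \<in> carrier M" "s' \<in> S" "n' \<in> carrier M" "t' \<in> S" "u \<in> S" "v \<in> S"
      and u: "(u \<otimes> s') \<odot>\<^bsub>M\<^esub> m = (u \<otimes> s) \<odot>\<^bsub>M\<^esub> m'" and v: "(v \<otimes> t') \<odot>\<^bsub>M\<^esub> n = (v \<otimes> t) \<odot>\<^bsub>M\<^esub> n'"
      using mem by (auto simp: mem_fraction)
    have 1: "(u \<otimes> v \<otimes> (s \<otimes> t) \<otimes> t') \<odot>\<^bsub>M\<^esub> m' = (u \<otimes> v \<otimes> (s' \<otimes> t') \<otimes> t) \<odot>\<^bsub>M\<^esub> m"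
      by (rule smult_eq_smult_cancel[OF u[symmetric], of _ "v \<otimes> t \<otimes> t'"]) (simp_all add: m_ac)
    have 2: "(u \<otimes> v \<otimes> (s \<otimes> t) \<otimes> s') \<odot>\<^bsub>M\<^esub> n' = (u \<otimes> v \<otimes> (s' \<otimes> t') \<otimes> s) \<odot>\<^bsub>M\<^esub> n"
      by (rule smult_eq_smult_cancel[OF v[symmetric], of _ "u \<otimes> s \<otimes> s'"]) (simp_all add: m_ac)
    have "(u \<otimes> v \<otimes> (s \<otimes> t)) \<odot>\<^bsub>M\<^esub> (t' \<odot>\<^bsub>M\<^esub> m' \<oplus>\<^bsub>M\<^esub> s' \<odot>\<^bsub>M\<^esub> n')
       = (u \<otimes> v \<otimes> (s' \<otimes> t')) \<odot>\<^bsub>M\<^esub> (t \<odot>\<^bsub>M\<^esub> m \<oplus>\<^bsub>M\<^esub> s \<odot>\<^bsub>M\<^esub> n)"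
      using 1 2 by (simp add: smult_r_distr smult_assoc1)
    then show ?thesis by (subst fraction_eq_iff) (auto intro!: bexI[of _ "u \<otimes> v"])
  qed
  then have "\<Union>{?F m' s' n' t' | m' s' n' t'. (m', s') \<in> fr m s \<and> (n', t') \<in> fr n t} = ?F m s n t"
    by (rule Union_image_constant[where F = ?F, OF _ fraction_self fraction_self]) simp_all
  then show ?thesis by (simp add: localized_module_def Let_def)
qed

lemma smult_LM:
  assumes [simp]: "a \<in> carrier R" "s \<in> S" "m \<in> carrier M" "t \<in> S"
  shows "fr_R a s \<odot>\<^bsub>LM\<^esub> fr m t = fr (a \<odot>\<^bsub>M\<^esub> m) (s \<otimes> t)"
proof -
  let ?F = "\<lambda>a s m t. fr (a \<odot>\<^bsub>M\<^esub> m) (s \<otimes> t)"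
  have "?F a' s' m' t' = ?F a s m t" if mem: "(a', s') \<in> fr_R a s" "(m', t') \<in> fr m t" for a' s' m' t'
  proof -
    obtain u v where [simp]: "a' \<in> carrier R" "s' \<in> S" "m' \<in> carrier M" "t' \<in> S" "u \<in> S" "v \<in> S"
      and u: "(u \<otimes> s') \<otimes> a = (u \<otimes> s) \<otimes> a'" and v: "(v \<otimes> t') \<odot>\<^bsub>M\<^esub> m = (v \<otimes> t) \<odot>\<^bsub>M\<^esub> m'"
      using mem by (auto simp: mem_fraction reg.mem_fraction)
    have "(u \<otimes> v \<otimes> (s \<otimes> t) \<otimes> a') \<odot>\<^bsub>M\<^esub> m' = (((u \<otimes> s) \<otimes> a') \<otimes> (v \<otimes> t)) \<odot>\<^bsub>M\<^esub> m'"
      by (simp add: m_ac)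
    also have "\<dots> = (((u \<otimes> s') \<otimes> a) \<otimes> (v \<otimes> t)) \<odot>\<^bsub>M\<^esub> m'" by (simp only: u)
    also have "\<dots> = (u \<otimes> v \<otimes> (s' \<otimes> t') \<otimes> a) \<odot>\<^bsub>M\<^esub> m"
      by (rule smult_eq_smult_cancel[OF v[symmetric], of _ "(u \<otimes> s') \<otimes> a"]) (simp_all add: m_ac)
    finally have "(u \<otimes> v \<otimes> (s \<otimes> t)) \<odot>\<^bsub>M\<^esub> (a' \<odot>\<^bsub>M\<^esub> m') = (u \<otimes> v \<otimes> (s' \<otimes> t')) \<odot>\<^bsub>M\<^esub> (a \<odot>\<^bsub>M\<^esub> m)"
      by (simp add: smult_assoc1)
    then show ?thesis by (subst fraction_eq_iff) (auto intro!: bexI[of _ "u \<otimes> v"])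
  qed
  then have "\<Union>{?F a' s' m' t' | a' s' m' t'. (a', s') \<in> fr_R a s \<and> (m', t') \<in> fr m t} = ?F a s m t"
    by (rule Union_image_constant[where F = ?F, OF _ reg.fraction_self fraction_self]) simp_all
  then show ?thesis by (simp add: localized_module_def Let_def)
qed

text \<open>Bringing a linear combination over a common denominator turns spanning in the
  localization into spanning up to a denominator in M. The module structure of the localization is a
  hypothesis since \<open>is_free_of_rank\<close> supplies it.\<close>

lemma lsum_LM_is_fraction:
  assumes LM: "module L LM" and "finite I"
    and "\<And>i. b i \<in> carrier M" "\<And>i. s i \<in> S" "\<And>i. q i \<in> carrier L"
  shows "\<exists>d t. (\<forall>i. d i \<in> carrier R) \<and> t \<in> S \<and> lsum LM I (\<lambda>i. fr (b i) (s i)) q = fr (lsum M I b d) t"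
  using assms(2)
proof (induction I rule: finite_induct)
  case empty
  show ?case using module.lsum_empty[OF LM] by (intro exI[of _ "\<lambda>_. \<zero>"] exI[of _ \<one>]) (simp add: zero_LM)
next
  case (insert k I)
  interpret LM: module L LM by (rule LM)
  note [simp] = assms(3,4,5)
  have [simp]: "fr (b i) (s i) \<in> carrier LM" for i by (simp add: fr_closed)
  obtain d t where d [simp]: "\<And>i. d i \<in> carrier R" and t [simp]: "t \<in> S"
    and IH: "lsum LM I (\<lambda>i. fr (b i) (s i)) q = fr (lsum M I b d) t" using insert by blast
  obtain a r where [simp]: "a \<in> carrier R" "r \<in> S" and qk: "q k = fr_R a r"
    using assms(5)[of k] unfolding carrier_L by blast
  \<comment> \<open>Numerators of the sum of the new term, with denominator
    \<open>r \<otimes> s k\<close>, and the old sum, with denominator \<open>t\<close>, after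
    cross-multiplication.\<close>
  let ?d = "\<lambda>i. if i = k then t \<otimes> a else (r \<otimes> s k) \<otimes> d i"
  have "lsum M (insert k I) b ?d = (t \<otimes> a) \<odot>\<^bsub>M\<^esub> b k \<oplus>\<^bsub>M\<^esub> lsum M I b ?d"
    using insert.hyps by (subst lsum_insert) auto
  also have "lsum M I b ?d = lsum M I b (\<lambda>i. (r \<otimes> s k) \<otimes> d i)"
    using insert.hyps by (intro lsum_cong) auto
  also have "\<dots> = (r \<otimes> s k) \<odot>\<^bsub>M\<^esub> lsum M I b d" using insert.hyps by (intro lsum_smult) auto
  finally have "fr (lsum M (insert k I) b ?d) (r \<otimes> s k \<otimes> t) =
      fr (t \<odot>\<^bsub>M\<^esub> (a \<odot>\<^bsub>M\<^esub> b k) \<oplus>\<^bsub>M\<^esub> (r \<otimes> s k) \<odot>\<^bsub>M\<^esub> lsum M I b d) (r \<otimes> s k \<otimes> t)"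
    by (simp add: smult_assoc1)
  also have "\<dots> = fr (a \<odot>\<^bsub>M\<^esub> b k) (r \<otimes> s k) \<oplus>\<^bsub>LM\<^esub> fr (lsum M I b d) t"
    by (simp add: add_LM)
  also have "\<dots> = q k \<odot>\<^bsub>LM\<^esub> fr (b k) (s k) \<oplus>\<^bsub>LM\<^esub> lsum LM I (\<lambda>i. fr (b i) (s i)) q"
    by (simp add: IH qk smult_LM)
  also have "\<dots> = lsum LM (insert k I) (\<lambda>i. fr (b i) (s i)) q"
    using insert.hyps by (subst LM.lsum_insert) simp_all
  finally show ?case
    by (intro exI[of _ ?d] exI[of _ "r \<otimes> s k \<otimes> t"]) simp
qed

text \<open>With coefficients \<open>c i \<otimes> s i\<close> the denominators of the vectors
  cancel. Thus a relation in M becomes a relation among the fractions, to which independence in the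
  localization applies.\<close>

lemma lsum_LM_clear_denominators:
  assumes LM: "module L LM" and "finite I"
    and "\<And>i. b i \<in> carrier M" "\<And>i. s i \<in> S" "\<And>i. c i \<in> carrier R"
  shows "lsum LM I (\<lambda>i. fr (b i) (s i)) (\<lambda>i. fr_R (c i \<otimes> s i) \<one>) = fr (lsum M I b c) \<one>"
  using assms(2)
proof (induction I rule: finite_induct)
  case empty
  show ?case using module.lsum_empty[OF LM] by (simp add: zero_LM)
next
  case (insert k I)
  interpret LM: module L LM by (rule LM)
  note [simp] = assms(3,4,5)
  have [simp]: "fr (b i) (s i) \<in> carrier LM" "fr_R (c i \<otimes> s i) \<one> \<in> carrier L" for i
    by (simp_all add: fr_closed fr_R_closed)
  have "fr_R (c k \<otimes> s k) \<one> \<odot>\<^bsub>LM\<^esub> fr (b k) (s k) = fr ((c k \<otimes> s k) \<odot>\<^bsub>M\<^esub> b k) (s k)"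
    by (simp add: smult_LM)
  also have "\<dots> = fr (c k \<odot>\<^bsub>M\<^esub> b k) \<one>"
  proof -
    have "(\<one> \<otimes> \<one>) \<odot>\<^bsub>M\<^esub> ((c k \<otimes> s k) \<odot>\<^bsub>M\<^esub> b k) = (\<one> \<otimes> s k) \<odot>\<^bsub>M\<^esub> (c k \<odot>\<^bsub>M\<^esub> b k)"
      by (simp add: smult_assoc1[symmetric] m_ac)
    then show ?thesis by (intro fraction_eq_iff[THEN iffD2, OF _ _ _ _ bexI[OF _ one_S]]) simp_all
  qed
  finally show ?case
    using insert by (simp add: LM.lsum_insert add_LM lsum_insert)
qed

end

lemma (in cring) common_annihilator:
  assumes "finite I" "S \<subseteq> carrier R" "\<one> \<in> S" "\<And>s t. s \<in> S \<Longrightarrow> t \<in> S \<Longrightarrow> s \<otimes> t \<in> S"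
    and "\<And>i. c i \<in> carrier R" "\<And>i. i \<in> I \<Longrightarrow> \<exists>s\<in>S. s \<otimes> c i = \<zero>"
  shows "\<exists>s\<in>S. \<forall>i\<in>I. s \<otimes> c i = \<zero>"
  using assms(1,6)
proof (induction I rule: finite_induct)
  case empty
  then show ?case using assms(3) by auto
next
  case (insert k I)
  obtain s where s: "s \<in> S" "\<And>i. i \<in> I \<Longrightarrow> s \<otimes> c i = \<zero>" using insert by blast
  obtain t where t: "t \<in> S" "t \<otimes> c k = \<zero>" using insert.prems by blast
  have [simp]: "s \<in> carrier R" "t \<in> carrier R" using s t assms(2) by auto
  have "(s \<otimes> t) \<otimes> c i = \<zero>" if "i \<in> insert k I" for i
  proof (cases "i = k")
    case True
    then show ?thesis using t assms(5) by (simp add: m_assoc)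
  next
    case False
    then have "s \<otimes> c i = \<zero>" using s that by simp
    then have "t \<otimes> (s \<otimes> c i) = \<zero>" by simp
    then show ?thesis using assms(5) by (simp add: m_ac)
  qed
  then show ?case using assms(4)[OF s(1) t(1)] by blast
qed

text \<open>The numerators of a basis of the localization serve as local basis: changing a vector by
  a denominator outside \<open>P\<close> changes it by a unit of the localized ring.\<close>

lemma (in module) local_basis_if_localization_free:
  assumes P: "primeideal P R"
    and free: "is_free_of_rank (localized_ring R (carrier R - P)) (localized_module R (carrier R - P) M) n"
  obtains b :: "nat \<Rightarrow> 'c" where "local_basis R M P {..<n} b"
proof -
  let ?S = "carrier R - P"
  interpret localization R M ?S
    by (intro localization.intro module_axioms localization_axioms.intro)
      (use prime_complement_one[OF P] prime_complement_mult[OF P] in auto)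
  have LM: "module L LM" using free by (simp add: is_free_of_rank_def)
  interpret LM: module L LM by (rule LM)
  obtain B where B: "B \<subseteq> carrier LM" "finite B" "card B = n" and li: "LM.lin_indpt B"
    and sp: "LM.span B = carrier LM"
    using free by (auto simp: is_free_of_rank_def is_basis_def)
  obtain h where h: "bij_betw h {..<n} B"
    using ex_bij_betw_nat_finite[OF B(2)] B(3) by (auto simp: atLeast0LessThan)
  \<comment> \<open>Indices from \<open>n\<close> on get the fraction 0/1, so that the families of
    numerators and denominators are total.\<close>
  have "\<exists>p. fst p \<in> carrier M \<and> snd p \<in> ?S \<and> (i < n \<longrightarrow> h i = fr (fst p) (snd p))" for i
  proof (cases "i < n")
    case True
    then have "h i \<in> carrier LM" using h B(1) by (auto simp: bij_betw_def)
    then show ?thesis unfolding carrier_LM by auto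
  next
    case False
    then show ?thesis by (intro exI[of _ "(\<zero>\<^bsub>M\<^esub>, \<one>)"]) (use one_S in simp)
  qed
  then obtain p where p: "\<And>i. fst (p i) \<in> carrier M" "\<And>i. snd (p i) \<in> ?S"
    "\<And>i. i < n \<Longrightarrow> h i = fr (fst (p i)) (snd (p i))" by metis
  define b s where "b i = fst (p i)" and "s i = snd (p i)" for i
  have b [simp]: "b i \<in> carrier M" and s: "s i \<in> ?S" and hb: "i < n \<Longrightarrow> h i = fr (b i) (s i)" for i
    using p by (simp_all add: b_def s_def)
  have frb [simp]: "fr (b i) (s i) \<in> carrier LM" for i using s by (intro fr_closed b)
  have lsum_B: "LM.lincomb a B = lsum LM {..<n} (\<lambda>i. fr (b i) (s i)) q"
    if aq: "a \<in> B \<rightarrow> carrier L" "\<And>i. i < n \<Longrightarrow> a (h i) = q i" for a q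
  proof -
    have "LM.lincomb a B = lsum LM B (\<lambda>v. v) a" by (simp add: LM.lincomb_def lsum_def)
    also have "\<dots> = lsum LM {..<n} h (\<lambda>i. a (h i))"
      using B aq by (intro LM.lsum_reindex[OF h]) auto
    also have "\<dots> = lsum LM {..<n} (\<lambda>i. fr (b i) (s i)) q"
    proof (intro LM.lsum_cong)
      show "q i \<in> carrier L" if "i \<in> {..<n}" for i
        using aq(1) aq(2)[of i, symmetric] that h by (auto simp: bij_betw_def)
    qed (use aq(2) in \<open>auto simp: hb\<close>)
    finally show ?thesis .
  qed
  have "local_basis R M P {..<n} b"
    unfolding local_basis_def
  proof (intro conjI allI ballI impI)
    fix y assume y: "y \<in> carrier M"
    then have "fr y \<one> \<in> LM.span B" unfolding sp using one_S by (intro fr_closed)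
    then obtain a where a: "a \<in> B \<rightarrow> carrier L" "LM.lincomb a B = fr y \<one>"
      using LM.finite_in_span[OF B(2,1)] by blast
    define q where "q i = (if i < n then a (h i) else \<zero>\<^bsub>L\<^esub>)" for i
    have q: "q i \<in> carrier L" for i using a(1) h by (auto simp: q_def bij_betw_def)
    obtain d t where d: "\<forall>i. d i \<in> carrier R" and t: "t \<in> ?S"
      and "lsum LM {..<n} (\<lambda>i. fr (b i) (s i)) q = fr (lsum M {..<n} b d) t"
      using lsum_LM_is_fraction[where b = b and s = s and q = q and I = "{..<n}", OF LM finite_lessThan b s q]
      by (elim exE conjE)
    then have "fr y \<one> = fr (lsum M {..<n} b d) t"
      using lsum_B[OF a(1), of q] a(2) by (simp add: q_def)
    then obtain u where u: "u \<in> ?S" and "(u \<otimes> t) \<odot>\<^bsub>M\<^esub> y = (u \<otimes> \<one>) \<odot>\<^bsub>M\<^esub> lsum M {..<n} b d"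
      using y d t one_S by (subst (asm) fraction_eq_iff) auto
    then have "(u \<otimes> t) \<odot>\<^bsub>M\<^esub> y = lsum M {..<n} b (\<lambda>i. u \<otimes> d i)"
      using d by (simp add: lsum_smult)
    then show "\<exists>s\<in>?S. \<exists>c. (\<forall>i. c i \<in> carrier R) \<and> s \<odot>\<^bsub>M\<^esub> y = lsum M {..<n} b c"
      using d u by (intro bexI[OF _ mult_S[OF u t]] exI[of _ "\<lambda>i. u \<otimes> d i"]) auto
  next
    fix c assume "\<forall>i. c i \<in> carrier R" and 0: "lsum M {..<n} b c = \<zero>\<^bsub>M\<^esub>"
    then have c [simp]: "c i \<in> carrier R" for i by blast
    define q where "q i = fr_R (c i \<otimes> s i) \<one>" for i
    have q: "q i \<in> carrier L" for i using s[of i] one_S unfolding q_def by (intro fr_R_closed) auto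
    \<comment> \<open>Coefficients indexed by numbers are moved to the basis set along the inverse
      of the bijection \<open>h\<close>, since independence of \<open>B\<close> speaks of
      coefficients attached to vectors.\<close>
    define a where "a v = q (the_inv_into {..<n} h v)" for v
    have ah: "a (h i) = q i" if "i < n" for i
      using h that by (simp add: a_def the_inv_into_f_f bij_betw_def)
    have "LM.lincomb a B = fr (lsum M {..<n} b c) \<one>"
      using lsum_B[of a q] ah q lsum_LM_clear_denominators[where b = b and s = s and c = c and I = "{..<n}", OF LM finite_lessThan b s c]
      by (simp add: a_def q_def[abs_def])
    then have "LM.lincomb a B = \<zero>\<^bsub>LM\<^esub>" by (simp add: 0 zero_LM)
    then have a0: "a v = \<zero>\<^bsub>L\<^esub>" if "v \<in> B" for v
      using li LM.lin_dep_crit[of B B a v] B that q by (auto simp: a_def)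
    \<comment> \<open>Each coefficient vanishes in the localized ring with an annihilator of its
      own; the product of the finitely many annihilators works for all.\<close>
    show "\<exists>s\<in>?S. \<forall>i\<in>{..<n}. s \<otimes> c i = \<zero>"
    proof (rule common_annihilator)
      fix i assume i: "i \<in> {..<n}"
      then have "h i \<in> B" using h by (auto simp: bij_betw_def)
      then have "fr_R (c i \<otimes> s i) \<one> = fr_R \<zero> \<one>"
        using a0[of "h i"] ah[of i] i by (simp add: q_def zero_L)
      then obtain u where u: "u \<in> ?S" and "(u \<otimes> \<one>) \<otimes> (c i \<otimes> s i) = (u \<otimes> \<one>) \<otimes> \<zero>"
        using s[of i] one_S by (subst (asm) reg.fraction_eq_iff) auto
      then have "(u \<otimes> s i) \<otimes> c i = \<zero>" using s[of i] by (simp add: m_ac)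
      then show "\<exists>s\<in>?S. s \<otimes> c i = \<zero>" using mult_S[OF u s] by blast
    qed (use one_S mult_S in auto)
  qed simp_all
  then show thesis by (rule that)
qed

section \<open>Free and projective modules\<close>

context module
begin

lemma lsum_support:
  assumes "finite J" "J' \<subseteq> J" "\<And>i. i \<in> J - J' \<Longrightarrow> c i = \<zero>"
    and "\<And>i. i \<in> J \<Longrightarrow> b i \<in> carrier M" "\<And>i. i \<in> J \<Longrightarrow> c i \<in> carrier R"
  shows "lsum M J b c = lsum M J' b c"
  unfolding lsum_def using assms by (intro M.add.finprod_mono_neutral_cong_left[symmetric]) auto

end

section \<open>The free module of finitely supported functions\<close>

context cring
begin

lemma carrier_free_module:
    "carrier (free_module R I) = {f \<in> I \<rightarrow>\<^sub>E carrier R. finite {i \<in> I. f i \<noteq> \<zero>}}"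
  and add_free_module: "f \<oplus>\<^bsub>free_module R I\<^esub> g = (\<lambda>i\<in>I. f i \<oplus> g i)"
  and smult_free_module: "a \<odot>\<^bsub>free_module R I\<^esub> f = (\<lambda>i\<in>I. a \<otimes> f i)"
  and zero_free_module: "\<zero>\<^bsub>free_module R I\<^esub> = (\<lambda>i\<in>I. \<zero>)"
  by (simp_all add: free_module_def func_space_def)

lemma free_module_closed [simp]: "f \<in> carrier (free_module R I) \<Longrightarrow> i \<in> I \<Longrightarrow> f i \<in> carrier R"
  by (auto simp: carrier_free_module)

lemma free_module_is_module: "module R (free_module R I)"
proof -
  interpret fs: module R "func_space I" by (rule func_space_is_module)
  let ?C = "{f \<in> I \<rightarrow>\<^sub>E carrier R. finite {i \<in> I. f i \<noteq> \<zero>}}"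
  have "submodule R ?C (func_space I)"
  proof (rule submodule.intro)
    show "module R (func_space I)" by (rule func_space_is_module)
    show "?C \<subseteq> carrier (func_space I)" by (auto simp: func_space_def)
    show "\<zero>\<^bsub>func_space I\<^esub> \<in> ?C" by (simp add: func_space_def)
    show "v \<oplus>\<^bsub>func_space I\<^esub> w \<in> ?C" if vw: "v \<in> ?C" "w \<in> ?C" for v w
    proof -
      have "finite ({i \<in> I. v i \<noteq> \<zero>} \<union> {i \<in> I. w i \<noteq> \<zero>})" using vw by simp
      then have "finite {i \<in> I. v i \<oplus> w i \<noteq> \<zero>}"
        by (rule rev_finite_subset) auto
      then have "finite {i \<in> I. (v \<oplus>\<^bsub>func_space I\<^esub> w) i \<noteq> \<zero>}"
        by (rule rev_finite_subset) (auto simp: func_space_def)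
      then show ?thesis using vw by (auto simp: func_space_def)
    qed
    show "c \<odot>\<^bsub>func_space I\<^esub> v \<in> ?C" if c: "c \<in> carrier R" and v: "v \<in> ?C" for c v
    proof -
      have "finite {i \<in> I. v i \<noteq> \<zero>}" using v by simp
      then have "finite {i \<in> I. (c \<odot>\<^bsub>func_space I\<^esub> v) i \<noteq> \<zero>}"
        by (rule rev_finite_subset) (use c in \<open>auto simp: func_space_def\<close>)
      then show ?thesis using c v by (auto simp: func_space_def)
    qed
  qed
  from fs.submodule_is_module[OF this] show ?thesis by (simp add: free_module_def)
qed

lemma unit_vector_closed [simp]: "i \<in> I \<Longrightarrow> unit_vector R I i \<in> carrier (free_module R I)"
  by (auto simp: carrier_free_module unit_vector_def intro: rev_finite_subset[of "{i}"])

lemma lsum_unit_vector: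
  assumes "finite J" "J \<subseteq> I" "\<And>i. i \<in> J \<Longrightarrow> c i \<in> carrier R"
  shows "lsum (free_module R I) J (unit_vector R I) c = (\<lambda>i\<in>I. if i \<in> J then c i else \<zero>)"
  using assms
proof (induction J rule: finite_induct)
  case empty
  then show ?case
    by (simp only: module.lsum_empty[OF free_module_is_module] zero_free_module) (rule restrict_ext, simp)
next
  case (insert k J)
  interpret F: module R "free_module R I" by (rule free_module_is_module)
  have IH: "lsum (free_module R I) J (unit_vector R I) c = (\<lambda>i\<in>I. if i \<in> J then c i else \<zero>)"
    by (rule insert.IH) (use insert.prems in auto)
  have "lsum (free_module R I) (insert k J) (unit_vector R I) c =
      c k \<odot>\<^bsub>free_module R I\<^esub> unit_vector R I k \<oplus>\<^bsub>free_module R I\<^esub> lsum (free_module R I) J (unit_vector R I) c"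
    using insert.hyps insert.prems by (intro F.lsum_insert) auto
  also have "\<dots> = (\<lambda>i\<in>I. if i \<in> insert k J then c i else \<zero>)"
    unfolding IH add_free_module smult_free_module
    using insert.hyps insert.prems by (intro restrict_ext) (auto simp: unit_vector_def)
  finally show ?case .
qed

lemma free_module_expansion:
  assumes f: "f \<in> carrier (free_module R I)" and J: "finite J" "J \<subseteq> I"
    and "\<And>i. i \<in> I - J \<Longrightarrow> f i = \<zero>"
  shows "lsum (free_module R I) J (unit_vector R I) f = f"
proof -
  have "lsum (free_module R I) J (unit_vector R I) f = (\<lambda>i\<in>I. if i \<in> J then f i else \<zero>)"
    using J f by (intro lsum_unit_vector) auto
  also have "\<dots> = f"
  proof
    fix i
    have "f \<in> I \<rightarrow>\<^sub>E carrier R" using f by (simp add: carrier_free_module)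
    from PiE_arb[OF this, of i] show "(\<lambda>i\<in>I. if i \<in> J then f i else \<zero>) i = f i"
      using assms(4)[of i] by (cases "i \<in> I"; cases "i \<in> J") simp_all
  qed
  finally show ?thesis .
qed

lemma free_module_support:
  assumes f: "f \<in> carrier (free_module R I)"
  obtains J where "finite J" "J \<subseteq> I" "\<And>i. i \<in> I - J \<Longrightarrow> f i = \<zero>"
    "lsum (free_module R I) J (unit_vector R I) f = f"
proof (rule that)
  let ?J = "{i \<in> I. f i \<noteq> \<zero>}"
  show "finite ?J" "?J \<subseteq> I" "\<And>i. i \<in> I - ?J \<Longrightarrow> f i = \<zero>"
    using f by (auto simp: carrier_free_module)
  then show "lsum (free_module R I) ?J (unit_vector R I) f = f"
    by (rule free_module_expansion[OF f])
qed

end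

text \<open>The universal property of the free module. The support of a sum can be smaller than the
  union of the supports, so \<open>supp\<close> first replaces the support by any finite set
  containing it, and both functions are then summed over a common set.\<close>

lemma (in module) free_module_lift:
  assumes b: "\<And>i. i \<in> I \<Longrightarrow> b i \<in> carrier M"
  obtains h where "h \<in> module_hom R (free_module R I) M"
    and "\<And>i. i \<in> I \<Longrightarrow> h (unit_vector R I i) = b i"
proof
  let ?F = "free_module R I"
  define h where "h f = lsum M {i \<in> I. f i \<noteq> \<zero>} b f" for f
  have supp: "h f = lsum M J b f"
    if "f \<in> carrier ?F" "finite J" "J \<subseteq> I" "\<And>i. i \<in> I - J \<Longrightarrow> f i = \<zero>" for f J
    unfolding h_def using that b by (intro lsum_support[symmetric]) auto
  interpret F: module R ?F by (rule free_module_is_module)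
  show "h \<in> module_hom R ?F M"
  proof (rule module_homI)
    show "h f \<in> carrier M" if "f \<in> carrier ?F" for f
      unfolding h_def using that b by (intro lsum_closed) auto
    show "h (f \<oplus>\<^bsub>?F\<^esub> g) = h f \<oplus>\<^bsub>M\<^esub> h g" if f: "f \<in> carrier ?F" and g: "g \<in> carrier ?F" for f g
    proof -
      obtain J where J: "finite J" "J \<subseteq> I" "\<And>i. i \<in> I - J \<Longrightarrow> f i = \<zero>"
        using free_module_support[OF f] by metis
      obtain K where K: "finite K" "K \<subseteq> I" "\<And>i. i \<in> I - K \<Longrightarrow> g i = \<zero>"
        using free_module_support[OF g] by metis
      have bJK: "b i \<in> carrier M" "f i \<in> carrier R" "g i \<in> carrier R" if "i \<in> J \<union> K" for i
        using that J K b f g by auto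
      have "h (f \<oplus>\<^bsub>?F\<^esub> g) = lsum M (J \<union> K) b (f \<oplus>\<^bsub>?F\<^esub> g)"
        using J K f g F.a_closed[OF f g] by (intro supp) (auto simp: add_free_module)
      also have "\<dots> = lsum M (J \<union> K) b (\<lambda>i. f i \<oplus> g i)"
        using J K bJK by (intro lsum_cong) (auto simp: add_free_module)
      also have "\<dots> = lsum M (J \<union> K) b f \<oplus>\<^bsub>M\<^esub> lsum M (J \<union> K) b g"
        using bJK by (intro lsum_add) auto
      also have "\<dots> = h f \<oplus>\<^bsub>M\<^esub> h g"
        using supp[OF f, of "J \<union> K"] supp[OF g, of "J \<union> K"] J K by auto
      finally show ?thesis .
    qed
    show "h (a \<odot>\<^bsub>?F\<^esub> f) = a \<odot>\<^bsub>M\<^esub> h f" if a: "a \<in> carrier R" and f: "f \<in> carrier ?F" for a f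
    proof -
      obtain J where J: "finite J" "J \<subseteq> I" "\<And>i. i \<in> I - J \<Longrightarrow> f i = \<zero>"
        using free_module_support[OF f] by metis
      have bJ: "b i \<in> carrier M" "f i \<in> carrier R" if "i \<in> J" for i using that J b f by auto
      have "h (a \<odot>\<^bsub>?F\<^esub> f) = lsum M J b (a \<odot>\<^bsub>?F\<^esub> f)"
        using J a F.smult_closed[OF a f] by (intro supp) (auto simp: smult_free_module)
      also have "\<dots> = lsum M J b (\<lambda>i. a \<otimes> f i)"
        using J a bJ by (intro lsum_cong) (auto simp: smult_free_module)
      also have "\<dots> = a \<odot>\<^bsub>M\<^esub> lsum M J b f" using bJ J a by (intro lsum_smult) auto
      also have "\<dots> = a \<odot>\<^bsub>M\<^esub> h f" using supp[OF f J] by simp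
      finally show ?thesis .
    qed
  qed
  show "h (unit_vector R I i) = b i" if i: "i \<in> I" for i
  proof -
    have "h (unit_vector R I i) = lsum M {i} b (unit_vector R I i)"
      using i by (intro supp[OF unit_vector_closed[OF i]]) (auto simp: unit_vector_def)
    also have "\<dots> = b i" using lsum_insert[of "{}" i b "unit_vector R I i"] i b
      by (simp add: unit_vector_def)
    finally show ?thesis .
  qed
qed

text \<open>M embeds into a free module as a summand. Finitely many generators involve a finite set
  \<open>J\<close> of coordinates; these coordinates restrict to the forms, and projecting the
  preimages of the unit vectors to M gives the elements.\<close>

lemma (in module) dual_basis_exists:
  assumes "finitely_generated R M" and "projective R M"
  obtains n g \<psi> where "dual_basis R M n g \<psi>"
proof -
  obtain A where A: "finite A" "A \<subseteq> carrier M" "span A = carrier M"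
    using assms(1) unfolding finitely_generated_def by blast
  obtain I :: "'c set" and N :: "('a, 'c \<Rightarrow> 'a) module" where N: "module R N"
    and "module_isomorphic R (direct_sum M N) (free_module R I)"
    using assms(2) unfolding projective_def by blast
  then obtain f where f: "f \<in> module_hom R (direct_sum M N) (free_module R I)"
    and bij: "bij_betw f (carrier (direct_sum M N)) (carrier (free_module R I))"
    unfolding module_isomorphic_def by blast
  let ?D = "direct_sum M N" and ?F = "free_module R I"
  interpret N: module R N by (rule N)
  interpret D: module R ?D by (rule direct_sum_is_module[OF module_axioms N])
  interpret F: module R ?F by (rule free_module_is_module)
  interpret f: mod_hom R ?D ?F f by (rule mod_homI[OF D.module_axioms F.module_axioms f])
  interpret fst: mod_hom R ?D M fst
    by (rule mod_homI[OF D.module_axioms module_axioms], rule module_homI) (auto simp: direct_sum_def)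
  define e where "e y = f (y, \<zero>\<^bsub>N\<^esub>)" for y
  have D0: "(y, \<zero>\<^bsub>N\<^esub>) \<in> carrier ?D" if "y \<in> carrier M" for y using that by (simp add: direct_sum_def)
  have e: "e \<in> module_hom R M ?F"
  proof (rule module_homI)
    show "e y \<in> carrier ?F" if "y \<in> carrier M" for y using D0[OF that] by (simp add: e_def)
    show "e (y \<oplus>\<^bsub>M\<^esub> z) = e y \<oplus>\<^bsub>?F\<^esub> e z" if "y \<in> carrier M" "z \<in> carrier M" for y z
      using f.f_add[OF D0[OF that(1)] D0[OF that(2)]] by (simp add: e_def direct_sum_def)
    show "e (r \<odot>\<^bsub>M\<^esub> y) = r \<odot>\<^bsub>?F\<^esub> e y" if "r \<in> carrier R" "y \<in> carrier M" for r y
      using f.f_smult[OF that(1) D0[OF that(2)]] that by (simp add: e_def direct_sum_def)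
  qed
  interpret e: mod_hom R M ?F e by (rule mod_homI[OF module_axioms F.module_axioms e])
  define J where "J = (\<Union>a\<in>A. {i \<in> I. e a i \<noteq> \<zero>})"
  have J: "finite J" "J \<subseteq> I"
    using A e.f_im unfolding J_def by (auto simp: carrier_free_module)
  have ec: "e y i \<in> carrier R" if "y \<in> carrier M" "i \<in> J" for y i
    using free_module_closed[OF e.f_im[OF that(1)]] J(2) that(2) by blast
  \<comment> \<open>Vanishing of the coordinates outside \<open>J\<close> is a linear condition, so
    it passes from the generators to all of M.\<close>
  let ?K = "{y \<in> carrier M. \<forall>i\<in>I - J. e y i = \<zero>}"
  have sub: "submodule R ?K M"
  proof (rule submodule.intro)
    show "\<zero>\<^bsub>M\<^esub> \<in> ?K" by (simp add: zero_free_module)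
    show "v \<oplus>\<^bsub>M\<^esub> w \<in> ?K" if "v \<in> ?K" "w \<in> ?K" for v w using that by (simp add: add_free_module)
    show "c \<odot>\<^bsub>M\<^esub> v \<in> ?K" if "c \<in> carrier R" "v \<in> ?K" for c v using that by (simp add: smult_free_module)
  qed (auto simp: module_axioms)
  have "A \<subseteq> ?K" using A(2) by (auto simp: J_def)
  from span_is_subset[OF this sub] have "carrier M \<subseteq> ?K" unfolding A(3) .
  then have eJ: "e y i = \<zero>" if "y \<in> carrier M" "i \<in> I - J" for y i using that by blast
  define w where "w i = inv_into (carrier ?D) f (unit_vector R I i)" for i
  have w: "w i \<in> carrier ?D" "f (w i) = unit_vector R I i" if "i \<in> J" for i
  proof -
    have "unit_vector R I i \<in> f ` carrier ?D"
      using bij that J by (auto simp: bij_betw_def)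
    then show "w i \<in> carrier ?D" "f (w i) = unit_vector R I i"
      unfolding w_def by (rule inv_into_into, rule f_inv_into_f)
  qed
  \<comment> \<open>The expansion of \<open>e y\<close> in unit vectors is pulled back along the
    bijection \<open>f\<close> and then projected to the first component.\<close>
  have exp: "y = lsum M J (\<lambda>i. fst (w i)) (e y)" if y: "y \<in> carrier M" for y
  proof -
    have ey: "e y i \<in> carrier R" if "i \<in> J" for i using ec[OF y that] .
    have "f (lsum ?D J w (e y)) = lsum ?F J (\<lambda>i. f (w i)) (e y)"
      using J w ey by (intro f.hom_lsum) auto
    also have "\<dots> = lsum ?F J (unit_vector R I) (e y)"
      using J w ey by (intro F.lsum_cong) auto
    also have "\<dots> = f (y, \<zero>\<^bsub>N\<^esub>)"
      using free_module_expansion[of "e y" I J] J eJ y by (simp add: e_def[symmetric])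
    finally have "lsum ?D J w (e y) = (y, \<zero>\<^bsub>N\<^esub>)"
      using bij D.lsum_closed[of J w "e y"] w ey D0[OF y] by (auto simp: bij_betw_def dest: inj_onD)
    then have "y = fst (lsum ?D J w (e y))" by simp
    also have "\<dots> = lsum M J (\<lambda>i. fst (w i)) (e y)" using J w ey by (intro fst.hom_lsum) auto
    finally show ?thesis .
  qed
  obtain h where h: "bij_betw h {..<card J} J"
    using ex_bij_betw_nat_finite[OF J(1)] by (auto simp: atLeast0LessThan)
  have hJ: "h i \<in> J" if "i < card J" for i using h that by (auto simp: bij_betw_def)
  \<comment> \<open>Zero fills the indices from \<open>card J\<close> on, because
    \<open>dual_basis\<close> asks for total families.\<close>
  define g where "g i = (if i < card J then fst (w (h i)) else \<zero>\<^bsub>M\<^esub>)" for i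
  define \<psi> where "\<psi> i y = (if i < card J then e y (h i) else \<zero>)" for i y
  have "dual_basis R M (card J) g \<psi>"
    unfolding dual_basis_def
  proof (intro conjI allI ballI)
    show "g i \<in> carrier M" for i using w hJ fst.f_im by (simp add: g_def)
    show "\<psi> i \<in> module_hom R M (regular_module R)" for i
    proof (rule module_homI)
      show "\<psi> i y \<in> carrier (regular_module R)" if "y \<in> carrier M" for y
        using that hJ[of i] ec by (auto simp: \<psi>_def)
      show "\<psi> i (y \<oplus>\<^bsub>M\<^esub> z) = \<psi> i y \<oplus>\<^bsub>regular_module R\<^esub> \<psi> i z" if "y \<in> carrier M" "z \<in> carrier M" for y z
        using that hJ[of i] J by (auto simp: \<psi>_def add_free_module)
      show "\<psi> i (r \<odot>\<^bsub>M\<^esub> y) = r \<odot>\<^bsub>regular_module R\<^esub> \<psi> i y" if "r \<in> carrier R" "y \<in> carrier M" for r y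
        using that hJ[of i] J by (auto simp: \<psi>_def smult_free_module)
    qed
    show "lsum M {..<card J} g (\<lambda>i. \<psi> i y) = y" if y: "y \<in> carrier M" for y
    proof -
      have wJ: "fst (w i) \<in> carrier M" "e y i \<in> carrier R" if "i \<in> J" for i
        using that w y fst.f_im ec by auto
      have "y = lsum M {..<card J} (\<lambda>i. fst (w (h i))) (\<lambda>i. e y (h i))"
        using exp[OF y] lsum_reindex[OF h, of "\<lambda>i. fst (w i)" "e y"] wJ by simp
      also have "\<dots> = lsum M {..<card J} g (\<lambda>i. \<psi> i y)"
        using wJ hJ by (intro lsum_cong) (auto simp: g_def \<psi>_def)
      finally show ?thesis by simp
    qed
  qed
  then show thesis by (rule that)
qed

theorem (in cring) constant_rank_projective_is_free:
  fixes M :: "('a, 'c, 'm) module_scheme"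
  assumes "represents_units R" and "module R M" and "finitely_generated R M" and "projective R M"
    and "has_constant_rank R M r"
  shows "is_free R M"
proof -
  interpret module R M by fact
  obtain n g \<psi> where "dual_basis R M n g \<psi>"
    using dual_basis_exists[OF assms(3,4)] .
  moreover have "\<exists>I (b :: nat \<Rightarrow> 'c). card I = r \<and> local_basis R M m I b" if m: "maximalideal m R" for m
  proof -
    have P: "primeideal m R" by (rule maximalideal_prime[OF m])
    then obtain b :: "nat \<Rightarrow> 'c" where "local_basis R M m {..<r} b"
      using local_basis_if_localization_free[OF P, of r] assms(5) unfolding has_constant_rank_def by blast
    then show ?thesis by (intro exI[of _ "{..<r}"] exI[of _ b]) simp
  qed
  ultimately have "\<exists>B. is_basis R M B"
    by (rule is_basis_exists_if_constant_rank[OF assms(1,2)])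
  with assms(2) show ?thesis by (simp add: is_free_def)
qed

section \<open>Tensor products and the Picard group\<close>

lemma module_isomorphic_sym:
  assumes M: "module R M" and iso: "module_isomorphic R M N"
  shows "module_isomorphic R N M"
proof -
  interpret module R M by (rule M)
  obtain f where f: "f \<in> module_hom R M N" and bij: "bij_betw f (carrier M) (carrier N)"
    using iso unfolding module_isomorphic_def by blast
  let ?g = "inv_into (carrier M) f"
  have g: "?g y \<in> carrier M" "f (?g y) = y" if "y \<in> carrier N" for y
    using that bij by (auto simp: bij_betw_def inv_into_into f_inv_into_f)
  have gf: "?g (f x) = x" if "x \<in> carrier M" for x
    using that bij by (simp add: bij_betw_def)
  have "?g \<in> module_hom R N M"
  proof (rule module_homI)
    show "?g y \<in> carrier M" if "y \<in> carrier N" for y by (rule g(1)[OF that])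
    show "?g (y \<oplus>\<^bsub>N\<^esub> z) = ?g y \<oplus>\<^bsub>M\<^esub> ?g z" if "y \<in> carrier N" "z \<in> carrier N" for y z
      using gf[of "?g y \<oplus>\<^bsub>M\<^esub> ?g z"] module_hom_add[OF f g(1)[OF that(1)] g(1)[OF that(2)]]
      by (simp add: g that)
    show "?g (r \<odot>\<^bsub>N\<^esub> y) = r \<odot>\<^bsub>M\<^esub> ?g y" if "r \<in> carrier R" "y \<in> carrier N" for r y
      using gf[of "r \<odot>\<^bsub>M\<^esub> ?g y"] module_hom_smult[OF f that(1) g(1)[OF that(2)]]
      by (simp add: g that)
  qed
  moreover have "bij_betw ?g (carrier N) (carrier M)" by (rule bij_betw_inv_into[OF bij])
  ultimately show ?thesis unfolding module_isomorphic_def by blast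
qed

lemma module_isomorphic_trans:
  assumes "module_isomorphic R M N" and "module_isomorphic R N P"
  shows "module_isomorphic R M P"
proof -
  obtain f where f: "f \<in> module_hom R M N" "bij_betw f (carrier M) (carrier N)"
    using assms(1) unfolding module_isomorphic_def by blast
  obtain g where g: "g \<in> module_hom R N P" "bij_betw g (carrier N) (carrier P)"
    using assms(2) unfolding module_isomorphic_def by blast
  have fc: "f x \<in> carrier N" if "x \<in> carrier M" for x using module_hom_closed[OF f(1)] that by blast
  have gc: "g x \<in> carrier P" if "x \<in> carrier N" for x using module_hom_closed[OF g(1)] that by blast
  have "(\<lambda>x. g (f x)) \<in> module_hom R M P"
    by (rule module_homI)
      (simp_all add: fc gc module_hom_add[OF f(1)] module_hom_add[OF g(1)]
        module_hom_smult[OF f(1)] module_hom_smult[OF g(1)])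
  moreover have "bij_betw (\<lambda>x. g (f x)) (carrier M) (carrier P)"
    using bij_betw_trans[OF f(2) g(2)] by (simp add: comp_def)
  ultimately show ?thesis unfolding module_isomorphic_def by blast
qed

context module
begin

lemma submodule_abelian_subgroup:
  assumes "submodule R K M"
  shows "abelian_subgroup K M"
proof (rule abelian_subgroupI3)
  show "additive_subgroup K M"
  proof (rule additive_subgroup.intro, rule M.add.subgroupI)
    show "K \<subseteq> carrier M" by (rule submodule.subset[OF assms])
    show "K \<noteq> {}" using submodule.zero_closed[OF assms] by blast
    show "\<ominus>\<^bsub>M\<^esub> a \<in> K" if "a \<in> K" for a
      using submodule.smult_closed[OF assms, of "\<ominus> \<one>" a] submodule.subset[OF assms] that
      by (auto simp: smult_minus_1)
    show "a \<oplus>\<^bsub>M\<^esub> b \<in> K" if "a \<in> K" "b \<in> K" for a b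
      using that by (rule submodule.m_closed[OF assms])
  qed
qed (rule M.abelian_group_axioms)

lemma coset_eq_iff:
  assumes K: "submodule R K M" and x: "x \<in> carrier M" and y: "y \<in> carrier M"
  shows "K +>\<^bsub>M\<^esub> x = K +>\<^bsub>M\<^esub> y \<longleftrightarrow> x \<ominus>\<^bsub>M\<^esub> y \<in> K"
proof -
  interpret K: abelian_subgroup K M by (rule submodule_abelian_subgroup[OF K])
  have "K +>\<^bsub>M\<^esub> x = K +>\<^bsub>M\<^esub> y \<longleftrightarrow> x \<in> K +>\<^bsub>M\<^esub> y"
    using K.a_repr_independence'[of x y] K.a_rcos_self[OF x] y by auto
  also have "\<dots> \<longleftrightarrow> x \<ominus>\<^bsub>M\<^esub> y \<in> K"
    using K.a_rcos_module[OF y x] by (simp add: M.minus_eq)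
  finally show ?thesis .
qed

lemma carrier_quotient_module:
  "carrier (quotient_module R M K) = (\<lambda>x. K +>\<^bsub>M\<^esub> x) ` carrier M"
  by (auto simp: quotient_module_def A_RCOSETS_def' a_r_coset_def)

lemma add_quotient_module:
  assumes K: "submodule R K M" and x: "x \<in> carrier M" and y: "y \<in> carrier M"
  shows "(K +>\<^bsub>M\<^esub> x) \<oplus>\<^bsub>quotient_module R M K\<^esub> (K +>\<^bsub>M\<^esub> y) = K +>\<^bsub>M\<^esub> (x \<oplus>\<^bsub>M\<^esub> y)"
  using abelian_subgroup.a_rcos_sum[OF submodule_abelian_subgroup[OF K] x y]
  by (simp add: quotient_module_def)

lemma smult_quotient_module:
  assumes K: "submodule R K M" and x: "x \<in> carrier M" and r: "r \<in> carrier R"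
  shows "r \<odot>\<^bsub>quotient_module R M K\<^esub> (K +>\<^bsub>M\<^esub> x) = K +>\<^bsub>M\<^esub> (r \<odot>\<^bsub>M\<^esub> x)"
proof -
  interpret K: abelian_subgroup K M by (rule submodule_abelian_subgroup[OF K])
  have "K +>\<^bsub>M\<^esub> (r \<odot>\<^bsub>M\<^esub> y) = K +>\<^bsub>M\<^esub> (r \<odot>\<^bsub>M\<^esub> x)" if y: "y \<in> K +>\<^bsub>M\<^esub> x" for y
  proof -
    have yc: "y \<in> carrier M" by (rule K.a_elemrcos_carrier[OF x y])
    have "y \<ominus>\<^bsub>M\<^esub> x \<in> K" using K.a_rcos_module_imp[OF x y] by (simp add: M.minus_eq)
    then have "r \<odot>\<^bsub>M\<^esub> (y \<ominus>\<^bsub>M\<^esub> x) \<in> K" by (rule submodule.smult_closed[OF K r])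
    then have "r \<odot>\<^bsub>M\<^esub> y \<ominus>\<^bsub>M\<^esub> r \<odot>\<^bsub>M\<^esub> x \<in> K"
      using r x yc by (simp add: M.minus_eq smult_r_distr smult_r_minus)
    then show ?thesis using coset_eq_iff[OF K] r x yc by simp
  qed
  moreover have "K +>\<^bsub>M\<^esub> x \<noteq> {}" using K.a_rcos_self[OF x] by blast
  ultimately have "(\<Union>y\<in>K +>\<^bsub>M\<^esub> x. K +>\<^bsub>M\<^esub> (r \<odot>\<^bsub>M\<^esub> y)) = K +>\<^bsub>M\<^esub> (r \<odot>\<^bsub>M\<^esub> x)"
    by (intro SUP_eq_const)
  then show ?thesis by (simp add: quotient_module_def)
qed

text \<open>The first isomorphism theorem in both directions. It replaces an isomorphism with the
  quotient by a surjection from M with kernel \<open>K\<close>, so that tensor products can be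
  studied through maps out of a free module.\<close>

lemma quotient_module_isomorphic_iff:
  assumes K: "submodule R K M" and L: "module R L"
  shows "module_isomorphic R L (quotient_module R M K) \<longleftrightarrow>
    (\<exists>\<tau>\<in>module_hom R M L. \<tau> ` carrier M = carrier L \<and> (\<forall>x\<in>carrier M. \<tau> x = \<zero>\<^bsub>L\<^esub> \<longleftrightarrow> x \<in> K))"
proof
  let ?Q = "quotient_module R M K"
  interpret L: module R L by (rule L)
  note Q = add_quotient_module[OF K] smult_quotient_module[OF K]
  assume "module_isomorphic R L ?Q"
  from module_isomorphic_sym[OF L this]
  obtain f where f: "f \<in> module_hom R ?Q L" and bij: "bij_betw f (carrier ?Q) (carrier L)"
    unfolding module_isomorphic_def by blast
  have c: "K +>\<^bsub>M\<^esub> x \<in> carrier ?Q" if "x \<in> carrier M" for x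
    using that by (simp add: carrier_quotient_module)
  define \<tau> where "\<tau> x = f (K +>\<^bsub>M\<^esub> x)" for x
  have \<tau>: "\<tau> \<in> module_hom R M L"
  proof (rule module_homI)
    show "\<tau> x \<in> carrier L" if "x \<in> carrier M" for x
      using c[OF that] module_hom_closed[OF f] by (auto simp: \<tau>_def)
    show "\<tau> (x \<oplus>\<^bsub>M\<^esub> y) = \<tau> x \<oplus>\<^bsub>L\<^esub> \<tau> y" if "x \<in> carrier M" "y \<in> carrier M" for x y
      using module_hom_add[OF f c[OF that(1)] c[OF that(2)]] that by (simp add: \<tau>_def Q)
    show "\<tau> (r \<odot>\<^bsub>M\<^esub> x) = r \<odot>\<^bsub>L\<^esub> \<tau> x" if "r \<in> carrier R" "x \<in> carrier M" for r x
      using module_hom_smult[OF f that(1) c[OF that(2)]] that by (simp add: \<tau>_def Q)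
  qed
  interpret \<tau>: mod_hom R M L \<tau> by (rule mod_homI[OF module_axioms L \<tau>])
  have "\<tau> ` carrier M = carrier L"
    using bij by (auto simp: \<tau>_def bij_betw_def carrier_quotient_module image_image)
  moreover have "\<tau> x = \<zero>\<^bsub>L\<^esub> \<longleftrightarrow> x \<in> K" if x: "x \<in> carrier M" for x
  proof -
    have "\<tau> x = \<zero>\<^bsub>L\<^esub> \<longleftrightarrow> \<tau> x = \<tau> \<zero>\<^bsub>M\<^esub>" by simp
    also have "\<dots> \<longleftrightarrow> K +>\<^bsub>M\<^esub> x = K +>\<^bsub>M\<^esub> \<zero>\<^bsub>M\<^esub>"
      using bij c[OF x] c[OF M.zero_closed] unfolding \<tau>_def bij_betw_def by (auto dest: inj_onD)
    also have "\<dots> \<longleftrightarrow> x \<in> K" using coset_eq_iff[OF K x M.zero_closed] x M.add.inv_one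
      by (simp add: M.minus_eq a_inv_def)
    finally show ?thesis .
  qed
  ultimately show "\<exists>\<tau>\<in>module_hom R M L. \<tau> ` carrier M = carrier L \<and> (\<forall>x\<in>carrier M. \<tau> x = \<zero>\<^bsub>L\<^esub> \<longleftrightarrow> x \<in> K)"
    using \<tau> by blast
next
  let ?Q = "quotient_module R M K"
  interpret L: module R L by (rule L)
  note Q = add_quotient_module[OF K] smult_quotient_module[OF K]
  assume "\<exists>\<tau>\<in>module_hom R M L. \<tau> ` carrier M = carrier L \<and> (\<forall>x\<in>carrier M. \<tau> x = \<zero>\<^bsub>L\<^esub> \<longleftrightarrow> x \<in> K)"
  then obtain \<tau> where \<tau>: "\<tau> \<in> module_hom R M L" and surj: "\<tau> ` carrier M = carrier L"
    and ker: "\<And>x. x \<in> carrier M \<Longrightarrow> \<tau> x = \<zero>\<^bsub>L\<^esub> \<longleftrightarrow> x \<in> K" by blast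
  interpret \<tau>: mod_hom R M L \<tau> by (rule mod_homI[OF module_axioms L \<tau>])
  have eq: "K +>\<^bsub>M\<^esub> x = K +>\<^bsub>M\<^esub> y \<longleftrightarrow> \<tau> x = \<tau> y" if "x \<in> carrier M" "y \<in> carrier M" for x y
  proof -
    have "K +>\<^bsub>M\<^esub> x = K +>\<^bsub>M\<^esub> y \<longleftrightarrow> \<tau> (x \<ominus>\<^bsub>M\<^esub> y) = \<zero>\<^bsub>L\<^esub>"
      using that ker[of "x \<ominus>\<^bsub>M\<^esub> y"] coset_eq_iff[OF K that] by simp
    also have "\<dots> \<longleftrightarrow> \<tau> x = \<tau> y" using that by simp
    finally show ?thesis .
  qed
  \<comment> \<open>The inverse sends \<open>l\<close> to the coset of a chosen preimage. The choice
    is harmless because, by \<open>eq\<close>, elements with the same image have the same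
    coset.\<close>
  define g where "g l = inv_into (carrier M) \<tau> l" for l
  have g: "g l \<in> carrier M" "\<tau> (g l) = l" if "l \<in> carrier L" for l
    using that surj unfolding g_def by (auto simp: inv_into_into f_inv_into_f)
  define \<sigma> where "\<sigma> l = K +>\<^bsub>M\<^esub> g l" for l
  have \<sigma>\<tau>: "\<sigma> (\<tau> x) = K +>\<^bsub>M\<^esub> x" if "x \<in> carrier M" for x
    unfolding \<sigma>_def using that g[OF \<tau>.f_im[OF that]] by (subst eq) simp_all
  have "\<sigma> \<in> module_hom R L ?Q"
  proof (rule module_homI)
    show "\<sigma> l \<in> carrier ?Q" if "l \<in> carrier L" for l
      using g(1)[OF that] by (simp add: \<sigma>_def carrier_quotient_module)
    show "\<sigma> (l \<oplus>\<^bsub>L\<^esub> l') = \<sigma> l \<oplus>\<^bsub>?Q\<^esub> \<sigma> l'" if "l \<in> carrier L" "l' \<in> carrier L" for l l'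
      using \<sigma>\<tau>[of "g l \<oplus>\<^bsub>M\<^esub> g l'"] g[OF that(1)] g[OF that(2)] by (simp add: Q) (simp add: \<sigma>_def Q)
    show "\<sigma> (r \<odot>\<^bsub>L\<^esub> l) = r \<odot>\<^bsub>?Q\<^esub> \<sigma> l" if "r \<in> carrier R" "l \<in> carrier L" for r l
      using \<sigma>\<tau>[of "r \<odot>\<^bsub>M\<^esub> g l"] g[OF that(2)] that(1) by (simp add: Q) (simp add: \<sigma>_def Q)
  qed
  moreover have "bij_betw \<sigma> (carrier L) (carrier ?Q)"
    unfolding bij_betw_def
  proof
    show "inj_on \<sigma> (carrier L)"
    proof (rule inj_onI)
      fix l l' assume l: "l \<in> carrier L" "l' \<in> carrier L" and "\<sigma> l = \<sigma> l'"
      then have "\<tau> (g l) = \<tau> (g l')" using eq[OF g(1)[OF l(1)] g(1)[OF l(2)]] by (simp add: \<sigma>_def)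
      then show "l = l'" using l by (simp add: g)
    qed
    show "\<sigma> ` carrier L = carrier ?Q"
      unfolding surj[symmetric] carrier_quotient_module image_image by (rule image_cong[OF refl \<sigma>\<tau>])
  qed
  ultimately show "module_isomorphic R L ?Q" unfolding module_isomorphic_def by blast
qed

end

section \<open>Tensor products and bilinear maps\<close>

context cring
begin

lemma tensor_relations_subset:
  assumes "module R M" and "module R N"
  shows "tensor_relations R M N \<subseteq> carrier (free_module R (carrier M \<times> carrier N))"
proof -
  interpret M: module R M by fact
  interpret N: module R N by fact
  interpret F: module R "free_module R (carrier M \<times> carrier N)" by (rule free_module_is_module)
  show ?thesis unfolding tensor_relations_def Let_def by auto
qed

lemma submodule_tensor_relations:
  assumes "module R M" and "module R N"
  shows "submodule R (module.span R (free_module R (carrier M \<times> carrier N)) (tensor_relations R M N))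
    (free_module R (carrier M \<times> carrier N))"
  by (rule module.span_is_submodule[OF free_module_is_module tensor_relations_subset[OF assms]])

text \<open>Under \<open>h\<close> each of the four families of relations becomes additivity or
  homogeneity in one argument. The direction from bilinearity builds maps on the tensor product, the
  other one extracts the pairing from such a map.\<close>

lemma tensor_relations_killed_iff:
  assumes M: "module R M" and N: "module R N" and L: "module R L"
    and h: "h \<in> module_hom R (free_module R (carrier M \<times> carrier N)) L"
  defines "\<beta> \<equiv> \<lambda>m n. h (unit_vector R (carrier M \<times> carrier N) (m, n))"
  shows "(\<forall>f\<in>tensor_relations R M N. h f = \<zero>\<^bsub>L\<^esub>) \<longleftrightarrow>
    (\<forall>n\<in>carrier N. (\<lambda>m. \<beta> m n) \<in> module_hom R M L) \<and> (\<forall>m\<in>carrier M. \<beta> m \<in> module_hom R N L)"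
    (is "?A \<longleftrightarrow> ?B")
proof -
  let ?I = "carrier M \<times> carrier N"
  let ?F = "free_module R ?I"
  let ?d = "\<lambda>m n. unit_vector R ?I (m, n)"
  interpret M: module R M by fact
  interpret N: module R N by fact
  interpret L: module R L by fact
  interpret F: module R ?F by (rule free_module_is_module)
  interpret h: mod_hom R ?F L h by (rule mod_homI[OF F.module_axioms L h])
  have [simp]: "\<beta> m n \<in> carrier L" if "m \<in> carrier M" "n \<in> carrier N" for m n
    unfolding \<beta>_def using that by simp
  have hr: "h (f \<ominus>\<^bsub>?F\<^esub> g) = \<zero>\<^bsub>L\<^esub> \<longleftrightarrow> h f = h g" if "f \<in> carrier ?F" "g \<in> carrier ?F" for f g
    using that by simp
  have rel1: "h (?d (m \<oplus>\<^bsub>M\<^esub> m') n \<ominus>\<^bsub>?F\<^esub> (?d m n \<oplus>\<^bsub>?F\<^esub> ?d m' n)) = \<zero>\<^bsub>L\<^esub> \<longleftrightarrow>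
      \<beta> (m \<oplus>\<^bsub>M\<^esub> m') n = \<beta> m n \<oplus>\<^bsub>L\<^esub> \<beta> m' n"
    if "m \<in> carrier M" "m' \<in> carrier M" "n \<in> carrier N" for m m' n
    using that by (subst hr) (simp_all add: \<beta>_def)
  have rel2: "h (?d m (n \<oplus>\<^bsub>N\<^esub> n') \<ominus>\<^bsub>?F\<^esub> (?d m n \<oplus>\<^bsub>?F\<^esub> ?d m n')) = \<zero>\<^bsub>L\<^esub> \<longleftrightarrow>
      \<beta> m (n \<oplus>\<^bsub>N\<^esub> n') = \<beta> m n \<oplus>\<^bsub>L\<^esub> \<beta> m n'"
    if "m \<in> carrier M" "n \<in> carrier N" "n' \<in> carrier N" for m n n'
    using that by (subst hr) (simp_all add: \<beta>_def)
  have rel3: "h (?d (r \<odot>\<^bsub>M\<^esub> m) n \<ominus>\<^bsub>?F\<^esub> (r \<odot>\<^bsub>?F\<^esub> ?d m n)) = \<zero>\<^bsub>L\<^esub> \<longleftrightarrow>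
      \<beta> (r \<odot>\<^bsub>M\<^esub> m) n = r \<odot>\<^bsub>L\<^esub> \<beta> m n"
    if "r \<in> carrier R" "m \<in> carrier M" "n \<in> carrier N" for r m n
    using that by (subst hr) (simp_all add: \<beta>_def)
  have rel4: "h (?d m (r \<odot>\<^bsub>N\<^esub> n) \<ominus>\<^bsub>?F\<^esub> (r \<odot>\<^bsub>?F\<^esub> ?d m n)) = \<zero>\<^bsub>L\<^esub> \<longleftrightarrow>
      \<beta> m (r \<odot>\<^bsub>N\<^esub> n) = r \<odot>\<^bsub>L\<^esub> \<beta> m n"
    if "r \<in> carrier R" "m \<in> carrier M" "n \<in> carrier N" for r m n
    using that by (subst hr) (simp_all add: \<beta>_def)
  show ?thesis
  proof
    assume A: ?A
    have in_rel: "?d (m \<oplus>\<^bsub>M\<^esub> m') n \<ominus>\<^bsub>?F\<^esub> (?d m n \<oplus>\<^bsub>?F\<^esub> ?d m' n) \<in> tensor_relations R M N"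
      if "m \<in> carrier M" "m' \<in> carrier M" "n \<in> carrier N" for m m' n
      unfolding tensor_relations_def Let_def using that by blast
    have in_rel2: "?d m (n \<oplus>\<^bsub>N\<^esub> n') \<ominus>\<^bsub>?F\<^esub> (?d m n \<oplus>\<^bsub>?F\<^esub> ?d m n') \<in> tensor_relations R M N"
      if "m \<in> carrier M" "n \<in> carrier N" "n' \<in> carrier N" for m n n'
      unfolding tensor_relations_def Let_def using that by blast
    have in_rel3: "?d (r \<odot>\<^bsub>M\<^esub> m) n \<ominus>\<^bsub>?F\<^esub> (r \<odot>\<^bsub>?F\<^esub> ?d m n) \<in> tensor_relations R M N"
      if "r \<in> carrier R" "m \<in> carrier M" "n \<in> carrier N" for r m n
      unfolding tensor_relations_def Let_def using that by blast
    have in_rel4: "?d m (r \<odot>\<^bsub>N\<^esub> n) \<ominus>\<^bsub>?F\<^esub> (r \<odot>\<^bsub>?F\<^esub> ?d m n) \<in> tensor_relations R M N"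
      if "r \<in> carrier R" "m \<in> carrier M" "n \<in> carrier N" for r m n
      unfolding tensor_relations_def Let_def using that by blast
    show ?B
    proof (intro conjI ballI)
      show "(\<lambda>m. \<beta> m n) \<in> module_hom R M L" if n: "n \<in> carrier N" for n
        using n rel1[THEN iffD1, OF _ _ _ bspec[OF A in_rel]] rel3[THEN iffD1, OF _ _ _ bspec[OF A in_rel3]]
        by (intro module_homI) simp_all
      show "\<beta> m \<in> module_hom R N L" if m: "m \<in> carrier M" for m
        using m rel2[THEN iffD1, OF _ _ _ bspec[OF A in_rel2]] rel4[THEN iffD1, OF _ _ _ bspec[OF A in_rel4]]
        by (intro module_homI) simp_all
    qed
  next
    assume B: ?B
    have "\<beta> (m \<oplus>\<^bsub>M\<^esub> m') n = \<beta> m n \<oplus>\<^bsub>L\<^esub> \<beta> m' n" if "m \<in> carrier M" "m' \<in> carrier M" "n \<in> carrier N" for m m' n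
      using B module_hom_add[of "\<lambda>m. \<beta> m n" R M L m m'] that by blast
    moreover have "\<beta> m (n \<oplus>\<^bsub>N\<^esub> n') = \<beta> m n \<oplus>\<^bsub>L\<^esub> \<beta> m n'" if "m \<in> carrier M" "n \<in> carrier N" "n' \<in> carrier N" for m n n'
      using B module_hom_add[of "\<beta> m" R N L n n'] that by blast
    moreover have "\<beta> (r \<odot>\<^bsub>M\<^esub> m) n = r \<odot>\<^bsub>L\<^esub> \<beta> m n" if "r \<in> carrier R" "m \<in> carrier M" "n \<in> carrier N" for r m n
      using B module_hom_smult[of "\<lambda>m. \<beta> m n" R M L r m] that by blast
    moreover have "\<beta> m (r \<odot>\<^bsub>N\<^esub> n) = r \<odot>\<^bsub>L\<^esub> \<beta> m n" if "r \<in> carrier R" "m \<in> carrier M" "n \<in> carrier N" for r m n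
      using B module_hom_smult[of "\<beta> m" R N L r n] that by blast
    ultimately show ?A
      unfolding tensor_relations_def Let_def using rel1 rel2 rel3 rel4 by (elim UnE CollectE exE conjE ballI | intro ballI)+ (simp_all)
  qed
qed

text \<open>The nested form matches what comes out of expanding a pairing by linearity, first in one
  argument and then in the other.\<close>

lemma bilinear_form_eq_lsum:
  assumes "\<And>i j. a i j \<in> carrier R" "\<And>i. u i \<in> carrier R" "\<And>i. v i \<in> carrier R"
  shows "bilinear_form R n a u v =
    lsum (regular_module R) {..<n} (\<lambda>i. lsum (regular_module R) {..<n} (a i) v) u"
  unfolding bilinear_form_def lsum_def using assms
  by (auto intro!: finsum_cong' simp: finsum_rdistr m_comm)

lemma tensor_product_isomorphic_iff:
  assumes "module R M" and "module R N" and "module R L"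
  shows "module_isomorphic R L (tensor_product R M N) \<longleftrightarrow>
    (\<exists>\<tau>\<in>module_hom R (free_module R (carrier M \<times> carrier N)) L.
      \<tau> ` carrier (free_module R (carrier M \<times> carrier N)) = carrier L \<and>
      (\<forall>f\<in>carrier (free_module R (carrier M \<times> carrier N)). \<tau> f = \<zero>\<^bsub>L\<^esub> \<longleftrightarrow>
        f \<in> module.span R (free_module R (carrier M \<times> carrier N)) (tensor_relations R M N)))"
  unfolding tensor_product_def Let_def
  by (rule module.quotient_module_isomorphic_iff[OF free_module_is_module
        submodule_tensor_relations[OF assms(1,2)] assms(3)])

lemma tensor_span_subset_kernel:
  assumes "module R M" and "module R N" and "module R L"
    and h: "h \<in> module_hom R (free_module R (carrier M \<times> carrier N)) L"
    and rel: "\<And>f. f \<in> tensor_relations R M N \<Longrightarrow> h f = \<zero>\<^bsub>L\<^esub>"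
    and f: "f \<in> module.span R (free_module R (carrier M \<times> carrier N)) (tensor_relations R M N)"
  shows "h f = \<zero>\<^bsub>L\<^esub>"
proof -
  let ?F = "free_module R (carrier M \<times> carrier N)"
  interpret h: mod_hom R ?F L h by (rule mod_homI[OF free_module_is_module assms(3) h])
  have "tensor_relations R M N \<subseteq> h.ker"
    using tensor_relations_subset[OF assms(1,2)] rel by (auto simp: h.ker_def)
  then have "f \<in> h.ker" using h.M.span_is_subset[OF _ h.ker_is_submodule] f by blast
  then show ?thesis by (rule h.f_ker)
qed

lemma invertible_module_isomorphic_regular:
  assumes R: "represents_units R" and M: "module R M" and N: "module R N"
    and inv: "module_isomorphic R (regular_module R) (tensor_product R M N)"
  shows "module_isomorphic R M (regular_module R)"
proof -
  let ?I = "carrier M \<times> carrier N"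
  let ?F = "free_module R ?I"
  let ?d = "\<lambda>m n. unit_vector R ?I (m, n)"
  let ?S = "module.span R ?F (tensor_relations R M N)"
  let ?R = "regular_module R"
  interpret M: module R M by fact
  interpret N: module R N by fact
  interpret F: module R ?F by (rule free_module_is_module)
  interpret reg: module R ?R by (rule regular_module_is_module)
  obtain \<tau> where \<tau>: "\<tau> \<in> module_hom R ?F ?R" and surj: "\<tau> ` carrier ?F = carrier R"
    and ker: "\<And>f. f \<in> carrier ?F \<Longrightarrow> \<tau> f = \<zero> \<longleftrightarrow> f \<in> ?S"
    using inv unfolding tensor_product_isomorphic_iff[OF M N regular_module_is_module] by auto
  interpret \<tau>: mod_hom R ?F ?R \<tau> by (rule mod_homI[OF F.module_axioms reg.module_axioms \<tau>])
  note rel_sub = tensor_relations_subset[OF M N]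
  define \<beta> where "\<beta> m n = \<tau> (?d m n)" for m n
  have "\<forall>f\<in>tensor_relations R M N. \<tau> f = \<zero>\<^bsub>?R\<^esub>"
    using rel_sub F.in_own_span[OF rel_sub] ker by auto
  then have \<beta>1: "\<And>n. n \<in> carrier N \<Longrightarrow> (\<lambda>m. \<beta> m n) \<in> module_hom R M ?R"
    and \<beta>2: "\<And>m. m \<in> carrier M \<Longrightarrow> \<beta> m \<in> module_hom R N ?R"
    unfolding tensor_relations_killed_iff[OF M N reg.module_axioms \<tau>] \<beta>_def by auto
  have \<beta>c [simp]: "\<beta> m n \<in> carrier R" if "m \<in> carrier M" "n \<in> carrier N" for m n
    using M.linear_form_closed[OF \<beta>1] that by simp
  \<comment> \<open>A preimage of 1 under \<open>\<tau>\<close> is supported on finitely many pairs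
    \<open>(p i, q i)\<close>, so the values \<open>\<beta> (p i) (q i)\<close> already generate the
    unit ideal. They are the diagonal of the matrix to which \<open>represents_units\<close> is
    applied.\<close>
  obtain x y where x [simp]: "x \<in> carrier M" and y [simp]: "y \<in> carrier N" and xy: "\<beta> x y = \<one>"
  proof -
    obtain f where f: "f \<in> carrier ?F" and \<tau>f: "\<tau> f = \<one>"
      using surj one_closed by (metis (no_types, lifting) imageE)
    obtain J where J: "finite J" "J \<subseteq> ?I" and fJ: "lsum ?F J (unit_vector R ?I) f = f"
      using free_module_support[OF f] by metis
    obtain h where h: "bij_betw h {..<card J} J"
      using ex_bij_betw_nat_finite[OF J(1)] by (auto simp: atLeast0LessThan)
    have hJ: "h i \<in> ?I" if "i < card J" for i using h that J(2) by (auto simp: bij_betw_def)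
    define p q where "p i = (if i < card J then fst (h i) else \<zero>\<^bsub>M\<^esub>)"
      and "q i = (if i < card J then snd (h i) else \<zero>\<^bsub>N\<^esub>)" for i
    have [simp]: "p i \<in> carrier M" "q i \<in> carrier N" for i
      using hJ[of i] by (auto simp: p_def q_def mem_Times_iff)
    let ?T = "{\<beta> (p i) (q j) | i j. i < card J \<and> j < card J}"
    have T: "?T \<subseteq> carrier R" by auto
    interpret T: ideal "Idl ?T" R by (rule genideal_ideal[OF T])
    have "\<tau> f = lsum ?R J (\<lambda>k. \<tau> (unit_vector R ?I k)) f"
      using J f by (subst fJ[symmetric], subst \<tau>.hom_lsum) auto
    also have "\<dots> \<in> Idl ?T"
    proof (rule T.lsum_mem_ideal[OF is_cring])
      fix k assume k: "k \<in> J"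
      show "\<tau> (unit_vector R ?I k) \<in> carrier R" using k J \<tau>.f_im by auto
      show "f k \<in> carrier R" using k J f by auto
      have "k \<in> h ` {..<card J}" using h k by (simp add: bij_betw_def)
      then obtain i where i: "i < card J" "h i = k" by auto
      then have "\<tau> (unit_vector R ?I k) = \<beta> (p i) (q i)" by (simp add: \<beta>_def p_def q_def)
      then have "\<tau> (unit_vector R ?I k) \<in> ?T" using i by blast
      then show "\<tau> (unit_vector R ?I k) \<in> Idl ?T \<or> f k \<in> Idl ?T"
        using genideal_self[OF T] by blast
    qed
    finally have gen: "Idl ?T = carrier R" unfolding \<tau>f by (rule T.one_imp_carrier)
    have \<beta>pq: "\<beta> (p i) (q j) \<in> carrier R" for i j by simp
    obtain u v where [simp]: "\<And>i. u i \<in> carrier R" "\<And>i. v i \<in> carrier R"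
      and unit: "bilinear_form R (card J) (\<lambda>i j. \<beta> (p i) (q j)) u v \<in> Units R"
      using represents_unitsE[OF R \<beta>pq gen] by blast
    define x0 y where "x0 = lsum M {..<card J} p u" and "y = lsum N {..<card J} q v"
    have x0: "x0 \<in> carrier M" and y: "y \<in> carrier N" by (simp_all add: x0_def y_def)
    interpret \<phi>: mod_hom R M ?R "\<lambda>m. \<beta> m y" by (rule M.linear_form_hom[OF \<beta>1[OF y]])
    have "\<beta> m y = lsum ?R {..<card J} (\<lambda>j. \<beta> m (q j)) v" if m: "m \<in> carrier M" for m
    proof -
      interpret \<beta>m: mod_hom R N ?R "\<beta> m" by (rule N.linear_form_hom[OF \<beta>2[OF m]])
      show ?thesis unfolding y_def by (rule \<beta>m.hom_lsum) simp_all
    qed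
    then have "\<beta> x0 y = lsum ?R {..<card J} (\<lambda>i. lsum ?R {..<card J} (\<lambda>j. \<beta> (p i) (q j)) v) u"
      unfolding x0_def by (subst \<phi>.hom_lsum) simp_all
    then have unit: "\<beta> x0 y \<in> Units R" using unit by (simp add: bilinear_form_eq_lsum)
    show thesis
    proof (rule that[OF _ y])
      show "inv (\<beta> x0 y) \<odot>\<^bsub>M\<^esub> x0 \<in> carrier M" using unit x0 by simp
      show "\<beta> (inv (\<beta> x0 y) \<odot>\<^bsub>M\<^esub> x0) y = \<one>" using unit x0 by simp
    qed
  qed
  \<comment> \<open>Here \<open>proj m\<close> is \<open>m\<close> minus \<open>\<beta> m y\<close>
    times \<open>x\<close>; the aim is to show that it vanishes.\<close>
  interpret split_module R M x "\<lambda>m. \<beta> m y"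
    by unfold_locales (simp_all add: \<beta>1 xy)
  let ?w = "?d x y"
  have w: "?w \<in> carrier ?F" and \<tau>w: "\<tau> ?w = \<one>" using xy by (simp_all add: \<beta>_def)
  have "\<beta> x (snd k) \<odot>\<^bsub>M\<^esub> proj (fst k) \<in> carrier M" if "k \<in> ?I" for k using that by auto
  then obtain h where h: "h \<in> module_hom R ?F M"
    and hd: "\<And>k. k \<in> ?I \<Longrightarrow> h (unit_vector R ?I k) = \<beta> x (snd k) \<odot>\<^bsub>M\<^esub> proj (fst k)"
    using M.free_module_lift[of ?I "\<lambda>k. \<beta> x (snd k) \<odot>\<^bsub>M\<^esub> proj (fst k)"] by blast
  interpret h: mod_hom R ?F M h by (rule mod_homI[OF F.module_axioms M h])
  have "\<forall>f\<in>tensor_relations R M N. h f = \<zero>\<^bsub>M\<^esub>"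
    unfolding tensor_relations_killed_iff[OF M N M h]
  proof (intro conjI ballI)
    show "(\<lambda>m. h (?d m n)) \<in> module_hom R M M" if "n \<in> carrier N" for n
      using that by (intro module_homI) (simp_all add: hd M.smult_r_distr M.smult_assoc1[symmetric] m_comm)
    show "(\<lambda>n. h (?d m n)) \<in> module_hom R N M" if "m \<in> carrier M" for m
      using that module_hom_add[OF \<beta>2[OF x]] module_hom_smult[OF \<beta>2[OF x]]
      by (intro module_homI) (simp_all add: hd M.smult_l_distr M.smult_assoc1)
  qed
  then have hS: "h f = \<zero>\<^bsub>M\<^esub>" if "f \<in> ?S" for f
    using tensor_span_subset_kernel[OF M N M h _ that] by blast
  \<comment> \<open>Because \<open>\<tau> ?w\<close> is 1, subtracting \<open>\<tau> f\<close> times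
    \<open>?w\<close> moves \<open>f\<close> into the kernel \<open>?S\<close>, where
    \<open>h\<close> vanishes. So \<open>h f\<close> is a multiple of \<open>h ?w\<close>, which is
    0 because \<open>proj x\<close> is 0.\<close>
  have h0: "h f = \<zero>\<^bsub>M\<^esub>" if f: "f \<in> carrier ?F" for f
  proof -
    have \<tau>fc: "\<tau> f \<in> carrier R" using \<tau>.f_im[OF f] by simp
    have g: "f \<ominus>\<^bsub>?F\<^esub> \<tau> f \<odot>\<^bsub>?F\<^esub> ?w \<in> carrier ?F" using f w \<tau>fc by simp
    have "\<tau> (f \<ominus>\<^bsub>?F\<^esub> \<tau> f \<odot>\<^bsub>?F\<^esub> ?w) = \<zero>" using f w \<tau>fc \<tau>w by simp
    then have "h (f \<ominus>\<^bsub>?F\<^esub> \<tau> f \<odot>\<^bsub>?F\<^esub> ?w) = \<zero>\<^bsub>M\<^esub>" using hS ker[OF g] by blast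
    then have "h f = \<tau> f \<odot>\<^bsub>M\<^esub> h ?w" using f w \<tau>fc by simp
    also have "h ?w = \<zero>\<^bsub>M\<^esub>" by (simp add: hd proj_x)
    finally show ?thesis using \<tau>fc by simp
  qed
  \<comment> \<open>On the generator at \<open>(z, y)\<close> the scalar factor of \<open>h\<close>
    is \<open>\<beta> x y\<close>, that is 1, so its value there is \<open>proj z\<close>.\<close>
  have proj0: "proj z = \<zero>\<^bsub>M\<^esub>" if z: "z \<in> carrier M" for z
    using h0[of "?d z y"] z hd[of "(z, y)"] xy by simp
  have dec: "z = \<beta> z y \<odot>\<^bsub>M\<^esub> x" if z: "z \<in> carrier M" for z
    using decompose[OF z] proj0[OF z] z by simp
  have "bij_betw (\<lambda>m. \<beta> m y) (carrier M) (carrier ?R)"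
    unfolding bij_betw_def
  proof
    show "inj_on (\<lambda>m. \<beta> m y) (carrier M)"
      by (rule inj_onI) (metis dec)
    show "(\<lambda>m. \<beta> m y) ` carrier M = carrier ?R"
    proof (intro equalityI subsetI)
      fix r assume "r \<in> carrier ?R"
      then have "r = \<beta> (r \<odot>\<^bsub>M\<^esub> x) y" "r \<odot>\<^bsub>M\<^esub> x \<in> carrier M" using xy by simp_all
      then show "r \<in> (\<lambda>m. \<beta> m y) ` carrier M" by (rule image_eqI)
    qed auto
  qed
  with \<beta>1[OF y] show ?thesis unfolding module_isomorphic_def by blast
qed

text \<open>This makes the class of the regular module idempotent in the monoid of classes. The map
  is multiplication of the coordinates \<open>f\<close> and \<open>g\<close>; the substance is that
  its kernel is no larger than the span of the tensor relations.\<close>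

lemma tensor_product_regular:
  assumes M: "module R M" and N: "module R N"
    and "module_isomorphic R M (regular_module R)" and "module_isomorphic R N (regular_module R)"
  shows "module_isomorphic R (regular_module R) (tensor_product R M N)"
proof -
  let ?I = "carrier M \<times> carrier N"
  let ?F = "free_module R ?I"
  let ?d = "\<lambda>m n. unit_vector R ?I (m, n)"
  let ?S = "module.span R ?F (tensor_relations R M N)"
  let ?R = "regular_module R"
  interpret M: module R M by fact
  interpret N: module R N by fact
  interpret F: module R ?F by (rule free_module_is_module)
  interpret reg: module R ?R by (rule regular_module_is_module)
  obtain f where f: "f \<in> module_hom R M ?R" and fb: "bij_betw f (carrier M) (carrier R)"
    using assms(3) unfolding module_isomorphic_def by auto
  obtain g where g: "g \<in> module_hom R N ?R" and gb: "bij_betw g (carrier N) (carrier R)"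
    using assms(4) unfolding module_isomorphic_def by auto
  have fc [simp]: "f m \<in> carrier R" if "m \<in> carrier M" for m using M.linear_form_closed[OF f that] .
  have gc [simp]: "g n \<in> carrier R" if "n \<in> carrier N" for n using N.linear_form_closed[OF g that] .
  have "\<one> \<in> f ` carrier M" "\<one> \<in> g ` carrier N" using fb gb by (simp_all add: bij_betw_def)
  then obtain x y where x [simp]: "x \<in> carrier M" "f x = \<one>" and y [simp]: "y \<in> carrier N" "g y = \<one>"
    by (metis imageE)
  have fx: "f m \<odot>\<^bsub>M\<^esub> x = m" if "m \<in> carrier M" for m
    using inj_onD[of f "carrier M" "f m \<odot>\<^bsub>M\<^esub> x" m] fb that module_hom_smult[OF f fc[OF that] x(1)]
    by (simp add: bij_betw_def)
  have gy: "g n \<odot>\<^bsub>N\<^esub> y = n" if "n \<in> carrier N" for n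
    using inj_onD[of g "carrier N" "g n \<odot>\<^bsub>N\<^esub> y" n] gb that module_hom_smult[OF g gc[OF that] y(1)]
    by (simp add: bij_betw_def)
  have "f (fst k) \<otimes> g (snd k) \<in> carrier ?R" if "k \<in> ?I" for k using that by auto
  then obtain \<tau> where \<tau>: "\<tau> \<in> module_hom R ?F ?R"
    and \<tau>d: "\<And>k. k \<in> ?I \<Longrightarrow> \<tau> (unit_vector R ?I k) = f (fst k) \<otimes> g (snd k)"
    using reg.free_module_lift[of ?I "\<lambda>k. f (fst k) \<otimes> g (snd k)"] by blast
  have "\<forall>k\<in>tensor_relations R M N. \<tau> k = \<zero>\<^bsub>?R\<^esub>"
    unfolding tensor_relations_killed_iff[OF M N reg.module_axioms \<tau>]
  proof (intro conjI ballI)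
    show "(\<lambda>m. \<tau> (?d m n)) \<in> module_hom R M ?R" if "n \<in> carrier N" for n
      using that module_hom_add[OF f] module_hom_smult[OF f]
      by (intro module_homI) (simp_all add: \<tau>d l_distr m_assoc)
    show "(\<lambda>n. \<tau> (?d m n)) \<in> module_hom R N ?R" if "m \<in> carrier M" for m
      using that module_hom_add[OF g] module_hom_smult[OF g]
      by (intro module_homI) (simp_all add: \<tau>d r_distr m_lcomm)
  qed
  then have \<tau>S: "\<tau> k = \<zero>" if "k \<in> ?S" for k
    using tensor_span_subset_kernel[OF M N reg.module_axioms \<tau> _ that] by simp
  let ?w = "?d x y"
  interpret T: split_module R ?F ?w \<tau>
    by unfold_locales (simp_all add: \<tau> \<tau>d)
  note rel_sub = tensor_relations_subset[OF M N]
  have S: "submodule R ?S ?F" by (rule submodule_tensor_relations[OF M N])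
  have rel: "k \<in> ?S" if "k \<in> tensor_relations R M N" for k
    using F.in_own_span[OF rel_sub] that by blast
  \<comment> \<open>Modulo the relations the generator at \<open>(m, n)\<close> equals
    \<open>f m\<close> times the one at \<open>(x, n)\<close>, and this equals
    \<open>f m \<otimes> g n\<close> times \<open>?w\<close>. The difference of the two ends is the
    projection of the generator.\<close>
  have projd: "T.proj (?d m n) \<in> ?S" if m: "m \<in> carrier M" and n: "n \<in> carrier N" for m n
  proof -
    have "?d (f m \<odot>\<^bsub>M\<^esub> x) n \<ominus>\<^bsub>?F\<^esub> f m \<odot>\<^bsub>?F\<^esub> ?d x n \<in> tensor_relations R M N"
      unfolding tensor_relations_def Let_def using m n x(1) fc[OF m] by blast
    then have 1: "?d m n \<ominus>\<^bsub>?F\<^esub> f m \<odot>\<^bsub>?F\<^esub> ?d x n \<in> ?S" using rel fx[OF m] by simp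
    have "?d x (g n \<odot>\<^bsub>N\<^esub> y) \<ominus>\<^bsub>?F\<^esub> g n \<odot>\<^bsub>?F\<^esub> ?w \<in> tensor_relations R M N"
      unfolding tensor_relations_def Let_def using n x(1) y(1) gc[OF n] by blast
    then have "?d x n \<ominus>\<^bsub>?F\<^esub> g n \<odot>\<^bsub>?F\<^esub> ?w \<in> ?S" using rel gy[OF n] by simp
    then have "f m \<odot>\<^bsub>?F\<^esub> (?d x n \<ominus>\<^bsub>?F\<^esub> g n \<odot>\<^bsub>?F\<^esub> ?w) \<in> ?S"
      by (rule submodule.smult_closed[OF S fc[OF m]])
    with 1 have "(?d m n \<ominus>\<^bsub>?F\<^esub> f m \<odot>\<^bsub>?F\<^esub> ?d x n) \<oplus>\<^bsub>?F\<^esub>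
        f m \<odot>\<^bsub>?F\<^esub> (?d x n \<ominus>\<^bsub>?F\<^esub> g n \<odot>\<^bsub>?F\<^esub> ?w) \<in> ?S"
      by (rule submodule.m_closed[OF S])
    also have "(?d m n \<ominus>\<^bsub>?F\<^esub> f m \<odot>\<^bsub>?F\<^esub> ?d x n) \<oplus>\<^bsub>?F\<^esub>
        f m \<odot>\<^bsub>?F\<^esub> (?d x n \<ominus>\<^bsub>?F\<^esub> g n \<odot>\<^bsub>?F\<^esub> ?w) = T.proj (?d m n)"
      using m n by (simp add: T.proj_def \<tau>d F.minus_eq F.smult_r_distr F.smult_r_minus
          F.smult_assoc1 F.a_assoc F.r_neg1)
    finally show ?thesis .
  qed
  have "k \<in> ?S" if k: "k \<in> carrier ?F" and k0: "\<tau> k = \<zero>" for k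
  proof -
    obtain J where J: "finite J" "J \<subseteq> ?I" and kJ: "lsum ?F J (unit_vector R ?I) k = k"
      using free_module_support[OF k] by metis
    \<comment> \<open>An element of the kernel is fixed by the projection, so it is a combination of
      projected generators, all of which lie in \<open>?S\<close>.\<close>
    have "k = T.proj k" using T.proj_id[of k] k k0 by (simp add: T.complement_def)
    also have "\<dots> = lsum ?F J (\<lambda>i. T.proj (unit_vector R ?I i)) k"
      using J k by (subst kJ[symmetric], subst T.proj.hom_lsum) auto
    also have "\<dots> \<in> ?S"
      using J k projd by (intro F.lsum_mem_submodule[OF S]) auto
    finally show ?thesis .
  qed
  moreover have "\<tau> ` carrier ?F = carrier ?R"
  proof (intro equalityI subsetI)
    fix r assume "r \<in> carrier ?R"
    then have "r = \<tau> (r \<odot>\<^bsub>?F\<^esub> ?w)" "r \<odot>\<^bsub>?F\<^esub> ?w \<in> carrier ?F" by simp_all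
    then show "r \<in> \<tau> ` carrier ?F" by (rule image_eqI)
  qed (use T.\<phi>.f_im in auto)
  ultimately show ?thesis
    unfolding tensor_product_isomorphic_iff[OF M N reg.module_axioms]
    using \<tau> \<tau>S by (intro bexI[of _ \<tau>] conjI ballI iffI) auto
qed

text \<open>Isomorphism classes consist of modules on the type \<open>nat \<Rightarrow> 'a\<close>.
  For a natural number \<open>i\<close> this gives a copy of the regular module on that type, which
  shows that its class is inhabited.\<close>

lemma free_module_rank_one: "module_isomorphic R (free_module R {i}) (regular_module R)"
proof -
  let ?F = "free_module R {i}"
  have "(\<lambda>f. f i) \<in> module_hom R ?F (regular_module R)"
    by (rule module_homI) (simp_all add: add_free_module smult_free_module)
  moreover have "bij_betw (\<lambda>f. f i) (carrier ?F) (carrier (regular_module R))"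
    unfolding bij_betw_def
  proof
    show "inj_on (\<lambda>f. f i) (carrier ?F)"
      by (rule inj_onI) (auto simp: carrier_free_module intro: PiE_ext)
    show "(\<lambda>f. f i) ` carrier ?F = carrier (regular_module R)"
    proof (intro equalityI subsetI)
      fix r assume "r \<in> carrier (regular_module R)"
      then have "(\<lambda>j\<in>{i}. r) \<in> carrier ?F" by (auto simp: carrier_free_module)
      then show "r \<in> (\<lambda>f. f i) ` carrier ?F" by (rule rev_image_eqI) simp
    qed auto
  qed
  ultimately show ?thesis unfolding module_isomorphic_def by blast
qed

section \<open>Triviality of the Picard group\<close>

lemma module_class_eqI:
  assumes "module R M" and "module_isomorphic R M N"
  shows "module_class R M = module_class R N"
proof -
  have "module_isomorphic R L M \<longleftrightarrow> module_isomorphic R L N" for L :: "('a, nat \<Rightarrow> 'a) module"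
    using module_isomorphic_trans[OF _ assms(2)]
      module_isomorphic_trans[OF _ module_isomorphic_sym[OF assms]] by blast
  then show ?thesis by (simp add: module_class_def)
qed

theorem picard_group_trivial:
  assumes R: "represents_units R"
  shows "trivial_group (picard_group R)"
proof -
  let ?R = "regular_module R" and ?G = "module_class_monoid R"
  let ?one = "module_class R ?R"
  let ?F = "free_module R {0 :: nat}"
  have F: "module R ?F" "module_isomorphic R ?F ?R"
    by (rule free_module_is_module, rule free_module_rank_one)
  have one: "\<one>\<^bsub>?G\<^esub> = ?one"
    and mult: "\<And>A B. A \<otimes>\<^bsub>?G\<^esub> B = (\<Union>M\<in>A. \<Union>N\<in>B. module_class R (tensor_product R M N))"
    by (simp_all add: module_class_monoid_def)
  have F_one: "?F \<in> ?one" using F by (simp add: module_class_def)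
  have one_carrier: "?one \<in> carrier ?G"
    using F module_class_eqI[OF F] by (auto simp: module_class_monoid_def)
  have "module_class R (tensor_product R M N) = ?one" if "M \<in> ?one" "N \<in> ?one" for M N
  proof -
    have "module_isomorphic R ?R (tensor_product R M N)"
      using that by (intro tensor_product_regular) (auto simp: module_class_def)
    from module_class_eqI[OF regular_module_is_module this] show ?thesis ..
  qed
  then have one_one: "?one \<otimes>\<^bsub>?G\<^esub> ?one = ?one" unfolding mult using F_one by blast
  have "A = ?one" if AU: "A \<in> Units ?G" for A
  proof -
    obtain M :: "('a, nat \<Rightarrow> 'a) module" where M: "module R M" and A: "A = module_class R M"
      using AU by (auto simp: Units_def module_class_monoid_def)
    obtain B where "A \<otimes>\<^bsub>?G\<^esub> B = ?one" and "B \<in> carrier ?G"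
      using AU one by (auto simp: Units_def)
    \<comment> \<open>A product of classes is a union of classes. As this union is the class of the
      regular module, it contains the copy \<open>?F\<close>, which singles out one pair of
      representatives whose tensor product is isomorphic to \<open>?F\<close>.\<close>
    then obtain M' N' where M': "M' \<in> A" and N': "N' \<in> B"
      and FT: "?F \<in> module_class R (tensor_product R M' N')"
      using F_one unfolding mult by blast
    have mods: "module R M'" "module R N'" "module_isomorphic R M' M"
      using M' N' A \<open>B \<in> carrier ?G\<close> by (auto simp: module_class_def module_class_monoid_def)
    have "module_isomorphic R ?F (tensor_product R M' N')"
      using FT by (simp add: module_class_def)
    then have "module_isomorphic R ?R (tensor_product R M' N')"
      by (rule module_isomorphic_trans[OF module_isomorphic_sym[OF F]])
    then have "module_isomorphic R M' ?R"
      by (rule invertible_module_isomorphic_regular[OF R mods(1,2)])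
    then show ?thesis
      unfolding A using module_class_eqI[OF mods(1,3)] module_class_eqI[OF mods(1)] by simp
  qed
  moreover have "?one \<in> Units ?G"
    using one_carrier one_one one by (auto simp: Units_def)
  ultimately have U: "Units ?G = {?one}" by blast
  \<comment> \<open>With a single unit, all the group axioms come down to
    \<open>one_one\<close>.\<close>
  have "group (picard_group R)"
    by (rule groupI) (simp_all add: picard_group_def units_of_def U one one_one)
  then show ?thesis by (simp add: trivial_group_def picard_group_def units_of_def U one)
qed

end

theorem proposition5p12:
  fixes R :: "('a, 'r) ring_scheme"
  assumes "cring R" and "\<one>\<^bsub>R\<^esub> \<noteq> \<zero>\<^bsub>R\<^esub>"
    and "J_regular R \<or> primitive_condition R"
  shows "trivial_group (picard_group R) \<and>
    (\<forall>M :: ('a, 'b, 'm) module_scheme.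
       module R M \<and> finitely_generated R M \<and> projective R M \<and> (\<exists>n. has_constant_rank R M n)
         \<longrightarrow> is_free R M)"
proof -
  interpret cring R by fact
  have "represents_units R"
    using assms(2,3) J_regular_represents_units primitive_condition_represents_units by blast
  show ?thesis
  proof (intro conjI allI impI)
    show "trivial_group (picard_group R)" by (rule picard_group_trivial) fact
    fix M :: "('a, 'b, 'm) module_scheme"
    assume "module R M \<and> finitely_generated R M \<and> projective R M \<and> (\<exists>n. has_constant_rank R M n)"
    then obtain n where "module R M" "finitely_generated R M" "projective R M" "has_constant_rank R M n"
      by blast
    then show "is_free R M"
      by (rule constant_rank_projective_is_free[OF \<open>represents_units R\<close>])
  qed
qed

end
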